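(* Let $S$ be a braided surface in a bidisk $D_1^2\times D_2^2$. Then there exists a symplectic surface $S''$ in the standard symplectic $4$-disk $(D^4,\omega_{st})$, whose boundary $\partial S''$ is a transverse link in the standard contact $3$-sphere $(\partial D^4,\xi_{st})$, such that $S''$ is isotopic to $S$.
   Context: $D_1^2$ and $D_2^2$ are oriented closed disks, and $pr_1:D_1^2\times D_2^2\to D_1^2$ is the first projection. A braided surface in $D_1^2\times D_2^2$ is a properly embedded surface $S\subset D_1^2\times D_2^2$ such that: (1) the restriction $pr_1|_S:S\to D_1^2$ is a simple branched covering (its branch points lie over interior points of $D_1^2$, and $\partial S\subset\partial D_1^2\times \mathrm{Int}\,D_2^2$); (2) for each branch point $x\in S$ of $pr_1|_S$ there are complex coordinates $(z,w)$ around $x$ and $\zeta$ around $pr_1(x)$, compatible with the orientations of $D_1^2\times D_2^2$ and $D_1^2$, such that $pr_1$ is written as $\zeta=pr_1(z,w)=z$ and locally $S$ coincides with $\{(z,w) : z=w^2\}$. $D^4=\{(z,w)\in\mathbb{C}^2 : |z|^2+|w|^2\le 1\}$, $\omega_{st}=\frac{\sqrt{-1}}{2}(dz\wedge d\bar z+dw\wedge d\bar w)|_{D^4}$, and $\xi_{st}$ is the kernel of the restriction to $\partial D^4$ of $\alpha=\frac{\sqrt{-1}}{4}(z\,d\bar z-\bar z\,dz+w\,d\bar w-\bar w\,dw)$. A symplectic surface in $(D^4,\omega_{st})$ is a smooth, compact, properly embedded surface on which $\omega_{st}$ restricts to an area form; a transverse link is a link everywhere transverse to $\xi_{st}$ (positively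 with respect to the boundary orientation). "$S''$ is isotopic to $S$" means: after identifying $D_1^2$ and $D_2^2$ with round disks in $\mathbb{C}$ centered at the origin by orientation-preserving diffeomorphisms, and identifying the bidisk $D_1^2\times D_2^2\subset\mathbb{C}^2$ (with corners rounded) with $D^4$ in the standard radial way, the surfaces $S$ and $S''$ are ambient isotopic in $D^4$. *)

theory Defs
  imports "HOL-Analysis.Analysis"
begin

section \<open>Smooth maps between subsets of Euclidean spaces\<close>

fun Ck_on :: "nat \<Rightarrow> ('a::euclidean_space \<Rightarrow> 'b::real_normed_vector) \<Rightarrow> 'a set \<Rightarrow> bool" where
  "Ck_on 0 f U = continuous_on U f"
| "Ck_on (Suc k) f U \<longleftrightarrow> (\<forall>x\<in>U. f differentiable (at x)) \<and>
     (\<forall>v. Ck_on k (\<lambda>x. frechet_derivative f (at x) v) U)"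

text \<open>On a set that need not be open, smooth means: restriction of a smooth map defined on an
  open neighbourhood.\<close>

definition smooth_on :: "'a::euclidean_space set \<Rightarrow> ('a \<Rightarrow> 'b::euclidean_space) \<Rightarrow> bool" where
  "smooth_on A f \<longleftrightarrow>
     (\<exists>W g. open W \<and> A \<subseteq> W \<and> (\<forall>k. Ck_on k g W) \<and> (\<forall>x\<in>A. g x = f x))"

definition diffeo ::
    "('a::euclidean_space \<Rightarrow> 'b::euclidean_space) \<Rightarrow> 'a set \<Rightarrow> 'b set \<Rightarrow> bool" where
  "diffeo f A B \<longleftrightarrow> (\<exists>g. homeomorphism A B f g \<and> smooth_on A f \<and> smooth_on B g)"

text \<open>The Leibniz formula for the determinant of an endomorphism, with respect to the standard
  orthonormal basis.\<close>

definition lin_det :: "('a::euclidean_space \<Rightarrow> 'a) \<Rightarrow> real" where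
  "lin_det A = (\<Sum>p | p permutes Basis. of_int (sign p) * (\<Prod>b\<in>Basis. A b \<bullet> p b))"

text \<open>Only used for open sets and for closed domains with smooth boundary, where the derivative
  within \<open>A\<close> is unique.\<close>

definition oriented_diffeo ::
    "('a::euclidean_space \<Rightarrow> 'a) \<Rightarrow> 'a set \<Rightarrow> 'a set \<Rightarrow> bool" where
  "oriented_diffeo f A B \<longleftrightarrow> diffeo f A B \<and>
     (\<forall>x\<in>A. \<exists>f'. (f has_derivative f') (at x within A) \<and> lin_det f' > 0)"


section \<open>Embedded curves and surfaces\<close>

text \<open>The model space \<open>H\<close> is \<open>half_plane\<close> for surfaces with boundary and the real line for
  closed curves.\<close>

definition half_plane :: "complex set" where
  "half_plane = {z. 0 \<le> Im z}"

definition local_param ::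
    "'m::euclidean_space set \<Rightarrow> 'a::euclidean_space set \<Rightarrow> ('m \<Rightarrow> 'a) \<Rightarrow> 'm set \<Rightarrow> 'm \<Rightarrow> 'a \<Rightarrow> bool"
  where
  "local_param H M f V a x \<longleftrightarrow>
     openin (top_of_set H) V \<and> a \<in> V \<and> f a = x \<and>
     openin (top_of_set M) (f ` V) \<and> diffeo f V (f ` V)"

definition submanifold :: "'m::euclidean_space set \<Rightarrow> 'a::euclidean_space set \<Rightarrow> bool" where
  "submanifold H M \<longleftrightarrow> (\<forall>x\<in>M. \<exists>f V a. local_param H M f V a x)"

definition tangent_space ::
    "'m::euclidean_space set \<Rightarrow> 'a::euclidean_space set \<Rightarrow> 'a \<Rightarrow> 'a set" where
  "tangent_space H M x =
     {v. \<exists>f V a A. local_param H M f V a x \<and>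
           (f has_derivative A) (at a within V) \<and> v \<in> range A}"

definition surface_boundary :: "'a::euclidean_space set \<Rightarrow> 'a set" where
  "surface_boundary S = {x. \<exists>f V a. local_param half_plane S f V a x \<and> Im a = 0}"

text \<open>The last condition is transversality to the frontier of \<open>X\<close>: some tangent vector of \<open>S\<close>
  lies in the interior of the tangent cone of \<open>X\<close>.  Where the frontier of \<open>X\<close> is smooth this says
  that the tangent plane of \<open>S\<close> is not contained in the tangent space of the frontier.\<close>

definition properly_embedded_surface ::
    "'a::euclidean_space set \<Rightarrow> 'a set \<Rightarrow> bool" where
  "properly_embedded_surface S X \<longleftrightarrow>
     compact S \<and> submanifold half_plane S \<and> S \<subseteq> X \<and>
     surface_boundary S = S \<inter> frontier X \<and>
     (\<forall>x\<in>surface_boundary S. \<exists>v\<in>tangent_space half_plane S x.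
        \<exists>e>0. \<forall>t\<in>{0<..<e}. ball (x + t *\<^sub>R v) (e * t) \<subseteq> X)"


section \<open>Braided surfaces\<close>

definition local_diffeo_at ::
    "('a::euclidean_space \<Rightarrow> complex) \<Rightarrow> 'a set \<Rightarrow> complex set \<Rightarrow> 'a \<Rightarrow> bool" where
  "local_diffeo_at p S D x \<longleftrightarrow>
     (\<exists>U V. x \<in> U \<and> openin (top_of_set S) U \<and> openin (top_of_set D) V \<and> diffeo p U V)"

definition branch_points ::
    "('a::euclidean_space \<Rightarrow> complex) \<Rightarrow> 'a set \<Rightarrow> complex set \<Rightarrow> 'a set" where
  "branch_points p S D = {x\<in>S. \<not> local_diffeo_at p S D x}"

text \<open>In smooth coordinates \<open>f\<close> on \<open>S\<close> and \<open>g\<close> on \<open>D\<close>, centred at \<open>x\<close> and \<open>p x\<close>, the map \<open>p\<close> is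
  the \<open>k\<close>-th power map.\<close>

definition power_model_at ::
    "nat \<Rightarrow> ('a::euclidean_space \<Rightarrow> complex) \<Rightarrow> 'a set \<Rightarrow> complex set \<Rightarrow> 'a \<Rightarrow> bool" where
  "power_model_at k p S D x \<longleftrightarrow>
     (\<exists>U V (f :: 'a \<Rightarrow> complex) (g :: complex \<Rightarrow> complex).
        x \<in> U \<and> openin (top_of_set S) U \<and> openin (top_of_set D) V \<and> p ` U \<subseteq> V \<and>
        open (f ` U) \<and> diffeo f U (f ` U) \<and> f x = 0 \<and>
        open (g ` V) \<and> diffeo g V (g ` V) \<and> g (p x) = 0 \<and>
        (\<forall>u\<in>U. g (p u) = f u ^ k))"

definition branched_covering ::
    "('a::euclidean_space \<Rightarrow> complex) \<Rightarrow> 'a set \<Rightarrow> complex set \<Rightarrow> bool" where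
  "branched_covering p S D \<longleftrightarrow>
     (let R = branch_points p S D; B = p ` R in
        compact S \<and> smooth_on S p \<and> p ` S = D \<and>
        finite B \<and> B \<subseteq> interior D \<and>
        covering_space (S - p -` B) p (D - B) \<and>
        (\<exists>d\<ge>1. \<forall>y\<in>D - B. card {x\<in>S. p x = y} = d) \<and>
        (\<forall>x\<in>R. \<exists>k\<ge>2. power_model_at k p S D x))"

definition simple_branched_covering ::
    "('a::euclidean_space \<Rightarrow> complex) \<Rightarrow> 'a set \<Rightarrow> complex set \<Rightarrow> bool" where
  "simple_branched_covering p S D \<longleftrightarrow>
     branched_covering p S D \<and>
     inj_on p (branch_points p S D) \<and>
     (\<forall>x\<in>branch_points p S D. power_model_at 2 p S D x)"

text \<open>Positively oriented coordinates \<open>\<Phi> = (z, w)\<close> on \<open>U\<close> and \<open>\<psi> = \<zeta>\<close> on \<open>N\<close>, centred at the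
  branch point \<open>x\<close> and at its projection.\<close>

definition positive_branch_coordinates ::
    "complex set \<Rightarrow> complex set \<Rightarrow> (complex \<times> complex) set \<Rightarrow> complex \<times> complex \<Rightarrow> bool" where
  "positive_branch_coordinates D1 D2 S x \<longleftrightarrow>
     (\<exists>U N \<Phi> \<psi>.
        open U \<and> x \<in> U \<and> U \<subseteq> D1 \<times> D2 \<and> open N \<and> N \<subseteq> D1 \<and> fst ` U \<subseteq> N \<and>
        open (\<Phi> ` U) \<and> oriented_diffeo \<Phi> U (\<Phi> ` U) \<and> \<Phi> x = (0, 0) \<and>
        open (\<psi> ` N) \<and> oriented_diffeo \<psi> N (\<psi> ` N) \<and>
        (\<forall>q\<in>U. \<psi> (fst q) = fst (\<Phi> q)) \<and>
        \<Phi> ` (S \<inter> U) = {(z, w). (z, w) \<in> \<Phi> ` U \<and> z = w\<^sup>2})"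

definition braided_surface ::
    "complex set \<Rightarrow> complex set \<Rightarrow> (complex \<times> complex) set \<Rightarrow> bool" where
  "braided_surface D1 D2 S \<longleftrightarrow>
     properly_embedded_surface S (D1 \<times> D2) \<and>
     simple_branched_covering fst S D1 \<and>
     surface_boundary S \<subseteq> frontier D1 \<times> interior D2 \<and>
     (\<forall>x\<in>branch_points fst S D1. positive_branch_coordinates D1 D2 S x)"


section \<open>The standard symplectic 4-disk and contact 3-sphere\<close>

definition D4 :: "(complex \<times> complex) set" where
  "D4 = {(z, w). (cmod z)\<^sup>2 + (cmod w)\<^sup>2 \<le> 1}"

text \<open>The argument of \<open>Re\<close> is already real, both here and in \<open>alpha_st\<close>.\<close>

definition omega_st :: "complex \<times> complex \<Rightarrow> complex \<times> complex \<Rightarrow> real" where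
  "omega_st u v = Re (\<i> / 2 * ((fst u * cnj (fst v) - fst v * cnj (fst u)) +
                              (snd u * cnj (snd v) - snd v * cnj (snd u))))"

definition alpha_st :: "complex \<times> complex \<Rightarrow> complex \<times> complex \<Rightarrow> real" where
  "alpha_st q v = Re (\<i> / 4 * (fst q * cnj (fst v) - cnj (fst q) * fst v +
                              snd q * cnj (snd v) - cnj (snd q) * snd v))"

definition xi_st :: "complex \<times> complex \<Rightarrow> (complex \<times> complex) set" where
  "xi_st q = {v. q \<bullet> v = 0 \<and> alpha_st q v = 0}"

definition symplectic_surface :: "(complex \<times> complex) set \<Rightarrow> bool" where
  "symplectic_surface S \<longleftrightarrow>
     properly_embedded_surface S D4 \<and>
     (\<forall>x\<in>S. \<exists>u\<in>tangent_space half_plane S x. \<exists>v\<in>tangent_space half_plane S x.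
        omega_st u v \<noteq> 0)"

definition transverse_link :: "(complex \<times> complex) set \<Rightarrow> bool" where
  "transverse_link L \<longleftrightarrow>
     compact L \<and> submanifold (UNIV :: real set) L \<and> L \<subseteq> frontier D4 \<and>
     (\<forall>x\<in>L. \<forall>\<tau>\<in>tangent_space (UNIV :: real set) L x. \<tau> \<noteq> 0 \<longrightarrow> \<tau> \<notin> xi_st x)"

text \<open>\<open>S\<close> is oriented by \<open>omega_st\<close>, and its boundary by the rule that the outward vector \<open>\<nu>\<close>
  comes first.\<close>

definition positively_transverse_boundary :: "(complex \<times> complex) set \<Rightarrow> bool" where
  "positively_transverse_boundary S \<longleftrightarrow>
     transverse_link (surface_boundary S) \<and>
     (\<forall>x\<in>surface_boundary S.
        \<forall>\<tau>\<in>tangent_space (UNIV :: real set) (surface_boundary S) x.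
        \<forall>\<nu>\<in>tangent_space half_plane S x.
          x \<bullet> \<nu> > 0 \<and> omega_st \<nu> \<tau> > 0 \<longrightarrow> alpha_st x \<tau> > 0)"


section \<open>Isotopy\<close>

text \<open>A subset of the plane admitting such a map is a smooth closed disk with the orientation of
  the plane; every oriented closed disk is diffeomorphic to one of these.\<close>

definition disk_identification :: "complex set \<Rightarrow> real \<Rightarrow> (complex \<Rightarrow> complex) \<Rightarrow> bool" where
  "disk_identification D r \<phi> \<longleftrightarrow> r > 0 \<and> oriented_diffeo \<phi> D (cball 0 r)"

text \<open>\<open>X\<close> is the round bidisk with its corner rounded inside a neighbourhood \<open>V\<close> away from the
  surface \<open>T\<close>, and \<open>h\<close> is a diffeomorphism of \<open>X\<close> onto the 4-disk moving each point along its ray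
  from the origin.  Smoothness of the frontier of \<open>X\<close> follows from the existence of \<open>h\<close>.\<close>

definition radial_identification ::
    "real \<Rightarrow> real \<Rightarrow> (complex \<times> complex) set \<Rightarrow> (complex \<times> complex) set \<Rightarrow>
     (complex \<times> complex \<Rightarrow> complex \<times> complex) \<Rightarrow> bool" where
  "radial_identification r1 r2 T X h \<longleftrightarrow>
     X \<subseteq> cball 0 r1 \<times> cball 0 r2 \<and>
     (\<exists>V. open V \<and> sphere 0 r1 \<times> sphere 0 r2 \<subseteq> V \<and> closure V \<inter> T = {} \<and>
          cball 0 r1 \<times> cball 0 r2 - X \<subseteq> V) \<and>
     diffeo h X D4 \<and> (\<forall>q\<in>X. \<exists>c>0. h q = c *\<^sub>R q)"

definition ambient_isotopic ::
    "'a::euclidean_space set \<Rightarrow> 'a set \<Rightarrow> 'a set \<Rightarrow> bool" where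
  "ambient_isotopic X A B \<longleftrightarrow>
     (\<exists>F :: real \<Rightarrow> 'a \<Rightarrow> 'a.
        smooth_on ({0..1} \<times> X) (\<lambda>(t, q). F t q) \<and>
        (\<forall>t\<in>{0..1}. diffeo (F t) X X) \<and>
        (\<forall>q\<in>X. F 0 q = q) \<and> F 1 ` A = B)"

text \<open>The choice of \<open>X\<close> and \<open>h\<close> does not matter: for two choices, the convex combinations of
  the inverse maps are again radial and give an isotopy between the images of \<open>T\<close>.\<close>

definition isotopic_to_braided ::
    "real \<Rightarrow> (complex \<Rightarrow> complex) \<Rightarrow> real \<Rightarrow> (complex \<Rightarrow> complex) \<Rightarrow>
     (complex \<times> complex) set \<Rightarrow> (complex \<times> complex) set \<Rightarrow> bool" where
  "isotopic_to_braided r1 \<phi>1 r2 \<phi>2 S'' S \<longleftrightarrow>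
     (let T = map_prod \<phi>1 \<phi>2 ` S in
        \<exists>X h. radial_identification r1 r2 T X h \<and> ambient_isotopic D4 (h ` T) S'')"

end

theory Submission
  imports Defs
begin

text \<open>
  Shrinking the fibre direction makes a braided surface symplectic.  Let \<open>T\<close> be the image of \<open>S\<close>
  in the round bidisk and write \<open>A\<^sub>z\<close>, \<open>A\<^sub>w\<close> for the area forms of the two factors, so that
  \<open>\<omega> = A\<^sub>z + A\<^sub>w\<close>.  The map \<open>(z, w) \<mapsto> (z, e w)\<close> pulls \<open>\<omega>\<close> back to \<open>A\<^sub>z + e\<^sup>2 A\<^sub>w\<close>.  Orient \<open>T\<close> by
  its projection to the \<open>z\<close>-disk.  Then \<open>A\<^sub>z > 0\<close> on \<open>T\<close> away from the branch points, and at a branch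
  point the tangent plane is the \<open>w\<close>-line, where \<open>A\<^sub>z\<close> vanishes and the positivity of the coordinates
  \<open>z = w\<^sup>2\<close> gives \<open>A\<^sub>w > 0\<close>.  Near a branch point both terms help, elsewhere the first dominates,
  and by compactness one small \<open>e\<close> serves for all of \<open>T\<close>.  In particular the surface need not be
  changed near its branch points.

  To land in the round 4-disk with boundary on the sphere, shrinking is combined with a projective
  map: \<open>flatten r e (z, w) = (z, e w) / sqrt (r\<^sup>2 + e\<^sup>2 |w|\<^sup>2)\<close> carries the solid cylinder
  \<open>|z| \<le> r\<close> into the 4-disk and its boundary \<open>|z| = r\<close> into the sphere.  The exact formula
  \<open>omega_flatten\<close> says that, up to a positive factor, \<open>\<omega>\<close> pulls back to \<open>r\<^sup>2 A\<^sub>z + e\<^sup>2 \<beta>\<close> with a fixed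
  2-form \<open>\<beta>\<close> that equals \<open>r\<^sup>2 A\<^sub>w\<close> on the tangent planes at the branch points, so the argument above
  applies (\<open>symplectic_near\<close>, \<open>compact_uniform_parameter\<close>).  By \<open>alpha_flatten\<close> the contact form
  pulls back to a multiple of \<open>|z|\<^sup>2 d\<theta>\<^sub>z + e\<^sup>2 |w|\<^sup>2 d\<theta>\<^sub>w\<close>.  Since the boundary of \<open>T\<close> is transverse
  to the fibres, with slopes bounded by compactness (\<open>slope_near\<close>), the first term dominates on it
  for small \<open>e\<close>; this is positive transversality (\<open>alpha_dominated\<close>, \<open>boundary_orientation\<close>).

  The ambient isotopy is explicit.  The automorphisms
  \<open>squeeze l (z, w) = (z, l w) / sqrt (1 - (1 - l\<^sup>2) |w|\<^sup>2)\<close> of the 4-disk join the identity to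
  \<open>squeeze e\<close>.  The radial map \<open>(z, w) \<mapsto> (z, w) / sqrt (r\<^sup>2 + |w|\<^sup>2)\<close> takes the cylinder into the
  4-disk, and following it by \<open>squeeze e\<close> gives \<open>flatten r e\<close>.  This radial map misses a circle of
  the sphere, which corresponds to \<open>|w| = \<infinity>\<close>; changing it only where \<open>|w|\<close> exceeds its values on
  \<open>T\<close> bends the cylinder into a bidisk with rounded corner that is mapped onto the whole 4-disk
  (\<open>exists_radial_identification\<close>).
\<close>


section \<open>Calculus of smooth maps\<close>

text \<open>Unfolding differentiability orders is kept under manual control: as a rewrite rule the
  successor equation replaces every hypothesis by its first derivatives.\<close>

declare Ck_on.simps(2) [simp del]

lemma Ck_on_subset:
  "Ck_on k f U \<Longrightarrow> V \<subseteq> U \<Longrightarrow> Ck_on k f V"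
  by (induction k arbitrary: f) (auto intro: continuous_on_subset simp: Ck_on.simps(2))

lemma Ck_on_cong:
  assumes "open U" "\<And>x. x \<in> U \<Longrightarrow> f x = g x" "Ck_on k f U"
  shows "Ck_on k g U"
  using assms(2,3)
proof (induction k arbitrary: f g)
  case 0
  then show ?case by (metis Ck_on.simps(1) continuous_on_cong)
next
  case (Suc k)
  have d: "(g has_derivative frechet_derivative f (at x)) (at x)" if "x \<in> U" for x
  proof -
    have "(f has_derivative frechet_derivative f (at x)) (at x)"
      using Suc.prems that by (simp add: frechet_derivative_works[symmetric] Ck_on.simps(2))
    then show ?thesis
      by (rule has_derivative_transform_within_open[OF _ assms(1) that]) (use Suc.prems in auto)
  qed
  have e: "frechet_derivative f (at x) = frechet_derivative g (at x)" if "x \<in> U" for x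
    using frechet_derivative_at[OF d[OF that]] .
  have "Ck_on k (\<lambda>x. frechet_derivative g (at x) v) U" for v
    by (rule Suc.IH[of "\<lambda>x. frechet_derivative f (at x) v"]) (use Suc.prems e in \<open>auto simp: Ck_on.simps(2)\<close>)
  then show ?case
    using d by (auto simp: differentiable_def Ck_on.simps(2))
qed

lemma Ck_on_SucI:
  assumes "open U" "\<And>x. x \<in> U \<Longrightarrow> (f has_derivative f' x) (at x)"
    and "\<And>v. Ck_on k (\<lambda>x. f' x v) U"
  shows "Ck_on (Suc k) f U"
proof -
  have "Ck_on k (\<lambda>x. frechet_derivative f (at x) v) U" for v
    by (rule Ck_on_cong[OF assms(1) _ assms(3)[of v]]) (metis assms(2) frechet_derivative_at)
  then show ?thesis using assms(2) by (auto simp: differentiable_def Ck_on.simps(2))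
qed

lemma Ck_on_SucD:
  assumes "Ck_on (Suc k) f U"
  shows "x \<in> U \<Longrightarrow> (f has_derivative frechet_derivative f (at x)) (at x)"
    and "Ck_on k (\<lambda>x. frechet_derivative f (at x) v) U"
  using assms by (auto simp: frechet_derivative_works[symmetric] Ck_on.simps(2))

lemma Ck_on_imp_continuous: "Ck_on k f U \<Longrightarrow> continuous_on U f"
  by (cases k) (auto intro: differentiable_imp_continuous_on
      simp: differentiable_on_def differentiable_at_withinI Ck_on.simps(2))

lemma Ck_on_Suc_imp: "Ck_on (Suc k) f U \<Longrightarrow> Ck_on k f U"
proof (induction k arbitrary: f)
  case 0
  then show ?case using Ck_on_imp_continuous by (metis Ck_on.simps(1))
next
  case (Suc k)
  then show ?case by (metis Ck_on.simps(2))
qed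

lemma Ck_on_const: "Ck_on k (\<lambda>x. c) U"
  by (induction k arbitrary: c) (auto simp: Ck_on.simps(2))

lemma Ck_on_bounded_linear:
  assumes "bounded_linear f" "open U"
  shows "Ck_on k f U"
proof (cases k)
  case 0
  then show ?thesis using assms(1) by (simp add: linear_continuous_on)
next
  case (Suc j)
  show ?thesis
    unfolding Suc by (rule Ck_on_SucI[OF assms(2) bounded_linear_imp_has_derivative[OF assms(1)] Ck_on_const])
qed

lemma Ck_on_add:
  assumes "open U" "Ck_on k f U" "Ck_on k g U"
  shows "Ck_on k (\<lambda>x. f x + g x) U"
  using assms(2,3)
proof (induction k arbitrary: f g)
  case 0
  then show ?case by (simp add: continuous_on_add)
next
  case (Suc k)
  show ?case
    by (rule Ck_on_SucI[OF assms(1) has_derivative_add[OF Ck_on_SucD(1)[OF Suc.prems(1)] Ck_on_SucD(1)[OF Suc.prems(2)]]])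
      (assumption | intro Suc.IH Ck_on_SucD(2) Suc.prems)+
qed

lemma Ck_on_sum:
  assumes "open U" "\<And>i. i \<in> I \<Longrightarrow> Ck_on k (f i) U"
  shows "Ck_on k (\<lambda>x. \<Sum>i\<in>I. f i x) U"
  using assms(2)
  by (induction I rule: infinite_finite_induct) (auto intro: Ck_on_const Ck_on_add[OF assms(1)])

lemma Ck_on_bilinear:
  assumes "bounded_bilinear pr" "open U" "Ck_on k f U" "Ck_on k g U"
  shows "Ck_on k (\<lambda>x. pr (f x) (g x)) U"
  using assms(3,4)
proof (induction k arbitrary: f g)
  case 0
  then show ?case by (simp add: bounded_bilinear.continuous_on[OF assms(1)])
next
  case (Suc k)
  show ?case
    by (rule Ck_on_SucI[OF assms(2) bounded_bilinear.FDERIV[OF assms(1) Ck_on_SucD(1)[OF Suc.prems(1)] Ck_on_SucD(1)[OF Suc.prems(2)]]])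
      (assumption | intro Ck_on_add[OF assms(2)] Suc.IH Ck_on_SucD(2) Ck_on_Suc_imp[OF Suc.prems(1)]
        Ck_on_Suc_imp[OF Suc.prems(2)] Suc.prems)+
qed

text \<open>By the chain rule a directional derivative of the composite is a combination of the partial
  derivatives of the outer map, composed with the inner one.  The induction on the order of
  differentiability therefore runs over all outer maps.\<close>

lemma Ck_on_compose:
  fixes f :: "'b::euclidean_space \<Rightarrow> 'c::real_normed_vector" and g :: "'a::euclidean_space \<Rightarrow> 'b"
  assumes "open U" "open V" "g ` U \<subseteq> V" "Ck_on k g U" "Ck_on k f V"
  shows "Ck_on k (\<lambda>x. f (g x)) U"
  using assms(4,5)
proof (induction k arbitrary: f)
  case 0
  then show ?case using assms(3) by (auto intro: continuous_on_compose2)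
next
  case (Suc k)
  let ?f' = "\<lambda>y. frechet_derivative f (at y)" and ?g' = "\<lambda>x. frechet_derivative g (at x)"
  have d: "((\<lambda>x. f (g x)) has_derivative (\<lambda>v. \<Sum>b\<in>Basis. (?g' x v \<bullet> b) *\<^sub>R ?f' (g x) b)) (at x)"
    if "x \<in> U" for x
  proof -
    have f: "(f has_derivative ?f' (g x)) (at (g x))"
      using Ck_on_SucD(1)[OF Suc.prems(2)] that assms(3) by blast
    have "((\<lambda>x. f (g x)) has_derivative (\<lambda>v. ?f' (g x) (?g' x v))) (at x)"
      using diff_chain_at[OF Ck_on_SucD(1)[OF Suc.prems(1) that] f] by (simp add: o_def)
    moreover have "(\<lambda>v. ?f' (g x) (?g' x v)) = (\<lambda>v. \<Sum>b\<in>Basis. (?g' x v \<bullet> b) *\<^sub>R ?f' (g x) b)"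
    proof
      fix v
      let ?u = "?g' x v"
      have "linear (?f' (g x))" using f has_derivative_linear by blast
      then have "?f' (g x) (\<Sum>b\<in>Basis. (?u \<bullet> b) *\<^sub>R b) = (\<Sum>b\<in>Basis. (?u \<bullet> b) *\<^sub>R ?f' (g x) b)"
        by (simp add: linear_sum linear_scale)
      then show "?f' (g x) ?u = (\<Sum>b\<in>Basis. (?u \<bullet> b) *\<^sub>R ?f' (g x) b)"
        by (simp only: euclidean_representation)
    qed
    ultimately show ?thesis by (simp only:)
  qed
  have "Ck_on k (\<lambda>x. (?g' x v \<bullet> b) *\<^sub>R ?f' (g x) b) U" for v b
  proof (rule Ck_on_bilinear[OF bounded_bilinear_scaleR assms(1)])
    show "Ck_on k (\<lambda>x. ?g' x v \<bullet> b) U"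
      by (rule Ck_on_bilinear[OF bounded_bilinear_inner assms(1) Ck_on_SucD(2)[OF Suc.prems(1)] Ck_on_const])
    show "Ck_on k (\<lambda>x. ?f' (g x) b) U"
      by (rule Suc.IH[OF Ck_on_Suc_imp[OF Suc.prems(1)] Ck_on_SucD(2)[OF Suc.prems(2)]])
  qed
  then show ?case
    by (intro Ck_on_SucI[OF assms(1) d] Ck_on_sum[OF assms(1)])
qed

lemma Ck_on_Pair:
  assumes "open U" "Ck_on k f U" "Ck_on k g U"
  shows "Ck_on k (\<lambda>x. (f x, g x)) U"
  using assms(2,3)
proof (induction k arbitrary: f g)
  case 0
  then show ?case by (simp add: continuous_on_Pair)
next
  case (Suc k)
  show ?case
    by (rule Ck_on_SucI[OF assms(1) has_derivative_Pair[OF Ck_on_SucD(1)[OF Suc.prems(1)] Ck_on_SucD(1)[OF Suc.prems(2)]]])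
      (assumption | intro Suc.IH Ck_on_SucD(2) Suc.prems)+
qed

text \<open>Openness is part of the definition because derivatives at the points of \<open>U\<close> see a full
  neighbourhood; it then need not be carried along separately in the closure rules.\<close>

definition Cinf_on :: "('a::euclidean_space \<Rightarrow> 'b::real_normed_vector) \<Rightarrow> 'a set \<Rightarrow> bool" where
  "Cinf_on f U \<longleftrightarrow> open U \<and> (\<forall>k. Ck_on k f U)"

lemma Cinf_on_open: "Cinf_on f U \<Longrightarrow> open U"
  by (simp add: Cinf_on_def)

lemma Cinf_on_subset: "Cinf_on f U \<Longrightarrow> open V \<Longrightarrow> V \<subseteq> U \<Longrightarrow> Cinf_on f V"
  by (meson Cinf_on_def Ck_on_subset)

lemma Cinf_on_cong: "Cinf_on f U \<Longrightarrow> (\<And>x. x \<in> U \<Longrightarrow> f x = g x) \<Longrightarrow> Cinf_on g U"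
  unfolding Cinf_on_def using Ck_on_cong[of U f g] by simp

lemma Cinf_on_const: "open U \<Longrightarrow> Cinf_on (\<lambda>x. c) U"
  unfolding Cinf_on_def using Ck_on_const[of _ c U] by simp

lemma Cinf_on_bounded_linear: "bounded_linear f \<Longrightarrow> open U \<Longrightarrow> Cinf_on f U"
  unfolding Cinf_on_def using Ck_on_bounded_linear[of f U] by simp

lemma Cinf_on_id: "open U \<Longrightarrow> Cinf_on (\<lambda>x. x) U"
  by (simp add: Cinf_on_bounded_linear bounded_linear_ident)

lemma Cinf_on_add: "Cinf_on f U \<Longrightarrow> Cinf_on g U \<Longrightarrow> Cinf_on (\<lambda>x. f x + g x) U"
  unfolding Cinf_on_def using Ck_on_add[of U _ f g] by simp

lemma Cinf_on_bilinear:
  "bounded_bilinear pr \<Longrightarrow> Cinf_on f U \<Longrightarrow> Cinf_on g U \<Longrightarrow> Cinf_on (\<lambda>x. pr (f x) (g x)) U"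
  unfolding Cinf_on_def using Ck_on_bilinear[of pr U _ f g] by simp

lemmas Cinf_on_scaleR = Cinf_on_bilinear[OF bounded_bilinear_scaleR]
lemmas Cinf_on_inner = Cinf_on_bilinear[OF bounded_bilinear_inner]
lemmas Cinf_on_mult = Cinf_on_bilinear[OF bounded_bilinear_mult]

lemma Cinf_on_Pair: "Cinf_on f U \<Longrightarrow> Cinf_on g U \<Longrightarrow> Cinf_on (\<lambda>x. (f x, g x)) U"
  unfolding Cinf_on_def using Ck_on_Pair[of U _ f g] by simp

lemma Cinf_on_compose:
  fixes f :: "'b::euclidean_space \<Rightarrow> 'c::real_normed_vector" and g :: "'a::euclidean_space \<Rightarrow> 'b"
  assumes "Cinf_on f V" "Cinf_on g U" "g ` U \<subseteq> V"
  shows "Cinf_on (\<lambda>x. f (g x)) U"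
  using assms Ck_on_compose[of U V g _ f] unfolding Cinf_on_def by simp

lemma Cinf_on_linear_compose:
  fixes g :: "'a::euclidean_space \<Rightarrow> 'b::euclidean_space"
  assumes "bounded_linear f" "Cinf_on g U"
  shows "Cinf_on (\<lambda>x. f (g x)) U"
  by (rule Cinf_on_compose[OF Cinf_on_bounded_linear[OF assms(1) open_UNIV] assms(2)]) simp

lemmas Cinf_on_fst = Cinf_on_linear_compose[OF bounded_linear_fst]
lemmas Cinf_on_snd = Cinf_on_linear_compose[OF bounded_linear_snd]
lemmas Cinf_on_uminus = Cinf_on_linear_compose[OF bounded_linear_minus[OF bounded_linear_ident]]

lemma Cinf_on_diff:
  fixes f g :: "'a::euclidean_space \<Rightarrow> 'b::euclidean_space"
  shows "Cinf_on f U \<Longrightarrow> Cinf_on g U \<Longrightarrow> Cinf_on (\<lambda>x. f x - g x) U"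
  using Cinf_on_add[OF _ Cinf_on_uminus] by fastforce

lemma Cinf_on_power:
  fixes f :: "'a::euclidean_space \<Rightarrow> 'b::real_normed_algebra_1"
  shows "Cinf_on f U \<Longrightarrow> Cinf_on (\<lambda>x. f x ^ n) U"
  by (induction n) (auto intro: Cinf_on_const Cinf_on_mult simp: Cinf_on_open)

lemma Cinf_on_norm_sq:
  fixes f :: "'a::euclidean_space \<Rightarrow> 'b::real_inner"
  shows "Cinf_on f U \<Longrightarrow> Cinf_on (\<lambda>x. (norm (f x))\<^sup>2) U"
  unfolding power2_norm_eq_inner by (rule Cinf_on_inner)

lemma Cinf_on_derivative:
  assumes "Cinf_on f U"
  shows "x \<in> U \<Longrightarrow> (f has_derivative frechet_derivative f (at x)) (at x)"
    and "Cinf_on (\<lambda>x. frechet_derivative f (at x) v) U"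
  using assms Ck_on_SucD unfolding Cinf_on_def by blast+

lemma Cinf_on_imp_continuous: "Cinf_on f U \<Longrightarrow> continuous_on U f"
  unfolding Cinf_on_def using Ck_on_imp_continuous by blast

text \<open>A real function whose derivative is a \<open>C\<^sup>k\<close> expression as soon as the function itself is
  \<open>C\<^sup>k\<close>, is smooth.  This bootstrapping covers inverses, roots and exponentials.\<close>

lemma Cinf_on_bootstrap:
  fixes f :: "real \<Rightarrow> real"
  assumes U: "open U" and d: "\<And>x. x \<in> U \<Longrightarrow> (f has_field_derivative f' x) (at x)"
    and step: "\<And>k. Ck_on k f U \<Longrightarrow> Ck_on k f' U"
  shows "Cinf_on f U"
proof -
  have "Ck_on k f U" for k
  proof (induction k)
    case 0
    show ?case
      using d by (auto intro!: continuous_at_imp_continuous_on DERIV_isCont)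
  next
    case (Suc k)
    have "Ck_on k (\<lambda>x. f' x * v) U" for v
      by (rule Ck_on_bilinear[OF bounded_bilinear_mult U step[OF Suc] Ck_on_const])
    then show ?case
      by (intro Ck_on_SucI[OF U, of f "\<lambda>x v. f' x * v"]) (use d has_field_derivative_def in blast)+
  qed
  then show ?thesis using U by (simp add: Cinf_on_def)
qed

lemma Ck_on_power:
  fixes f :: "'a::euclidean_space \<Rightarrow> 'b::real_normed_algebra_1"
  shows "open U \<Longrightarrow> Ck_on k f U \<Longrightarrow> Ck_on k (\<lambda>x. f x ^ n) U"
  by (induction n) (auto intro: Ck_on_const Ck_on_bilinear[OF bounded_bilinear_mult])

lemma Cinf_on_inverse_real: "Cinf_on (inverse :: real \<Rightarrow> real) (- {0})"
proof (rule Cinf_on_bootstrap)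
  show "(inverse has_field_derivative - 1 * (inverse x ^ 2)) (at x)" if "x \<in> - {0}" for x :: real
    using DERIV_inverse[of x UNIV] that by (simp add: numeral_2_eq_2)
  show "Ck_on k (\<lambda>x. - 1 * (inverse x) ^ 2) (- {0::real})"
    if "Ck_on k (inverse :: real \<Rightarrow> real) (- {0})" for k
    using that by (intro Ck_on_bilinear[OF bounded_bilinear_mult] Ck_on_const Ck_on_power) auto
qed auto

lemma Cinf_on_inverse:
  fixes f :: "'a::euclidean_space \<Rightarrow> real"
  shows "Cinf_on f U \<Longrightarrow> (\<And>x. x \<in> U \<Longrightarrow> f x \<noteq> 0) \<Longrightarrow> Cinf_on (\<lambda>x. inverse (f x)) U"
  by (rule Cinf_on_compose[OF Cinf_on_inverse_real]) auto

lemma Cinf_on_divide: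
  fixes f g :: "'a::euclidean_space \<Rightarrow> real"
  shows "Cinf_on f U \<Longrightarrow> Cinf_on g U \<Longrightarrow> (\<And>x. x \<in> U \<Longrightarrow> g x \<noteq> 0) \<Longrightarrow> Cinf_on (\<lambda>x. f x / g x) U"
  unfolding divide_inverse by (intro Cinf_on_mult Cinf_on_inverse)

lemma Cinf_on_sqrt_real: "Cinf_on sqrt {0<..}"
proof -
  define r where "r x = inverse (sqrt x)" for x
  have r: "Cinf_on r {0<..}"
  proof (rule Cinf_on_bootstrap)
    show "(r has_field_derivative (- 1/2) * (r x ^ 3)) (at x)" if "x \<in> {0<..}" for x :: real
      unfolding r_def using that
      by (auto intro!: derivative_eq_intros simp: divide_simps power3_eq_cube)
    show "Ck_on k (\<lambda>x. (- 1/2) * (r x) ^ 3) {0<..}" if "Ck_on k r {0<..}" for k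
      using that by (intro Ck_on_bilinear[OF bounded_bilinear_mult] Ck_on_const Ck_on_power) auto
  qed auto
  have "Cinf_on (\<lambda>x. x * r x) {0<..}"
    by (intro Cinf_on_mult Cinf_on_id r) auto
  then show ?thesis
    by (rule Cinf_on_cong) (auto simp: r_def field_simps)
qed

lemma Cinf_on_sqrt:
  fixes f :: "'a::euclidean_space \<Rightarrow> real"
  shows "Cinf_on f U \<Longrightarrow> (\<And>x. x \<in> U \<Longrightarrow> 0 < f x) \<Longrightarrow> Cinf_on (\<lambda>x. sqrt (f x)) U"
  by (rule Cinf_on_compose[OF Cinf_on_sqrt_real]) auto

text \<open>The classical function that vanishes to infinite order at \<open>0\<close> is treated together with its
  quotients by all powers of \<open>x\<close>, since linear combinations of these are closed under
  differentiation.\<close>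

definition flat :: "nat \<Rightarrow> real \<Rightarrow> real" where
  "flat m x = (if x \<le> 0 then 0 else exp (- (1 / x)) / x ^ m)"

lemma flat_tendsto: "(flat m \<longlongrightarrow> 0) (at_right 0)"
proof -
  have "((\<lambda>y::real. y ^ m / exp y) \<longlongrightarrow> 0) at_top"
    by (rule tendsto_power_div_exp_0)
  then have "((\<lambda>x. (inverse x) ^ m / exp (inverse x)) \<longlongrightarrow> 0) (at_right (0::real))"
    by (rule filterlim_compose) (rule filterlim_inverse_at_top_right)
  then show ?thesis
    by (rule Lim_transform_eventually)
      (auto simp: eventually_at_filter flat_def exp_minus divide_simps power_inverse)
qed

lemma flat_has_derivative:
  "(flat m has_field_derivative (- of_nat m) * flat (Suc m) x + flat (m + 2) x) (at x)"
proof -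
  consider "x < 0" | "x = 0" | "x > 0" by linarith
  then show ?thesis
  proof cases
    case 1
    have "((\<lambda>x. 0) has_field_derivative 0) (at x)" by simp
    then have "(flat m has_field_derivative 0) (at x)"
      by (rule has_field_derivative_transform_within_open[of _ _ _ "{..<0}"])
        (use 1 in \<open>auto simp: flat_def\<close>)
    then show ?thesis using 1 by (simp add: flat_def)
  next
    case 3
    have "((\<lambda>x. exp (- (1 / x)) / x ^ m) has_field_derivative
       (- of_nat m) * flat (Suc m) x + flat (m + 2) x) (at x)"
    proof -
      have "((\<lambda>x. exp (- inverse x)) has_field_derivative exp (- inverse x) * (inverse x ^ 2)) (at x)"
        using 3 by (auto intro!: derivative_eq_intros simp: power2_eq_square)
      moreover have "((\<lambda>x. inverse x ^ m) has_field_derivative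
          of_nat m * inverse x ^ (m - 1) * (- (inverse x ^ 2))) (at x)"
        using 3 by (auto intro!: derivative_eq_intros simp: power2_eq_square)
      ultimately have "((\<lambda>x. exp (- inverse x) * inverse x ^ m) has_field_derivative
          exp (- inverse x) * (inverse x ^ 2) * inverse x ^ m
            + (of_nat m * inverse x ^ (m - 1) * (- (inverse x ^ 2))) * exp (- inverse x)) (at x)"
        by (rule DERIV_mult)
      moreover have "exp (- inverse x) * (inverse x ^ 2) * inverse x ^ m
            + (of_nat m * inverse x ^ (m - 1) * (- (inverse x ^ 2))) * exp (- inverse x)
          = - of_nat m * (exp (- inverse x) * inverse x ^ Suc m) + exp (- inverse x) * inverse x ^ (m + 2)"
        by (cases m) (simp_all add: algebra_simps power2_eq_square del: power_inverse)
      ultimately show ?thesis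
        using 3 by (simp add: flat_def divide_inverse power_inverse)
    qed
    then show ?thesis
      by (rule has_field_derivative_transform_within_open[of _ _ _ "{0<..}"])
        (use 3 in \<open>auto simp: flat_def\<close>)
  next
    case 2
    have "((\<lambda>h. (flat m (0 + h) - flat m 0) / h) \<longlongrightarrow> 0) (at 0)"
    proof (rule filterlim_split_at)
      show "((\<lambda>h. (flat m (0 + h) - flat m 0) / h) \<longlongrightarrow> 0) (at_left 0)"
        by (rule Lim_transform_eventually[OF tendsto_const])
          (auto simp: eventually_at_filter flat_def)
      show "((\<lambda>h. (flat m (0 + h) - flat m 0) / h) \<longlongrightarrow> 0) (at_right 0)"
        by (rule Lim_transform_eventually[OF flat_tendsto[of "Suc m"]])
          (auto simp: eventually_at_filter flat_def field_simps)
    qed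
    then have "(flat m has_field_derivative 0) (at 0)"
      by (simp add: DERIV_def)
    then show ?thesis using 2 by (simp add: flat_def)
  qed
qed

lemma Cinf_on_flat: "Cinf_on (flat m) UNIV"
proof -
  have "Ck_on k (flat m) UNIV" for k m
  proof (induction k arbitrary: m)
    case 0
    show ?case
      using flat_has_derivative by (auto intro!: continuous_at_imp_continuous_on DERIV_isCont)
  next
    case (Suc k)
    have "Ck_on k (\<lambda>x. ((- of_nat m) * flat (Suc m) x + flat (m + 2) x) * v) UNIV" for v
      by (intro Ck_on_bilinear[OF bounded_bilinear_mult] Ck_on_const Ck_on_add Suc open_UNIV)
    then show ?case
      by (intro Ck_on_SucI[OF open_UNIV, of _ "\<lambda>x v. ((- of_nat m) * flat (Suc m) x + flat (m + 2) x) * v"])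
        (use flat_has_derivative has_field_derivative_def in blast)+
  qed
  then show ?thesis by (simp add: Cinf_on_def)
qed

text \<open>The derivative of the inverse \<open>g\<close> is \<open>1 / (f' \<circ> g)\<close>, so \<open>g\<close> gains one order of
  differentiability at a time.\<close>

lemma strictly_increasing_smooth_inverse:
  fixes f :: "real \<Rightarrow> real"
  assumes f: "Cinf_on f {a<..<b}"
    and d: "\<And>x. x \<in> {a<..<b} \<Longrightarrow> (f has_field_derivative f' x) (at x)"
    and pos: "\<And>x. x \<in> {a<..<b} \<Longrightarrow> f' x > 0"
  obtains g where "Cinf_on g (f ` {a<..<b})" "\<And>x. x \<in> {a<..<b} \<Longrightarrow> g (f x) = x"
    "strict_mono_on {a<..<b} f"
proof -
  let ?I = "{a<..<b}"
  have mono: "f x < f y" if "x \<in> ?I" "y \<in> ?I" "x < y" for x y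
  proof (rule DERIV_pos_imp_increasing[OF that(3)])
    fix z assume "x \<le> z" "z \<le> y"
    then have "z \<in> ?I" using that by auto
    then show "\<exists>w. (f has_real_derivative w) (at z) \<and> 0 < w" using d pos by blast
  qed
  then have inj: "inj_on f ?I"
    by (metis inj_onI linorder_less_linear order_less_irrefl)
  have op: "open (f ` ?I)"
    by (rule invariance_of_domain[OF Cinf_on_imp_continuous[OF f] _ inj]) simp
  define g where "g = inv_into ?I f"
  have gf: "g (f x) = x" if "x \<in> ?I" for x
    using inj that by (simp add: g_def)
  have f'eq: "f' x = frechet_derivative f (at x) 1" if "x \<in> ?I" for x
    using frechet_derivative_at[of f "(*) (f' x)"] d[OF that]
    by (metis has_field_derivative_def mult.right_neutral)
  have Cf': "Cinf_on f' ?I"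
    by (rule Cinf_on_cong[OF Cinf_on_derivative(2)[OF f]]) (simp add: f'eq)
  have gd: "(g has_field_derivative inverse (f' (g y))) (at y)" if "y \<in> f ` ?I" for y
  proof -
    from that obtain x where x: "x \<in> ?I" "y = f x" by blast
    have "(g has_derivative (*) (inverse (f' x))) (at (f x))"
    proof (rule has_derivative_inverse_on[of ?I f "\<lambda>x. (*) (f' x)" g x "\<lambda>x. (*) (inverse (f' x))"])
      show "(f has_derivative (*) (f' x)) (at x)" if "x \<in> ?I" for x
        using d[OF that] by (simp add: has_field_derivative_def)
      show "(*) (f' x) \<circ> (*) (inverse (f' x)) = id"
        using pos[OF x(1)] by (auto simp: fun_eq_iff)
    qed (use gf x in auto)
    then show ?thesis using x gf by (simp add: has_field_derivative_def)
  qed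
  have "Cinf_on g (f ` ?I)"
  proof (rule Cinf_on_bootstrap[OF op gd])
    fix k assume k: "Ck_on k g (f ` ?I)"
    have "Cinf_on (\<lambda>x. inverse (f' x)) ?I"
      by (rule Cinf_on_inverse[OF Cf']) (use pos in force)
    then show "Ck_on k (\<lambda>y. inverse (f' (g y))) (f ` ?I)"
      using gf by (intro Ck_on_compose[OF op _ _ k, of ?I "\<lambda>x. inverse (f' x)"]) (auto simp: Cinf_on_def)
  qed
  then show ?thesis
    using that gf mono by (auto simp: strict_mono_on_def)
qed


section \<open>Diffeomorphisms, charts and tangent spaces\<close>

lemma smooth_on_iff: "smooth_on A f \<longleftrightarrow> (\<exists>W g. Cinf_on g W \<and> A \<subseteq> W \<and> (\<forall>x\<in>A. g x = f x))"
  unfolding smooth_on_def Cinf_on_def by (auto simp: conj_ac)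

lemma smooth_onE:
  assumes "smooth_on A f"
  obtains g W where "Cinf_on g W" "A \<subseteq> W" "\<forall>x\<in>A. g x = f x"
  using assms unfolding smooth_on_iff by blast

lemma Cinf_imp_smooth_on:
  fixes f :: "'a::euclidean_space \<Rightarrow> 'b::euclidean_space"
  shows "Cinf_on f W \<Longrightarrow> A \<subseteq> W \<Longrightarrow> smooth_on A f"
  unfolding smooth_on_iff by blast

lemma smooth_on_subset: "smooth_on A f \<Longrightarrow> B \<subseteq> A \<Longrightarrow> smooth_on B f"
  unfolding smooth_on_def by (meson subset_iff)

lemma smooth_on_cong: "smooth_on A f \<Longrightarrow> (\<And>x. x \<in> A \<Longrightarrow> f x = g x) \<Longrightarrow> smooth_on A g"
  unfolding smooth_on_def by metis

lemma smooth_on_compose: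
  assumes "smooth_on A f" "smooth_on B g" "f ` A \<subseteq> B"
  shows "smooth_on A (\<lambda>x. g (f x))"
proof -
  obtain F W where F: "Cinf_on F W" "A \<subseteq> W" "\<forall>x\<in>A. F x = f x"
    by (rule smooth_onE[OF assms(1)])
  obtain G W' where G: "Cinf_on G W'" "B \<subseteq> W'" "\<forall>x\<in>B. G x = g x"
    by (rule smooth_onE[OF assms(2)])
  have op: "open (W \<inter> F -` W')"
    using continuous_on_open_vimage[OF Cinf_on_open[OF F(1)]] Cinf_on_imp_continuous[OF F(1)]
      Cinf_on_open[OF G(1)] by (metis Int_commute)
  have "Cinf_on (\<lambda>x. G (F x)) (W \<inter> F -` W')"
    by (rule Cinf_on_compose[OF G(1) Cinf_on_subset[OF F(1) op]]) auto
  moreover have "f x \<in> B" if "x \<in> A" for x using that assms(3) by auto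
  then have "A \<subseteq> W \<inter> F -` W'" "\<forall>x\<in>A. G (F x) = g (f x)"
    using F(2,3) G(2,3) by (auto simp: subset_iff)
  ultimately show ?thesis unfolding smooth_on_iff by blast
qed

lemma smooth_on_map_prod:
  assumes "smooth_on A f" "smooth_on B g"
  shows "smooth_on (A \<times> B) (map_prod f g)"
proof -
  obtain F W where F: "Cinf_on F W" "A \<subseteq> W" "\<forall>x\<in>A. F x = f x"
    by (rule smooth_onE[OF assms(1)])
  obtain G W' where G: "Cinf_on G W'" "B \<subseteq> W'" "\<forall>x\<in>B. G x = g x"
    by (rule smooth_onE[OF assms(2)])
  have op: "open (W \<times> W')" using F(1) G(1) by (simp add: Cinf_on_open open_Times)
  have "Cinf_on (\<lambda>p. F (fst p)) (W \<times> W')"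
    by (rule Cinf_on_compose[OF F(1) Cinf_on_fst[OF Cinf_on_id[OF op]]]) auto
  moreover have "Cinf_on (\<lambda>p. G (snd p)) (W \<times> W')"
    by (rule Cinf_on_compose[OF G(1) Cinf_on_snd[OF Cinf_on_id[OF op]]]) auto
  ultimately have "Cinf_on (\<lambda>p. (F (fst p), G (snd p))) (W \<times> W')"
    by (rule Cinf_on_Pair)
  then show ?thesis
    unfolding smooth_on_iff
    by (intro exI[of _ "W \<times> W'"] exI[of _ "\<lambda>p. (F (fst p), G (snd p))"]) (use F G in auto)
qed

lemma smooth_on_continuous: "smooth_on A f \<Longrightarrow> continuous_on A f"
  by (erule smooth_onE) (metis Cinf_on_imp_continuous continuous_on_cong continuous_on_subset)

lemma diffeoI:
  assumes "smooth_on A f" "smooth_on B g" "f ` A \<subseteq> B" "g ` B \<subseteq> A"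
    "\<And>x. x \<in> A \<Longrightarrow> g (f x) = x" "\<And>y. y \<in> B \<Longrightarrow> f (g y) = y"
  shows "diffeo f A B"
proof -
  have "homeomorphism A B f g"
    by (rule homeomorphismI) (use assms smooth_on_continuous in auto)
  then show ?thesis using assms unfolding diffeo_def by blast
qed

lemma diffeoE:
  assumes "diffeo f A B"
  obtains g where "homeomorphism A B f g" "smooth_on A f" "smooth_on B g" "diffeo g B A"
  using assms unfolding diffeo_def by (meson homeomorphism_sym)

lemma diffeo_image: "diffeo f A B \<Longrightarrow> f ` A = B"
  by (meson diffeo_def homeomorphism_image1)

lemma diffeo_smooth: "diffeo f A B \<Longrightarrow> smooth_on A f"
  unfolding diffeo_def by blast

lemma diffeo_inj: "diffeo f A B \<Longrightarrow> inj_on f A"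
  unfolding diffeo_def using homeomorphism_apply1 by (metis inj_onI)

lemma diffeo_compose:
  assumes "diffeo f A B" "diffeo g B C"
  shows "diffeo (g \<circ> f) A C"
proof -
  obtain f' where f: "homeomorphism A B f f'" "smooth_on A f" "smooth_on B f'"
    by (rule diffeoE[OF assms(1)])
  obtain g' where g: "homeomorphism B C g g'" "smooth_on B g" "smooth_on C g'"
    by (rule diffeoE[OF assms(2)])
  have "smooth_on A (g \<circ> f)" "smooth_on C (f' \<circ> g')"
    unfolding o_def using f g
    by (auto intro!: smooth_on_compose[of _ _ B] simp: homeomorphism_def)
  then show ?thesis
    using homeomorphism_compose[OF f(1) g(1)] unfolding diffeo_def by blast
qed

lemma diffeo_restrict:
  assumes "diffeo f A B" "A' \<subseteq> A"
  shows "diffeo f A' (f ` A')"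
proof -
  obtain g where g: "homeomorphism A B f g" "smooth_on A f" "smooth_on B g"
    by (rule diffeoE[OF assms(1)])
  have "homeomorphism A' (f ` A') f g"
    by (rule homeomorphism_of_subsets[OF g(1) assms(2)])
      (use assms(2) homeomorphism_image1[OF g(1)] in auto)
  moreover have "f ` A' \<subseteq> B" using assms diffeo_image by blast
  ultimately show ?thesis
    using g assms(2) smooth_on_subset unfolding diffeo_def by metis
qed

lemma diffeo_cong: "diffeo f A B \<Longrightarrow> (\<And>x. x \<in> A \<Longrightarrow> f x = g x) \<Longrightarrow> diffeo g A B"
  unfolding diffeo_def by (metis (mono_tags, lifting) homeomorphism_cong smooth_on_cong)

lemma diffeo_map_prod:
  assumes "diffeo f A B" "diffeo g C D"
  shows "diffeo (map_prod f g) (A \<times> C) (B \<times> D)"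
proof -
  obtain f' where f: "homeomorphism A B f f'" "smooth_on A f" "smooth_on B f'"
    by (rule diffeoE[OF assms(1)])
  obtain g' where g: "homeomorphism C D g g'" "smooth_on C g" "smooth_on D g'"
    by (rule diffeoE[OF assms(2)])
  show ?thesis
    by (rule diffeoI[of _ _ _ "map_prod f' g'"])
      (use f g in \<open>auto intro!: smooth_on_map_prod simp: homeomorphism_def\<close>)
qed

lemma local_param_in: "local_param H M f V a x \<Longrightarrow> x \<in> M"
  unfolding local_param_def by (meson imageI openin_imp_subset subset_iff)

lemma local_param_image:
  assumes "diffeo \<Phi> A B" "M \<subseteq> A" "local_param H M f V a x"
  shows "local_param H (\<Phi> ` M) (\<Phi> \<circ> f) V a (\<Phi> x)"
proof -
  obtain g where g: "homeomorphism A B \<Phi> g" by (rule diffeoE[OF assms(1)])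
  have h: "homeomorphism M (\<Phi> ` M) \<Phi> g"
    by (rule homeomorphism_of_subsets[OF g assms(2)])
      (use assms(2) homeomorphism_image1[OF g] in auto)
  have V: "openin (top_of_set H) V" "a \<in> V" "f a = x" "openin (top_of_set M) (f ` V)"
    "diffeo f V (f ` V)" using assms(3) by (auto simp: local_param_def)
  have "f ` V \<subseteq> A" using V(4) assms(2) openin_imp_subset by blast
  then have "diffeo (\<Phi> \<circ> f) V (\<Phi> ` f ` V)"
    using diffeo_compose[OF V(5)] diffeo_restrict[OF assms(1)] by blast
  moreover have "openin (top_of_set (\<Phi> ` M)) (\<Phi> ` f ` V)"
    by (rule homeomorphism_imp_open_map[OF h V(4)])
  ultimately show ?thesis using V by (simp add: local_param_def image_comp)
qed

lemma surface_boundary_subset: "surface_boundary M \<subseteq> M"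
  unfolding surface_boundary_def using local_param_in by blast

lemma surface_boundary_image:
  assumes "diffeo \<Phi> A B" "M \<subseteq> A"
  shows "surface_boundary (\<Phi> ` M) = \<Phi> ` surface_boundary M"
proof -
  have *: "\<Psi> ` surface_boundary N \<subseteq> surface_boundary (\<Psi> ` N)"
    if "diffeo \<Psi> C D" "N \<subseteq> C" for \<Psi> C D and N
    using local_param_image[OF that] unfolding surface_boundary_def by blast
  obtain g where g: "homeomorphism A B \<Phi> g" "diffeo g B A" by (rule diffeoE[OF assms(1)])
  have "\<Phi> ` M \<subseteq> B" using assms diffeo_image by blast
  from *[OF g(2) this] have "g ` surface_boundary (\<Phi> ` M) \<subseteq> surface_boundary (g ` \<Phi> ` M)" .
  also have "g ` \<Phi> ` M = M"
    unfolding image_image using homeomorphism_apply1[OF g(1)] assms(2) by (simp add: subset_iff)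
  finally have "\<Phi> ` g ` surface_boundary (\<Phi> ` M) \<subseteq> \<Phi> ` surface_boundary M" by blast
  moreover have "\<Phi> ` g ` surface_boundary (\<Phi> ` M) = surface_boundary (\<Phi> ` M)"
    unfolding image_image
    using homeomorphism_apply2[OF g(1)] surface_boundary_subset[of "\<Phi> ` M"] \<open>\<Phi> ` M \<subseteq> B\<close>
    by (simp add: subset_iff)
  ultimately show ?thesis using *[OF assms] by blast
qed

lemma submanifold_image:
  "diffeo \<Phi> A B \<Longrightarrow> M \<subseteq> A \<Longrightarrow> submanifold H M \<Longrightarrow> submanifold H (\<Phi> ` M)"
  unfolding submanifold_def using local_param_image by blast

text \<open>This property of the two model spaces makes derivatives within their relatively open subsets
  unique.\<close>

definition directionally_full :: "'a::euclidean_space set \<Rightarrow> bool" where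
  "directionally_full H \<longleftrightarrow> (\<forall>a\<in>H. \<forall>i\<in>Basis. \<forall>e>0. \<exists>d. 0 < \<bar>d\<bar> \<and> \<bar>d\<bar> < e \<and> a + d *\<^sub>R i \<in> H)"

lemma directionally_full_half_plane: "directionally_full half_plane"
  unfolding directionally_full_def
proof (intro ballI allI impI)
  fix a :: complex and i :: complex and e :: real
  assume "a \<in> half_plane" "i \<in> Basis" "e > 0"
  then show "\<exists>d. 0 < \<bar>d\<bar> \<and> \<bar>d\<bar> < e \<and> a + d *\<^sub>R i \<in> half_plane"
    by (intro exI[of _ "e/2"]) (auto simp: half_plane_def Basis_complex_def)
qed

lemma directionally_full_UNIV: "directionally_full UNIV"
  unfolding directionally_full_def
proof (intro ballI allI impI)
  fix a i :: 'a and e :: real assume "e > 0"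
  then show "\<exists>d. 0 < \<bar>d\<bar> \<and> \<bar>d\<bar> < e \<and> a + d *\<^sub>R i \<in> UNIV"
    by (intro exI[of _ "e/2"]) auto
qed

lemma derivative_within_unique:
  assumes "directionally_full H" "openin (top_of_set H) V" "a \<in> V"
    and "(f has_derivative A) (at a within V)" "(f has_derivative B) (at a within V)"
  shows "A = B"
proof (rule frechet_derivative_unique_within[OF assms(4,5)])
  fix i :: 'a and e :: real assume i: "i \<in> Basis" and e: "e > 0"
  obtain O' where O': "open O'" "V = H \<inter> O'" using assms(2) by (auto simp: openin_open)
  then obtain r where r: "r > 0" "ball a r \<subseteq> O'" using assms(3) open_contains_ball by blast
  obtain d where d: "0 < \<bar>d\<bar>" "\<bar>d\<bar> < min e r" "a + d *\<^sub>R i \<in> H"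
    using assms(1,3) O' i e r unfolding directionally_full_def by (metis IntD1 min_less_iff_conj)
  have "a + d *\<^sub>R i \<in> ball a r" using d i by (simp add: dist_norm)
  then show "\<exists>d. 0 < \<bar>d\<bar> \<and> \<bar>d\<bar> < e \<and> a + d *\<^sub>R i \<in> V"
    using d r O' by auto
qed

lemma extension_derivative_within:
  assumes "Cinf_on F W" "V \<subseteq> W" "\<forall>b\<in>V. F b = f b" "a \<in> V"
  shows "(f has_derivative frechet_derivative F (at a)) (at a within V)"
proof -
  have "(F has_derivative frechet_derivative F (at a)) (at a within V)"
    using Cinf_on_derivative(1)[OF assms(1)] assms(2,4) has_derivative_at_withinI by blast
  then show ?thesis
    by (rule has_derivative_transform[OF assms(4), rotated]) (use assms(3) in simp)
qed

text \<open>A differentiable map into \<open>M\<close> factors through a chart, differentiably because the inverse of the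
  chart extends smoothly.  With \<open>H' = H\<close> this makes the tangent space independent of the chart; with
  the real line for \<open>H'\<close> it compares the tangent lines of the boundary with the tangent planes.\<close>

lemma velocity_in_chart_range:
  assumes chart: "local_param H M f V a x" and A: "(f has_derivative A) (at a within V)"
    and full: "directionally_full H" "directionally_full H'"
    and g: "openin (top_of_set H') V'" "a' \<in> V'" "g a' = x" "g ` V' \<subseteq> M" "continuous_on V' g"
      "(g has_derivative B) (at a' within V')"
  shows "range B \<subseteq> range A"
proof -
  have c: "openin (top_of_set H) V" "a \<in> V" "f a = x" "openin (top_of_set M) (f ` V)"
    "diffeo f V (f ` V)" using chart by (auto simp: local_param_def)
  obtain k where k: "homeomorphism V (f ` V) f k" "smooth_on (f ` V) k"
    by (rule diffeoE[OF c(5)])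
  obtain K W where K: "Cinf_on K W" "f ` V \<subseteq> W" "\<forall>y\<in>f ` V. K y = k y"
    by (rule smooth_onE[OF k(2)])
  define V2 where "V2 = V' \<inter> g -` (f ` V)"
  have V2: "openin (top_of_set V') V2"
    unfolding V2_def using g(4,5) c(4)
    by (metis continuous_openin_preimage image_subset_iff_funcset)
  have V2H: "openin (top_of_set H') V2" using V2 g(1) openin_trans by blast
  have a': "a' \<in> V2" using g(2,3) c(2,3) imageI[of a V f] unfolding V2_def by simp
  have B2: "(g has_derivative B) (at a' within V2)"
    using g(6) by (rule has_derivative_subset) (auto simp: V2_def)
  have "x \<in> W" using K(2) c(2,3) by blast
  obtain K' where K': "(K has_derivative K') (at x)"
    using Cinf_on_derivative(1)[OF K(1) \<open>x \<in> W\<close>] by blast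
  have Kx: "K x = a" using K(3) c(2,3) k(1) by (auto simp: homeomorphism_def)
  have 1: "((\<lambda>b. K (g b)) has_derivative (\<lambda>v. K' (B v))) (at a' within V2)"
    by (rule has_derivative_compose[OF B2]) (use K' g(3) in simp)
  have im: "(\<lambda>b. K (g b)) ` V2 \<subseteq> V" using K(3) k(1) by (auto simp: V2_def homeomorphism_def)
  have "(f has_derivative A) (at (K (g a')) within (\<lambda>b. K (g b)) ` V2)"
    using A im by (simp add: g(3) Kx) (metis has_derivative_subset)
  then have "((\<lambda>b. f (K (g b))) has_derivative (\<lambda>v. A (K' (B v)))) (at a' within V2)"
    by (rule has_derivative_in_compose[OF 1])
  then have "(g has_derivative (\<lambda>v. A (K' (B v)))) (at a' within V2)"
    by (rule has_derivative_transform[OF a', rotated])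
      (use K(3) k(1) in \<open>auto simp: V2_def homeomorphism_def\<close>)
  from derivative_within_unique[OF full(2) V2H a' B2 this]
  have "B v = A (K' (B v))" for v by metis
  then show ?thesis by blast
qed

lemma local_param_continuous: "local_param H M f V a x \<Longrightarrow> continuous_on V f"
  unfolding local_param_def diffeo_def homeomorphism_def by blast

lemma tangent_space_eq_range:
  assumes full: "directionally_full H" and c: "local_param H M f V a x"
    and A: "(f has_derivative A) (at a within V)"
  shows "tangent_space H M x = range A"
proof
  show "range A \<subseteq> tangent_space H M x"
    unfolding tangent_space_def using c A by blast
  show "tangent_space H M x \<subseteq> range A"
  proof
    fix v assume "v \<in> tangent_space H M x"
    then obtain g V' a' B where g: "local_param H M g V' a' x" "(g has_derivative B) (at a' within V')"
      "v \<in> range B" unfolding tangent_space_def by blast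
    have "g ` V' \<subseteq> M" using g(1) openin_imp_subset unfolding local_param_def by blast
    then have "range B \<subseteq> range A"
      using velocity_in_chart_range[OF c A full full, of V' a' g B] g local_param_continuous[OF g(1)]
      by (auto simp: local_param_def)
    then show "v \<in> range A" using g(3) by blast
  qed
qed

lemma chart_extension:
  assumes "local_param H M f V a x"
  obtains F W where "Cinf_on F W" "V \<subseteq> W" "\<forall>b\<in>V. F b = f b"
  using assms smooth_onE unfolding local_param_def diffeo_def by metis

lemma chart_derivative:
  assumes "local_param H M f V a x"
  obtains A where "(f has_derivative A) (at a within V)" "linear A"
proof -
  obtain F W where "Cinf_on F W" "V \<subseteq> W" "\<forall>b\<in>V. F b = f b"
    by (rule chart_extension[OF assms])
  then have "(f has_derivative frechet_derivative F (at a)) (at a within V)"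
    using assms by (intro extension_derivative_within) (auto simp: local_param_def)
  then show ?thesis using that has_derivative_linear by blast
qed

text \<open>The derivative of a smooth extension of the inverse is a left inverse of \<open>A\<close>.\<close>

lemma diffeo_derivative_inj:
  assumes full: "directionally_full H" and V: "openin (top_of_set H) V" "a \<in> V"
    and f: "diffeo f V B" "(f has_derivative A) (at a within V)"
  shows "inj A"
proof -
  obtain k where k: "homeomorphism V B f k" "smooth_on B k" by (rule diffeoE[OF f(1)])
  obtain K W where K: "Cinf_on K W" "B \<subseteq> W" "\<forall>y\<in>B. K y = k y"
    by (rule smooth_onE[OF k(2)])
  have "f a \<in> W" using K(2) V(2) k(1) by (auto simp: homeomorphism_def)
  then obtain K' where K': "(K has_derivative K') (at (f a))"
    using Cinf_on_derivative(1)[OF K(1)] by blast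
  have "((\<lambda>b. K (f b)) has_derivative (\<lambda>v. K' (A v))) (at a within V)"
    by (rule has_derivative_compose[OF f(2) K'])
  then have "((\<lambda>b. b) has_derivative (\<lambda>v. K' (A v))) (at a within V)"
    by (rule has_derivative_transform[OF V(2), rotated])
      (use K(3) k(1) in \<open>auto simp: homeomorphism_def\<close>)
  from derivative_within_unique[OF full V this has_derivative_ident]
  have "K' (A v) = v" for v by metis
  then show ?thesis by (metis injI)
qed

lemma tangent_space_image:
  assumes full: "directionally_full H" and d: "diffeo \<Phi> A B" "M \<subseteq> A" and M: "submanifold H M" "x \<in> M"
    and D: "(\<Phi> has_derivative \<Phi>') (at x)"
  shows "tangent_space H (\<Phi> ` M) (\<Phi> x) = \<Phi>' ` tangent_space H M x"
proof -
  obtain f V a where c: "local_param H M f V a x" using M unfolding submanifold_def by blast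
  obtain T where T: "(f has_derivative T) (at a within V)" by (rule chart_derivative[OF c])
  have "(\<Phi> \<circ> f has_derivative (\<lambda>v. \<Phi>' (T v))) (at a within V)"
    unfolding o_def by (rule has_derivative_compose[OF T]) (use D c in \<open>simp add: local_param_def\<close>)
  from tangent_space_eq_range[OF full local_param_image[OF d c] this] tangent_space_eq_range[OF full c T]
  show ?thesis by auto
qed

text \<open>If \<open>a'\<close> were interior, then by invariance of domain the transition map would carry a
  neighbourhood of it onto an open subset of the plane that contains \<open>a\<close> and lies in the half-plane.\<close>

lemma boundary_chart_invariant:
  assumes f: "local_param half_plane M f V a x" and g: "local_param half_plane M g V' a' x"
    and "Im a = 0"
  shows "Im a' = 0"
proof (rule ccontr)
  assume "Im a' \<noteq> 0"
  have cf: "openin (top_of_set half_plane) V" "a \<in> V" "f a = x" "openin (top_of_set M) (f ` V)"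
    "diffeo f V (f ` V)" using f by (auto simp: local_param_def)
  have cg: "openin (top_of_set half_plane) V'" "a' \<in> V'" "g a' = x" "openin (top_of_set M) (g ` V')"
    "diffeo g V' (g ` V')" using g by (auto simp: local_param_def)
  obtain k where k: "homeomorphism V (f ` V) f k" by (rule diffeoE[OF cf(5)])
  have a'pos: "Im a' > 0"
    using \<open>Im a' \<noteq> 0\<close> cg(1,2) openin_imp_subset by (fastforce simp: half_plane_def)
  define V2 where "V2 = V' \<inter> g -` (f ` V)"
  have "openin (top_of_set V') V2"
    unfolding V2_def using cf(4) openin_imp_subset[OF cg(4)] local_param_continuous[OF g]
    by (metis continuous_openin_preimage image_subset_iff_funcset)
  then have "openin (top_of_set half_plane) V2" using cg(1) openin_trans by blast
  then obtain O' where O': "open O'" "V2 = half_plane \<inter> O'" by (auto simp: openin_open)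
  define U where "U = O' \<inter> {b. 0 < Im b}"
  have U: "open U" unfolding U_def using O'(1) by (intro open_Int open_halfspace_Im_gt) auto
  have UV2: "U \<subseteq> V2" unfolding U_def O'(2) half_plane_def by auto
  have "a' \<in> V2" using cg(2,3) cf(2,3) imageI[of a V f] unfolding V2_def by simp
  then have a'U: "a' \<in> U" using a'pos O'(2) unfolding U_def by auto
  have "continuous_on U (\<lambda>b. k (g b))"
    by (rule continuous_on_compose2[of "f ` V" k])
      (use k UV2 local_param_continuous[OF g] in \<open>auto simp: homeomorphism_def V2_def intro: continuous_on_subset\<close>)
  moreover have "inj_on (\<lambda>b. k (g b)) U"
  proof (rule inj_onI)
    fix b c assume bc: "b \<in> U" "c \<in> U" "k (g b) = k (g c)"
    then have "g b \<in> f ` V" "g c \<in> f ` V" using UV2 by (auto simp: V2_def)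
    then have "g b = g c" using bc(3) k by (metis homeomorphism_apply2)
    then show "b = c" using diffeo_inj[OF cg(5)] bc UV2 unfolding V2_def inj_on_def by blast
  qed
  ultimately have "open ((\<lambda>b. k (g b)) ` U)" using U invariance_of_domain by blast
  moreover have "a \<in> (\<lambda>b. k (g b)) ` U"
    using a'U cg(3) cf(2,3) homeomorphism_apply1[OF k, of a] by force
  ultimately obtain e where e: "e > 0" "ball a e \<subseteq> (\<lambda>b. k (g b)) ` U"
    using open_contains_ball by blast
  have "(\<lambda>b. k (g b)) ` U \<subseteq> V" using UV2 k by (auto simp: V2_def homeomorphism_def)
  then have "ball a e \<subseteq> half_plane" using e cf(1) openin_imp_subset by fast
  moreover have "a - \<i> * of_real (e/2) \<in> ball a e" using e(1) by (simp add: dist_norm norm_mult)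
  ultimately have "a - \<i> * of_real (e/2) \<in> half_plane" by blast
  then show False using e(1) assms(3) by (simp add: half_plane_def)
qed

lemma surface_boundary_iff:
  "local_param half_plane M f V a x \<Longrightarrow> x \<in> surface_boundary M \<longleftrightarrow> Im a = 0"
  unfolding surface_boundary_def using boundary_chart_invariant by blast

lemma local_param_move:
  "local_param H M f V a x \<Longrightarrow> b \<in> V \<Longrightarrow> local_param H M f V b (f b)"
  unfolding local_param_def by blast

text \<open>The charts are the restrictions of half-plane charts to the real line; that they are onto
  relatively open sets of the boundary is the invariance just proved.\<close>

lemma submanifold_surface_boundary:
  assumes "submanifold half_plane M"
  shows "submanifold (UNIV :: real set) (surface_boundary M)"
  unfolding submanifold_def
proof
  fix x assume x: "x \<in> surface_boundary M"
  then obtain f V a where f: "local_param half_plane M f V a x" and a: "Im a = 0"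
    unfolding surface_boundary_def by blast
  have c: "openin (top_of_set half_plane) V" "a \<in> V" "f a = x" "openin (top_of_set M) (f ` V)"
    "diffeo f V (f ` V)" using f by (auto simp: local_param_def)
  define R where "R = {s::real. complex_of_real s \<in> V}"
  obtain O' where O': "open O'" "V = half_plane \<inter> O'" using c(1) by (auto simp: openin_open)
  have "R = complex_of_real -` O'" unfolding R_def O' half_plane_def by auto
  then have "open R" using O'(1) by (simp add: continuous_open_vimage continuous_on_of_real)
  have "diffeo complex_of_real R (complex_of_real ` R)"
    by (rule diffeoI[of _ _ _ Re])
      (auto intro!: Cinf_imp_smooth_on[OF Cinf_on_bounded_linear[OF _ open_UNIV]] bounded_linear_of_real bounded_linear_Re)
  moreover have sub: "complex_of_real ` R \<subseteq> V" by (auto simp: R_def)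
  ultimately have d: "diffeo (f \<circ> complex_of_real) R ((f \<circ> complex_of_real) ` R)"
    using diffeo_compose[OF _ diffeo_restrict[OF c(5)]] by (metis image_comp)
  have "(f \<circ> complex_of_real) ` R = surface_boundary M \<inter> f ` V"
  proof
    show "(f \<circ> complex_of_real) ` R \<subseteq> surface_boundary M \<inter> f ` V"
      using surface_boundary_iff[OF local_param_move[OF f]] by (auto simp: R_def)
    show "surface_boundary M \<inter> f ` V \<subseteq> (f \<circ> complex_of_real) ` R"
    proof
      fix y assume y: "y \<in> surface_boundary M \<inter> f ` V"
      then obtain b where b: "b \<in> V" "y = f b" by blast
      then have "Im b = 0" using surface_boundary_iff[OF local_param_move[OF f b(1)]] y by blast
      then have "b = complex_of_real (Re b)" by (simp add: complex_eq_iff)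
      then show "y \<in> (f \<circ> complex_of_real) ` R" using b unfolding R_def by (metis comp_apply imageI mem_Collect_eq)
    qed
  qed
  then have "openin (top_of_set (surface_boundary M)) ((f \<circ> complex_of_real) ` R)"
    using c(4) openin_subset_trans surface_boundary_subset
    by (smt (verit) inf.absorb_iff2 inf_assoc inf_commute openin_open)
  moreover have "complex_of_real (Re a) = a" using a by (simp add: complex_eq_iff)
  ultimately have "local_param UNIV (surface_boundary M) (f \<circ> complex_of_real) R (Re a) x"
    using \<open>open R\<close> d c(2,3) by (simp add: local_param_def R_def)
  then show "\<exists>f V a. local_param (UNIV :: real set) (surface_boundary M) f V a x" by blast
qed

lemma tangent_space_surface_boundary:
  assumes "submanifold half_plane M" "x \<in> M"
  shows "tangent_space (UNIV :: real set) (surface_boundary M) x \<subseteq> tangent_space half_plane M x"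
proof
  fix v assume "v \<in> tangent_space (UNIV :: real set) (surface_boundary M) x"
  then obtain g V' a' B where g: "local_param (UNIV::real set) (surface_boundary M) g V' a' x"
      "(g has_derivative B) (at a' within V')" "v \<in> range B" unfolding tangent_space_def by blast
  obtain f V a where c: "local_param half_plane M f V a x" using assms unfolding submanifold_def by blast
  obtain A where A: "(f has_derivative A) (at a within V)" by (rule chart_derivative[OF c])
  have "range B \<subseteq> range A"
  proof (rule velocity_in_chart_range[OF c A directionally_full_half_plane directionally_full_UNIV])
    show "g ` V' \<subseteq> M"
      using g(1) surface_boundary_subset[of M] openin_imp_subset unfolding local_param_def by blast
  qed (use g local_param_continuous[OF g(1)] in \<open>auto simp: local_param_def\<close>)
  then show "v \<in> tangent_space half_plane M x"
    using tangent_space_eq_range[OF directionally_full_half_plane c A] g(3) by blast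
qed


section \<open>Rounding the corner of the bidisk\<close>

lemma flat0_add_flat1_le: "flat 0 x + flat 1 x \<le> 1"
proof (cases "x \<le> 0")
  case False
  have "exp (- (1 / x)) * (1 + 1 / x) \<le> exp (- (1 / x)) * exp (1 / x)"
    by (intro mult_left_mono exp_ge_add_one_self) auto
  then show ?thesis using False by (simp add: flat_def field_simps exp_add[symmetric])
qed (simp add: flat_def)

lemma flat0_less_one: "flat 0 x < 1"
  by (simp add: flat_def)

lemma flat_nonneg: "flat m x \<ge> 0"
  by (simp add: flat_def)

text \<open>The radial identification is the inverse of a map that divides \<open>p\<close> by \<open>sqrt (n b)\<close>, where \<open>b\<close> is
  the squared length of the second coordinate of \<open>p\<close>.  The choice \<open>n b = (1 - b) / r1\<^sup>2\<close> would map
  the 4-disk to the cylinder of radius \<open>r1\<close>, except for the circle \<open>b = 1\<close>.  A term that is flat at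
  \<open>b0\<close> is added to keep \<open>n\<close> positive up to \<open>b = 1\<close>.  It has to be large enough to bring the image
  inside \<open>|w| \<le> r2\<close>, and small enough for \<open>b / n b\<close>, which is \<open>|w|\<^sup>2\<close> on the image, to stay
  increasing; the inequality between \<open>b0\<close>, \<open>r1\<close> and \<open>r2\<close> leaves room for both.\<close>

lemma rounding_profile:
  fixes r1 r2 b0 :: real
  assumes r: "r1 > 0" and b0: "0 < b0" "b0 < 1" "r1\<^sup>2 * b0 < r2\<^sup>2 * (1 - b0)"
  obtains n Z :: "real \<Rightarrow> real" and I where
    "{0..1} \<subseteq> I" "Cinf_on n I" "\<forall>b\<in>I. 0 < n b"
    "\<forall>b. b \<le> b0 \<longrightarrow> n b = (1 - b) / r1\<^sup>2"
    "\<forall>b\<in>{0..1}. 1 - b \<le> r1\<^sup>2 * n b" "\<forall>b\<in>{0..1}. b \<le> r2\<^sup>2 * n b"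
    "Cinf_on Z ((\<lambda>b. b / n b) ` I)" "\<forall>b\<in>I. Z (b / n b) = b"
proof -
  define G where "G m = (1 - b0) * exp (- m / (1 - b0)) * r2\<^sup>2 - r1\<^sup>2 * (b0 + m)" for m :: real
  have "(G \<longlongrightarrow> G 0) (at_right 0)"
    unfolding G_def by (intro tendsto_intros) (use b0 in auto)
  moreover have "G 0 > 0" using b0 by (simp add: G_def algebra_simps)
  ultimately have "eventually (\<lambda>m. G m > 0) (at_right 0)" by (rule order_tendstoD)
  moreover have "eventually (\<lambda>m::real. m > 0) (at_right 0)" by (simp add: eventually_at_right_less)
  ultimately have "eventually (\<lambda>m. G m > 0 \<and> m > 0) (at_right 0)" by (rule eventually_conj)
  then obtain m where m: "G m > 0" "m > 0"
    by (metis (no_types, lifting) eventually_happens' trivial_limit_at_right_real)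
  \<comment> \<open>A coefficient at most this large makes the derivative of \<open>b / n b\<close> positive; with equality,
    \<open>G m > 0\<close> says that \<open>n 1 > 1 / r2\<^sup>2\<close>.\<close>
  define kap where "kap = 1 / (r1\<^sup>2 * (b0 + m))"
  have kap: "kap > 0" using r m b0 by (simp add: kap_def)
  define n where "n b = (1 - b) / r1\<^sup>2 + kap * (b - b0) * flat 0 ((b - b0) / m)" for b
  define n' where "n' b = - 1 / r1\<^sup>2 + kap * (flat 0 ((b - b0) / m) + ((b - b0) / m) * flat 2 ((b - b0) / m))" for b
  have Cn: "Cinf_on n UNIV"
  proof -
    have "Cinf_on (\<lambda>b. (1 - b) * (1 / r1\<^sup>2) + kap * (b - b0) * flat 0 ((b - b0) * (1 / m))) UNIV"
      by (intro Cinf_on_add Cinf_on_mult Cinf_on_diff Cinf_on_const Cinf_on_id open_UNIV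
          Cinf_on_compose[OF Cinf_on_flat]) auto
    then show ?thesis by (rule Cinf_on_cong) (simp add: n_def)
  qed
  have dn: "(n has_field_derivative n' b) (at b)" for b
  proof -
    have f: "(flat 0 has_field_derivative flat 2 x) (at x)" for x
      using flat_has_derivative[of 0 x] by (simp add: numeral_2_eq_2)
    have "((\<lambda>b. (b - b0) / m) has_field_derivative 1 / m) (at b)"
      using m(2) by (auto intro!: derivative_eq_intros)
    from DERIV_chain2[OF f this]
    have 1: "((\<lambda>b. flat 0 ((b - b0) / m)) has_field_derivative flat 2 ((b - b0) / m) * (1 / m)) (at b)" .
    have 2: "((\<lambda>b. (1 - b) / r1\<^sup>2) has_field_derivative - 1 / r1\<^sup>2) (at b)"
      by (rule DERIV_cdivide) (auto intro!: derivative_eq_intros)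
    have 3: "((\<lambda>b. kap * (b - b0)) has_field_derivative kap) (at b)"
      by (auto intro!: derivative_eq_intros)
    show ?thesis
      unfolding n_def n'_def
      by (rule DERIV_cong[OF DERIV_add[OF 2 DERIV_mult[OF 3 1]]]) (simp add: algebra_simps)
  qed
  have x2: "x * flat 2 x = flat 1 x" for x
    by (simp add: flat_def power2_eq_square)
  \<comment> \<open>The numerator of the derivative of \<open>b / n b\<close>.\<close>
  have wr: "n b - b * n' b > 0" for b
  proof -
    define x where "x = (b - b0) / m"
    have b: "b = b0 + m * x" using m by (simp add: x_def)
    have "x * flat 1 x = flat 0 x" by (simp add: flat_def)
    then have bf: "b * flat 1 x = b0 * flat 1 x + m * flat 0 x" by (simp add: b algebra_simps)
    have "n b - b * n' b = 1 / r1\<^sup>2 + kap * ((b - b0) * flat 0 x) - kap * (b * flat 0 x + b * (x * flat 2 x))"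
      unfolding n_def n'_def x_def[symmetric] by (simp add: algebra_simps diff_divide_distrib)
    then have "n b - b * n' b = 1 / r1\<^sup>2 - kap * ((b0 + m) * flat 0 x + b0 * flat 1 x)"
      unfolding x2 bf by (simp add: algebra_simps)
    moreover have "(b0 + m) * flat 0 x + b0 * flat 1 x < b0 + m"
    proof -
      have "b0 * (flat 0 x + flat 1 x) \<le> b0 * 1"
        using flat0_add_flat1_le b0 by (intro mult_left_mono) auto
      moreover have "m * flat 0 x < m * 1" using flat0_less_one m by (intro mult_strict_left_mono)
      ultimately show ?thesis by (simp add: algebra_simps)
    qed
    then have "kap * ((b0 + m) * flat 0 x + b0 * flat 1 x) < kap * (b0 + m)"
      using kap by (intro mult_strict_left_mono)
    moreover have "kap * (b0 + m) = 1 / r1\<^sup>2" using m b0 by (simp add: kap_def)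
    ultimately show ?thesis by simp
  qed
  have nge: "n b \<ge> (1 - b) / r1\<^sup>2" for b
  proof (cases "b \<le> b0")
    case True then show ?thesis using m by (simp add: n_def flat_def divide_nonpos_pos)
  next
    case False then show ?thesis using kap flat_nonneg[of 0] by (simp add: n_def)
  qed
  have n1: "n 1 * r2\<^sup>2 \<ge> 1"
  proof -
    have n1eq: "n 1 = kap * (1 - b0) * exp (- m / (1 - b0))"
    proof -
      have "(1 - b0) / m > 0" using b0 m by simp
      then show ?thesis unfolding n_def flat_def by (simp add: not_le)
    qed
    have "r1\<^sup>2 * (b0 + m) \<le> (1 - b0) * exp (- m / (1 - b0)) * r2\<^sup>2"
      using m(1) by (simp add: G_def)
    moreover have "r1\<^sup>2 * (b0 + m) > 0" using r m b0 by simp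
    ultimately have "1 \<le> (1 - b0) * exp (- m / (1 - b0)) * r2\<^sup>2 / (r1\<^sup>2 * (b0 + m))"
      by (simp only: le_divide_eq_1_pos)
    then show ?thesis
      by (simp add: n1eq kap_def)
  qed
  have n1pos: "n 1 > 0" using n1 by (metis mult_nonpos_nonneg not_less not_one_le_zero order_trans zero_le_power2)
  have "open {b. n b > 0}"
    using Cinf_on_imp_continuous[OF Cn] by (intro open_Collect_less) auto
  then obtain d where d: "d > 0" "ball 1 d \<subseteq> {b. n b > 0}"
    using n1pos open_contains_ball by (metis mem_Collect_eq)
  define I where "I = {-1<..<1 + d}"
  have npos: "n b > 0" if "b \<in> I" for b
  proof (cases "b < 1")
    case True
    then have "(1 - b) / r1\<^sup>2 > 0" using r by simp
    then show ?thesis using nge[of b] by linarith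
  next
    case False
    then have "b \<in> ball 1 d" using that by (auto simp: I_def dist_real_def)
    then show ?thesis using d by blast
  qed
  define Y where "Y b = b / n b" for b
  have dY: "(Y has_field_derivative (n b - b * n' b) / (n b)\<^sup>2) (at b)" if "b \<in> I" for b
    unfolding Y_def using npos[OF that] dn[of b]
    by (auto intro!: derivative_eq_intros simp: power2_eq_square)
  have CY: "Cinf_on Y I"
    unfolding Y_def
    by (rule Cinf_on_divide[OF Cinf_on_id Cinf_on_subset[OF Cn]])
      (auto simp: I_def dest: npos[unfolded I_def greaterThanLessThan_iff, OF conjI])
  obtain Z where Z: "Cinf_on Z (Y ` I)" "\<And>b. b \<in> I \<Longrightarrow> Z (Y b) = b" "strict_mono_on I Y"
    unfolding I_def
  proof (rule strictly_increasing_smooth_inverse[OF CY[unfolded I_def], of "\<lambda>b. (n b - b * n' b) / (n b)\<^sup>2"])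
    show "(Y has_field_derivative (n b - b * n' b) / (n b)\<^sup>2) (at b)" if "b \<in> {-1<..<1 + d}" for b
      using dY that by (simp add: I_def)
    show "(n b - b * n' b) / (n b)\<^sup>2 > 0" if "b \<in> {-1<..<1 + d}" for b
      using wr npos[of b] that by (simp add: I_def)
  qed (use that in \<open>auto simp: I_def\<close>)
  have "b \<le> r2\<^sup>2 * n b" if "b \<in> {0..1}" for b
  proof -
    have bI: "b \<in> I" "1 \<in> I" using that d by (auto simp: I_def)
    have "Y b \<le> Y 1" using Z(3) bI that by (auto simp: strict_mono_on_def le_less)
    also have "Y 1 \<le> r2\<^sup>2" using n1 n1pos by (simp add: Y_def field_simps)
    finally show ?thesis using npos[OF bI(1)] by (simp add: Y_def field_simps)
  qed
  moreover have "1 - b \<le> r1\<^sup>2 * n b" for b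
    using nge[of b] r by (simp add: field_simps)
  moreover have "n b = (1 - b) / r1\<^sup>2" if "b \<le> b0" for b
    using that m by (simp add: n_def flat_def divide_nonpos_pos)
  moreover have "{0..1} \<subseteq> I" "open I" using d by (auto simp: I_def)
  ultimately show ?thesis
    using npos Z(1,2) Cinf_on_subset[OF Cn, of I] by (intro that[of I n Z]) (auto simp: Y_def)
qed

lemma norm_Pair_sq: "(norm (q :: complex \<times> complex))\<^sup>2 = (cmod (fst q))\<^sup>2 + (cmod (snd q))\<^sup>2"
  by (cases q) (simp add: norm_Pair)

lemma D4_iff: "q \<in> D4 \<longleftrightarrow> (cmod (fst q))\<^sup>2 + (cmod (snd q))\<^sup>2 \<le> 1"
  by (cases q) (simp add: D4_def)

lemma D4_eq: "D4 = cball 0 1"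
proof -
  have "(cmod (fst q))\<^sup>2 + (cmod (snd q))\<^sup>2 \<le> 1 \<longleftrightarrow> norm q \<le> 1" for q :: "complex \<times> complex"
    unfolding norm_Pair_sq[symmetric] using abs_square_le_1[of "norm q"] by simp
  then show ?thesis by (simp add: set_eq_iff D4_iff)
qed

lemma exists_radial_identification:
  fixes r1 r2 y1 :: real
  assumes r: "r1 > 0" "r2 > 0" and y1: "0 \<le> y1" "y1 < r2\<^sup>2"
    and T: "T \<subseteq> cball 0 r1 \<times> cball 0 r2" "\<forall>q\<in>T. (cmod (snd q))\<^sup>2 < y1"
  shows "\<exists>X h. radial_identification r1 r2 T X h \<and>
    (\<forall>q\<in>T. h q = (1 / sqrt (r1\<^sup>2 + (cmod (snd q))\<^sup>2)) *\<^sub>R q)"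
proof -
  \<comment> \<open>The rounding takes place where \<open>|w|\<^sup>2 > y0\<close>, away from \<open>T\<close>; \<open>b0\<close> is the corresponding bound in
    the 4-disk.\<close>
  define y0 where "y0 = (y1 + r2\<^sup>2) / 2"
  have y0: "y1 < y0" "y0 < r2\<^sup>2" "0 < y0" using y1 by (auto simp: y0_def)
  define b0 where "b0 = y0 / (r1\<^sup>2 + y0)"
  have pos: "r1\<^sup>2 + y > 0" if "y \<ge> 0" for y using r that by (simp add: add_pos_nonneg)
  have b0: "0 < b0" "b0 < 1" using y0 pos[of y0] r by (auto simp: b0_def field_simps)
  have "1 - b0 = r1\<^sup>2 / (r1\<^sup>2 + y0)" using pos[of y0] y0 by (simp add: b0_def field_simps)
  then have "r1\<^sup>2 * b0 < r2\<^sup>2 * (1 - b0)"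
    using pos[of y0] y0 r by (simp add: b0_def divide_strict_right_mono)
  then obtain n Z I where I: "{0..1} \<subseteq> I" and n: "Cinf_on n I" "\<forall>b\<in>I. 0 < n b"
    "\<forall>b. b \<le> b0 \<longrightarrow> n b = (1 - b) / r1\<^sup>2"
    "\<forall>b\<in>{0..1}. 1 - b \<le> r1\<^sup>2 * n b" "\<forall>b\<in>{0..1}. b \<le> r2\<^sup>2 * n b"
    and Z: "Cinf_on Z ((\<lambda>b. b / n b) ` I)" "\<forall>b\<in>I. Z (b / n b) = b"
    by (rule rounding_profile[OF r(1) b0])
  define N where "N = (\<lambda>q :: complex \<times> complex. (cmod (snd q))\<^sup>2)"
  have CN: "Cinf_on N U" if "open U" for U
    unfolding N_def by (intro Cinf_on_norm_sq Cinf_on_snd Cinf_on_id that)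
  have Nscale: "N (c *\<^sub>R q) = c\<^sup>2 * N q" for c q
    by (simp add: N_def power_mult_distrib)
  define k where "k p = inverse (sqrt (n (N p))) *\<^sub>R p" for p
  define h where "h q = sqrt (n (Z (N q))) *\<^sub>R q" for q
  define W where "W = (\<lambda>b. b / n b) ` I"
  have ZW: "Z ` W \<subseteq> I" using Z(2) by (auto simp: W_def)
  have openN: "open (N -` U)" if "open U" for U
    by (rule open_vimage[OF that Cinf_on_imp_continuous[OF CN[OF open_UNIV]]])
  have oI: "open I" "open W" using Cinf_on_open n(1) Z(1) by (auto simp: W_def)
  have Ck: "Cinf_on k (N -` I)"
    unfolding k_def
    by (intro Cinf_on_scaleR Cinf_on_inverse Cinf_on_sqrt Cinf_on_compose[OF n(1)] CN Cinf_on_id openN oI)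
      (use n(2) in fastforce)+
  have Ch: "Cinf_on h (N -` W)"
    unfolding h_def
    by (intro Cinf_on_scaleR Cinf_on_sqrt Cinf_on_compose[OF n(1)] Cinf_on_compose[OF Z(1)[folded W_def]]
        CN Cinf_on_id openN oI)
      (use n(2) ZW in auto)
  have ND4: "N p \<in> {0..1}" if "p \<in> D4" for p
    using that unfolding D4_iff N_def by (auto intro: order_trans[rotated])
  have Nk: "N (k p) = N p / n (N p)" and hk: "h (k p) = p" if "p \<in> D4" for p
  proof -
    have pI: "N p \<in> I" using ND4[OF that] I by blast
    then have np: "n (N p) > 0" using n(2) by blast
    then show e: "N (k p) = N p / n (N p)"
      by (simp add: k_def Nscale power_inverse divide_inverse)
    show "h (k p) = p"
      unfolding h_def e using Z(2) pI np by (simp add: k_def)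
  qed
  have NkW: "N (k p) \<in> W" if "p \<in> D4" for p
    using Nk[OF that] ND4[OF that] I unfolding W_def by blast
  define X where "X = k ` D4"
  have dh: "diffeo h X D4"
  proof (rule diffeoI[of _ _ _ k])
    show "smooth_on X h"
      by (rule Cinf_imp_smooth_on[OF Ch]) (use NkW in \<open>auto simp: X_def\<close>)
    show "smooth_on D4 k"
      by (rule Cinf_imp_smooth_on[OF Ck]) (use ND4 I in blast)
  qed (auto simp: X_def hk)
  have Xsub: "X \<subseteq> cball 0 r1 \<times> cball 0 r2"
  proof
    fix q assume "q \<in> X"
    then obtain p where p: "p \<in> D4" "q = k p" by (auto simp: X_def)
    let ?b = "N p"
    have b: "?b \<in> {0..1}" "n ?b > 0" using ND4[OF p(1)] n(2) I by blast+
    have "(cmod (fst q))\<^sup>2 = (cmod (fst p))\<^sup>2 / n ?b"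
      using b by (simp add: p(2) k_def power_mult_distrib power_inverse divide_inverse)
    also have "\<dots> \<le> (1 - ?b) / n ?b"
      using p(1) b by (intro divide_right_mono) (auto simp: D4_iff N_def)
    also have "\<dots> \<le> r1\<^sup>2" using n(4) b by (simp add: field_simps)
    finally have 1: "cmod (fst q) \<le> r1" using r power2_le_imp_le by fastforce
    have "(cmod (snd q))\<^sup>2 = ?b / n ?b" using Nk[OF p(1)] p(2) by (simp add: N_def)
    also have "\<dots> \<le> r2\<^sup>2" using n(5) b by (simp add: field_simps)
    finally have "cmod (snd q) \<le> r2" using r power2_le_imp_le by fastforce
    with 1 show "q \<in> cball 0 r1 \<times> cball 0 r2" by (cases q) simp
  qed
  have inner: "q \<in> X \<and> h q = (1 / sqrt (r1\<^sup>2 + N q)) *\<^sub>R q"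
    if q: "q \<in> cball 0 r1 \<times> cball 0 r2" "N q \<le> y1" for q
  proof -
    define R where "R = r1\<^sup>2 + N q"
    have N0: "N q \<ge> 0" by (simp add: N_def)
    have R: "R > 0" using pos N0 by (simp add: R_def)
    define p where "p = (1 / sqrt R) *\<^sub>R q"
    have Np: "N p = N q / R" using R by (simp add: p_def Nscale power_divide)
    have "N q / R \<le> b0"
      using q(2) y0(1,3) R pos[of y0] r unfolding b0_def R_def
      by (simp add: divide_simps) (simp add: algebra_simps mult_right_mono)
    then have "n (N p) = (1 - N q / R) / r1\<^sup>2" using n(3) Np by simp
    also have "1 - N q / R = r1\<^sup>2 / R"
      using R diff_divide_distrib[of R "N q" R] by (simp add: R_def)
    also have "r1\<^sup>2 / R / r1\<^sup>2 = 1 / R" using r by simp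
    finally have kp: "k p = q" using R by (simp add: k_def p_def real_sqrt_divide)
    have "cmod (fst q) \<le> r1" using q(1) by (cases q) simp
    then have "(cmod (fst q))\<^sup>2 \<le> r1\<^sup>2" by (simp add: power_mono)
    then have "p \<in> D4"
      using R by (simp add: D4_iff p_def power_mult_distrib power_divide N_def R_def
          add_divide_distrib[symmetric])
    then have "h q = p" "q \<in> X" using hk[of p] kp by (simp_all add: X_def image_iff) metis
    then show ?thesis by (simp add: p_def R_def)
  qed
  define V where "V = N -` {y1<..}"
  have "open V" unfolding V_def by (intro openN) simp
  moreover have "sphere 0 r1 \<times> sphere 0 r2 \<subseteq> V" using y1 by (auto simp: V_def N_def)
  moreover have "closure V \<inter> T = {}"
  proof -
    have "closed (N -` {y1..})"
      using closed_vimage[OF closed_atLeast] Cinf_on_imp_continuous[OF CN[OF open_UNIV]]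
      by blast
    then have "closure V \<subseteq> N -` {y1..}" by (intro closure_minimal) (auto simp: V_def)
    then show ?thesis using T(2) by (force simp: N_def)
  qed
  moreover have "cball 0 r1 \<times> cball 0 r2 - X \<subseteq> V" using inner by (force simp: V_def)
  moreover have "\<forall>q\<in>X. \<exists>c>0. h q = c *\<^sub>R q"
  proof
    fix q assume "q \<in> X"
    then have "Z (N q) \<in> I" using NkW ZW by (auto simp: X_def)
    then show "\<exists>c>0. h q = c *\<^sub>R q" using n(2) by (auto simp: h_def intro!: exI[of _ "sqrt (n (Z (N q)))"])
  qed
  ultimately have "radial_identification r1 r2 T X h"
    unfolding radial_identification_def using Xsub dh by blast
  moreover have "\<forall>q\<in>T. h q = (1 / sqrt (r1\<^sup>2 + (cmod (snd q))\<^sup>2)) *\<^sub>R q"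
    using inner T unfolding N_def by (metis less_imp_le subsetD)
  ultimately show ?thesis by blast
qed


section \<open>Squeezing the 4-disk\<close>

text \<open>In the coordinates \<open>(|z|\<^sup>2, |w|\<^sup>2)\<close> the 4-disk is a triangle, and this is its projective
  automorphism that fixes the three vertices and multiplies one of the homogeneous coordinates by
  \<open>l\<^sup>2\<close>.  Hence it preserves the 4-disk and is inverted by \<open>squeeze (1 / l)\<close>.\<close>

definition squeeze :: "real \<Rightarrow> complex \<times> complex \<Rightarrow> complex \<times> complex" where
  "squeeze l q = (1 / sqrt (1 - (1 - l\<^sup>2) * (cmod (snd q))\<^sup>2)) *\<^sub>R (fst q, l *\<^sub>R snd q)"

lemma squeeze_denominator_pos:
  fixes b l :: real
  assumes "0 \<le> b" "b \<le> 1" "l \<noteq> 0"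
  shows "1 - (1 - l\<^sup>2) * b > 0"
proof -
  have "1 - (1 - l\<^sup>2) * b = (1 - b) + l\<^sup>2 * b" by (simp add: algebra_simps)
  also have "\<dots> > 0"
  proof (cases "b = 1")
    case False then show ?thesis using assms by (intro add_pos_nonneg) auto
  qed (use assms in auto)
  finally show ?thesis .
qed

lemma D4_snd_le: "q \<in> D4 \<Longrightarrow> (cmod (snd q))\<^sup>2 \<le> 1"
  unfolding D4_iff using zero_le_power2[of "cmod (fst q)"] by linarith

lemma squeeze_in_D4:
  assumes "q \<in> D4" "l \<noteq> 0"
  shows "squeeze l q \<in> D4"
proof -
  let ?b = "(cmod (snd q))\<^sup>2"
  define d where "d = 1 - (1 - l\<^sup>2) * ?b"
  have d: "d > 0" unfolding d_def
    using squeeze_denominator_pos[of ?b l] D4_snd_le[OF assms(1)] assms(2) by simp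
  have "(cmod (fst q))\<^sup>2 + l\<^sup>2 * ?b \<le> d"
    using assms(1) by (simp add: D4_iff d_def algebra_simps)
  moreover have "(cmod (fst (squeeze l q)))\<^sup>2 + (cmod (snd (squeeze l q)))\<^sup>2
      = ((cmod (fst q))\<^sup>2 + l\<^sup>2 * ?b) / d"
    using d by (simp add: squeeze_def d_def[symmetric] power_mult_distrib power_divide add_divide_distrib)
  ultimately show ?thesis using d by (simp add: D4_iff)
qed

lemma squeeze_inverse:
  assumes "q \<in> D4" "l > 0"
  shows "squeeze (1 / l) (squeeze l q) = q"
proof -
  let ?b = "(cmod (snd q))\<^sup>2"
  define d where "d = 1 - (1 - l\<^sup>2) * ?b"
  have d: "d > 0" unfolding d_def
    using squeeze_denominator_pos[of ?b l] D4_snd_le[OF assms(1)] assms(2) by simp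
  have sq: "squeeze l q = (1 / sqrt d) *\<^sub>R (fst q, l *\<^sub>R snd q)"
    by (simp add: squeeze_def d_def)
  have "(cmod (snd (squeeze l q)))\<^sup>2 = l\<^sup>2 * ?b / d"
    using d by (simp add: sq power_mult_distrib power_divide)
  then have "1 - (1 - (1 / l)\<^sup>2) * (cmod (snd (squeeze l q)))\<^sup>2 = 1 - (1 - (1 / l)\<^sup>2) * (l\<^sup>2 * ?b / d)"
    by (simp only:)
  also have "\<dots> = (d - (l\<^sup>2 - 1) * ?b) / d"
    using d assms(2) by (simp add: field_simps)
  also have "\<dots> = 1 / d" by (simp add: d_def algebra_simps)
  finally show ?thesis
    using d assms(2) unfolding squeeze_def[of "1/l"] by (simp add: sq real_sqrt_divide)
qed

lemma Cinf_on_squeeze_family: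
  fixes e :: real
  defines "L \<equiv> \<lambda>t :: real. 1 - t * (1 - e)"
  assumes "e > 0"
  shows "\<exists>W. Cinf_on (\<lambda>(t, q). squeeze (L t) q) W \<and> {0..1} \<times> D4 \<subseteq> W"
proof -
  define D where "D = (\<lambda>x :: real \<times> complex \<times> complex.
    1 - (1 - (1 - fst x * (1 - e))\<^sup>2) * (cmod (snd (snd x)))\<^sup>2)"
  have CD: "Cinf_on D UNIV"
    unfolding D_def
    by (intro Cinf_on_diff Cinf_on_mult Cinf_on_power Cinf_on_norm_sq Cinf_on_const Cinf_on_fst Cinf_on_snd
        Cinf_on_id open_UNIV)
  define W where "W = D -` {0<..}"
  have "open W" unfolding W_def by (rule open_vimage[OF _ Cinf_on_imp_continuous[OF CD]]) simp
  have "Cinf_on (\<lambda>x. inverse (sqrt (D x)) *\<^sub>R (fst (snd x), (1 - fst x * (1 - e)) *\<^sub>R snd (snd x))) W"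
    by (intro Cinf_on_scaleR Cinf_on_Pair Cinf_on_inverse Cinf_on_sqrt Cinf_on_diff Cinf_on_mult
        Cinf_on_const Cinf_on_fst Cinf_on_snd Cinf_on_id Cinf_on_subset[OF CD] \<open>open W\<close>)
      (auto simp: W_def)
  then have "Cinf_on (\<lambda>(t, q). squeeze (L t) q) W"
    by (rule Cinf_on_cong) (auto simp: squeeze_def D_def L_def divide_inverse)
  moreover have "{0..1} \<times> D4 \<subseteq> W"
  proof (rule subrelI)
    fix t q assume tq: "(t :: real, q) \<in> {0..1} \<times> D4"
    have "t * (1 - e) < 1"
    proof (cases "e < 1")
      case True
      then have "t * (1 - e) \<le> 1 * (1 - e)" using tq by (intro mult_right_mono) auto
      also have "\<dots> < 1" using assms(2) by simp
      finally show ?thesis .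
    next
      case False
      then have "t * (1 - e) \<le> 0" using tq by (intro mult_nonneg_nonpos) auto
      then show ?thesis by linarith
    qed
    then show "(t, q) \<in> W"
      using squeeze_denominator_pos[of "(cmod (snd q))\<^sup>2" "1 - t * (1 - e)"] D4_snd_le[of q] tq
      by (simp add: W_def D_def)
  qed
  ultimately show ?thesis by blast
qed

lemma smooth_on_squeeze:
  assumes "l > 0"
  shows "smooth_on D4 (squeeze l)"
proof -
  obtain W where W: "Cinf_on (\<lambda>(t, q). squeeze (1 - t * (1 - l)) q) W" "{0..1} \<times> D4 \<subseteq> W"
    using Cinf_on_squeeze_family[OF assms] by blast
  have 1: "smooth_on ({0..1} \<times> D4) (\<lambda>(t, q). squeeze (1 - t * (1 - l)) q)"
    using W by (rule Cinf_imp_smooth_on)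
  have 2: "smooth_on D4 (\<lambda>q. (1::real, q))"
    by (intro Cinf_imp_smooth_on[of _ UNIV] Cinf_on_Pair Cinf_on_const Cinf_on_id open_UNIV) auto
  have "(\<lambda>q. (1::real, q)) ` D4 \<subseteq> {0..1} \<times> D4" by auto
  from smooth_on_compose[OF 2 1 this] show ?thesis by simp
qed

lemma squeeze_isotopy:
  assumes "e > 0"
  shows "ambient_isotopic D4 A (squeeze e ` A)"
  unfolding ambient_isotopic_def
proof (intro exI[of _ "\<lambda>t. squeeze (1 - t * (1 - e))"] conjI ballI)
  obtain W where W: "Cinf_on (\<lambda>(t, q). squeeze (1 - t * (1 - e)) q) W" "{0..1} \<times> D4 \<subseteq> W"
    using Cinf_on_squeeze_family[OF assms] by blast
  show "smooth_on ({0..1} \<times> D4) (\<lambda>(t, q). squeeze (1 - t * (1 - e)) q)"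
    using W by (rule Cinf_imp_smooth_on)
  fix t :: real assume t: "t \<in> {0..1}"
  define l where "l = 1 - t * (1 - e)"
  have "l = (1 - t) + t * e" by (simp add: l_def algebra_simps)
  also have "\<dots> > 0"
    using t assms by (cases "t = 1") (auto intro: add_pos_nonneg)
  finally have l: "l > 0" .
  show "diffeo (squeeze (1 - t * (1 - e))) D4 D4"
    unfolding l_def[symmetric]
    by (rule diffeoI[of _ _ _ "squeeze (1 / l)"])
      (use l squeeze_inverse[of _ "1 / l"] in
        \<open>auto simp: smooth_on_squeeze squeeze_in_D4 squeeze_inverse\<close>)
qed (auto simp: squeeze_def)

definition cross :: "complex \<Rightarrow> complex \<Rightarrow> real" where
  "cross u v = Im (cnj u * v)"

lemma cross_expand: "cross (a *\<^sub>R u - b *\<^sub>R z) (c *\<^sub>R v - d *\<^sub>R z) =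
    a * c * cross u v + a * d * cross z u - b * c * cross z v"
  by (simp add: cross_def algebra_simps)

lemma omega_st_cross: "omega_st u v = cross (fst u) (fst v) + cross (snd u) (snd v)"
  by (simp add: omega_st_def cross_def field_simps)

lemma alpha_st_cross: "alpha_st q v = (cross (fst q) (fst v) + cross (snd q) (snd v)) / 2"
  by (simp add: alpha_st_def cross_def field_simps)

text \<open>The radial identification near the surface, followed by squeezing, as \<open>squeeze_radial\<close> shows.\<close>

definition flatten :: "real \<Rightarrow> real \<Rightarrow> complex \<times> complex \<Rightarrow> complex \<times> complex" where
  "flatten r e q = (1 / sqrt (r\<^sup>2 + e\<^sup>2 * (cmod (snd q))\<^sup>2)) *\<^sub>R (fst q, e *\<^sub>R snd q)"

lemma squeeze_radial:
  assumes "r > 0" "e > 0"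
  shows "squeeze e ((1 / sqrt (r\<^sup>2 + (cmod (snd q))\<^sup>2)) *\<^sub>R q) = flatten r e q"
proof -
  let ?y = "(cmod (snd q))\<^sup>2"
  define R where "R = r\<^sup>2 + ?y"
  have R: "R > 0" using assms by (simp add: R_def add_pos_nonneg)
  have "1 - (1 - e\<^sup>2) * (?y / R) = (R - (1 - e\<^sup>2) * ?y) / R"
    using R by (simp add: diff_divide_distrib)
  also have "R - (1 - e\<^sup>2) * ?y = r\<^sup>2 + e\<^sup>2 * ?y" by (simp add: R_def algebra_simps)
  finally show ?thesis
    using R unfolding squeeze_def flatten_def R_def[symmetric]
    by (simp add: power_mult_distrib power_divide real_sqrt_divide)
qed

definition flatten' :: "real \<Rightarrow> real \<Rightarrow> complex \<times> complex \<Rightarrow> complex \<times> complex \<Rightarrow> complex \<times> complex" where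
  "flatten' r e q v = (let s = 1 / sqrt (r\<^sup>2 + e\<^sup>2 * (cmod (snd q))\<^sup>2); d = s ^ 3 * e\<^sup>2 * (snd q \<bullet> snd v)
     in (s *\<^sub>R fst v - d *\<^sub>R fst q, (s * e) *\<^sub>R snd v - (d * e) *\<^sub>R snd q))"

text \<open>With \<open>\<alpha>\<^sub>z = (|z|\<^sup>2 / 2) d\<theta>\<^sub>z\<close>, this is the 2-form \<open>|w|\<^sup>2 A\<^sub>z + r\<^sup>2 A\<^sub>w - d(|w|\<^sup>2) \<and> \<alpha>\<^sub>z\<close>, the
  coefficient of \<open>e\<^sup>2\<close> in \<open>omega_flatten\<close>.\<close>

definition beta :: "real \<Rightarrow> complex \<times> complex \<Rightarrow> complex \<times> complex \<Rightarrow> complex \<times> complex \<Rightarrow> real" where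
  "beta r q u v = (cmod (snd q))\<^sup>2 * cross (fst u) (fst v) + r\<^sup>2 * cross (snd u) (snd v)
     + (snd q \<bullet> snd v) * cross (fst q) (fst u) - (snd q \<bullet> snd u) * cross (fst q) (fst v)"

context
  fixes r e :: real
  assumes r: "r > 0" and e: "e > 0"
begin

lemma flatten_denominator_pos: "r\<^sup>2 + e\<^sup>2 * (cmod w)\<^sup>2 > 0"
  using r by (simp add: add_pos_nonneg)

lemma norm_flatten_sq: "(norm (flatten r e q))\<^sup>2 =
    ((cmod (fst q))\<^sup>2 + e\<^sup>2 * (cmod (snd q))\<^sup>2) / (r\<^sup>2 + e\<^sup>2 * (cmod (snd q))\<^sup>2)"
  using flatten_denominator_pos[of "snd q"]
  by (simp add: flatten_def norm_Pair_sq power_mult_distrib power_divide add_divide_distrib)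

lemma flatten_norm_le_1: "norm (flatten r e q) \<le> 1 \<longleftrightarrow> cmod (fst q) \<le> r"
  and flatten_norm_eq_1: "norm (flatten r e q) = 1 \<longleftrightarrow> cmod (fst q) = r"
proof -
  have "norm (flatten r e q) \<le> 1 \<longleftrightarrow> (norm (flatten r e q))\<^sup>2 \<le> 1"
    using abs_square_le_1[of "norm (flatten r e q)"] by simp
  also have "\<dots> \<longleftrightarrow> (cmod (fst q))\<^sup>2 \<le> r\<^sup>2"
    unfolding norm_flatten_sq using flatten_denominator_pos[of "snd q"] by (simp add: divide_simps)
  also have "\<dots> \<longleftrightarrow> cmod (fst q) \<le> r" using r by (simp add: power2_le_iff_abs_le)
  finally show "norm (flatten r e q) \<le> 1 \<longleftrightarrow> cmod (fst q) \<le> r" .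
  have "norm (flatten r e q) = 1 \<longleftrightarrow> (norm (flatten r e q))\<^sup>2 = 1"
    by (simp add: power2_eq_1_iff) (smt (verit) norm_ge_zero)
  also have "\<dots> \<longleftrightarrow> (cmod (fst q))\<^sup>2 = r\<^sup>2"
    unfolding norm_flatten_sq using flatten_denominator_pos[of "snd q"] by (simp add: divide_simps)
  also have "\<dots> \<longleftrightarrow> cmod (fst q) = r" using r by (simp add: power2_eq_iff_nonneg)
  finally show "norm (flatten r e q) = 1 \<longleftrightarrow> cmod (fst q) = r" .
qed

lemma diffeo_flatten: "diffeo (flatten r e) UNIV {p. cmod (snd p) < 1}"
proof -
  define g where "g p = (r * inverse (sqrt (1 - (cmod (snd p))\<^sup>2))) *\<^sub>R (fst p, (1 / e) *\<^sub>R snd p)"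
    for p :: "complex \<times> complex"
  have "Cinf_on (\<lambda>q. inverse (sqrt (r\<^sup>2 + e\<^sup>2 * (cmod (snd q))\<^sup>2)) *\<^sub>R (fst q, e *\<^sub>R snd q))
      (UNIV :: (complex \<times> complex) set)"
    by (intro Cinf_on_scaleR Cinf_on_Pair Cinf_on_inverse Cinf_on_sqrt Cinf_on_add Cinf_on_mult
        Cinf_on_norm_sq Cinf_on_const Cinf_on_fst Cinf_on_snd Cinf_on_id open_UNIV)
      (use flatten_denominator_pos in \<open>auto simp: less_imp_neq[symmetric]\<close>)
  then have C1: "smooth_on UNIV (flatten r e)"
    by (intro Cinf_imp_smooth_on[of _ UNIV]) (auto simp: flatten_def[abs_def] divide_inverse)
  have "open {p :: complex \<times> complex. cmod (snd p) < 1}"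
    by (intro open_Collect_less continuous_intros)
  then have "Cinf_on g {p. cmod (snd p) < 1}"
    unfolding g_def
    by (intro Cinf_on_scaleR Cinf_on_Pair Cinf_on_inverse Cinf_on_sqrt Cinf_on_diff Cinf_on_mult
        Cinf_on_norm_sq Cinf_on_const Cinf_on_fst Cinf_on_snd Cinf_on_id)
      (auto simp: abs_square_less_1 abs_square_eq_1)
  then have C2: "smooth_on {p. cmod (snd p) < 1} g"
    by (rule Cinf_imp_smooth_on) simp
  have sn: "(cmod (snd (flatten r e q)))\<^sup>2
      = e\<^sup>2 * (cmod (snd q))\<^sup>2 / (r\<^sup>2 + e\<^sup>2 * (cmod (snd q))\<^sup>2)" for q
    using flatten_denominator_pos[of "snd q"]
    by (simp add: flatten_def power_mult_distrib power_divide)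
  show ?thesis
  proof (rule diffeoI[OF C1 C2])
    show "flatten r e ` UNIV \<subseteq> {p. cmod (snd p) < 1}"
    proof clarsimp
      fix z w
      have "(cmod (snd (flatten r e (z, w))))\<^sup>2 < 1"
        unfolding sn using flatten_denominator_pos[of w] r by simp
      then show "cmod (snd (flatten r e (z, w))) < 1" by (simp add: abs_square_less_1)
    qed
    show "g (flatten r e q) = q" for q
    proof -
      define R where "R = r\<^sup>2 + e\<^sup>2 * (cmod (snd q))\<^sup>2"
      have R: "R > 0" using flatten_denominator_pos by (simp add: R_def)
      have "1 - (cmod (snd (flatten r e q)))\<^sup>2 = (R - e\<^sup>2 * (cmod (snd q))\<^sup>2) / R"
        unfolding sn R_def[symmetric] using R by (simp add: diff_divide_distrib)
      then have "1 - (cmod (snd (flatten r e q)))\<^sup>2 = r\<^sup>2 / R" by (simp add: R_def)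
      then show ?thesis
        using R r e unfolding g_def by (simp add: flatten_def R_def[symmetric] real_sqrt_divide)
    qed
    show "flatten r e (g p) = p" if "p \<in> {p. cmod (snd p) < 1}" for p
    proof -
      define c where "c = 1 - (cmod (snd p))\<^sup>2"
      have c: "c > 0" using that by (simp add: c_def abs_square_less_1)
      have "(cmod (snd (g p)))\<^sup>2 = r\<^sup>2 / c * (cmod (snd p))\<^sup>2 / e\<^sup>2"
        using c by (simp add: g_def c_def[symmetric] power_mult_distrib power_divide power_inverse divide_inverse)
      then have "r\<^sup>2 + e\<^sup>2 * (cmod (snd (g p)))\<^sup>2 = r\<^sup>2 * (c + (cmod (snd p))\<^sup>2) / c"
        using c e by (simp add: field_simps)
      then have "r\<^sup>2 + e\<^sup>2 * (cmod (snd (g p)))\<^sup>2 = r\<^sup>2 / c" by (simp add: c_def)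
      then show ?thesis
        using c e r unfolding flatten_def by (simp add: g_def c_def[symmetric] real_sqrt_divide)
    qed
  qed auto
qed

lemma flatten_has_derivative: "(flatten r e has_derivative flatten' r e q) (at q)"
proof -
  define R where "R q = r\<^sup>2 + e\<^sup>2 * (snd q \<bullet> snd q)" for q :: "complex \<times> complex"
  have Rpos: "R q > 0" for q using flatten_denominator_pos by (simp add: R_def power2_norm_eq_inner)
  have dR: "(R has_derivative (\<lambda>v. 2 * e\<^sup>2 * (snd q \<bullet> snd v))) (at q)"
    unfolding R_def by (auto intro!: derivative_eq_intros simp: inner_commute algebra_simps)
  have "((\<lambda>x. 1 / sqrt x) has_field_derivative ((-1/2) * (1 / sqrt (R q)) ^ 3)) (at (R q))"
    using Rpos[of q] by (auto intro!: derivative_eq_intros simp: divide_simps power3_eq_cube)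
  from has_derivative_compose[OF dR this[unfolded has_field_derivative_def]]
  have "((\<lambda>x. 1 / sqrt (R x)) has_derivative
      (\<lambda>v. (-1/2) * (1 / sqrt (R q)) ^ 3 * (2 * e\<^sup>2 * (snd q \<bullet> snd v)))) (at q)" .
  moreover have "((\<lambda>q. (fst q, e *\<^sub>R snd q)) has_derivative (\<lambda>v. (fst v, e *\<^sub>R snd v))) (at q)"
    by (auto intro!: derivative_eq_intros)
  ultimately have "((\<lambda>q. (1 / sqrt (R q)) *\<^sub>R (fst q, e *\<^sub>R snd q)) has_derivative
      (\<lambda>v. (1 / sqrt (R q)) *\<^sub>R (fst v, e *\<^sub>R snd v)
        + ((-1/2) * (1 / sqrt (R q)) ^ 3 * (2 * e\<^sup>2 * (snd q \<bullet> snd v))) *\<^sub>R (fst q, e *\<^sub>R snd q))) (at q)"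
    by (rule has_derivative_scaleR)
  moreover have "flatten r e = (\<lambda>q. (1 / sqrt (R q)) *\<^sub>R (fst q, e *\<^sub>R snd q))"
    by (simp add: fun_eq_iff flatten_def R_def power2_norm_eq_inner)
  moreover have "flatten' r e q = (\<lambda>v. (1 / sqrt (R q)) *\<^sub>R (fst v, e *\<^sub>R snd v)
        + ((-1/2) * (1 / sqrt (R q)) ^ 3 * (2 * e\<^sup>2 * (snd q \<bullet> snd v))) *\<^sub>R (fst q, e *\<^sub>R snd q))"
    by (simp add: fun_eq_iff flatten'_def R_def power2_norm_eq_inner Let_def algebra_simps)
  ultimately show ?thesis by simp
qed

lemma alpha_flatten: "alpha_st (flatten r e q) (flatten' r e q v) =
    (cross (fst q) (fst v) + e\<^sup>2 * cross (snd q) (snd v)) / (2 * (r\<^sup>2 + e\<^sup>2 * (cmod (snd q))\<^sup>2))"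
proof -
  define s where "s = 1 / sqrt (r\<^sup>2 + e\<^sup>2 * (cmod (snd q))\<^sup>2)"
  have s2: "s * s = 1 / (r\<^sup>2 + e\<^sup>2 * (cmod (snd q))\<^sup>2)"
    using flatten_denominator_pos[of "snd q"] by (simp add: s_def)
  have c: "cross (a *\<^sub>R z) (b *\<^sub>R u - c *\<^sub>R z) = a * b * cross z u" for a b c z u
    by (simp add: cross_def algebra_simps)
  have "alpha_st (flatten r e q) (flatten' r e q v) = (s * s) * (cross (fst q) (fst v) + e\<^sup>2 * cross (snd q) (snd v)) / 2"
    unfolding alpha_st_cross flatten_def flatten'_def Let_def s_def[symmetric]
    by (simp add: c power2_eq_square algebra_simps)
  then show ?thesis unfolding s2 by simp
qed

text \<open>Since \<open>\<omega> = d\<alpha>\<close> and \<open>\<alpha>\<close> is homogeneous, \<open>\<alpha>\<close> pulls back to \<open>(\<alpha>\<^sub>z + e\<^sup>2 \<alpha>\<^sub>w) / \<rho>\<close> with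
  \<open>\<rho> = r\<^sup>2 + e\<^sup>2 |w|\<^sup>2\<close>.  In the differential of this form the terms of order \<open>e\<^sup>4\<close> cancel, because
  \<open>d(|w|\<^sup>2) \<and> \<alpha>\<^sub>w = |w|\<^sup>2 A\<^sub>w\<close>.  That leaves an expression linear in \<open>e\<^sup>2\<close>, in which no error term
  competes with \<open>A\<^sub>w\<close> at the branch points.\<close>

lemma omega_flatten: "omega_st (flatten' r e q u) (flatten' r e q v) =
    (r\<^sup>2 * cross (fst u) (fst v) + e\<^sup>2 * beta r q u v) / (r\<^sup>2 + e\<^sup>2 * (cmod (snd q))\<^sup>2)\<^sup>2"
proof -
  define s where "s = 1 / sqrt (r\<^sup>2 + e\<^sup>2 * (cmod (snd q))\<^sup>2)"
  define R where "R = r\<^sup>2 + e\<^sup>2 * (cmod (snd q))\<^sup>2"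
  have R: "R > 0" using flatten_denominator_pos by (simp add: R_def)
  have s2: "s\<^sup>2 = 1 / R"
    using R by (simp add: s_def R_def power_divide)
  then have s4: "s ^ 4 = 1 / R\<^sup>2" using power_mult[of s 2 2] by (simp add: power_divide)
  have key: "(cmod w)\<^sup>2 * cross u v + (w \<bullet> v) * cross w u - (w \<bullet> u) * cross w v = 0" for w u v
    by (simp add: cross_def inner_complex_def cmod_power2) (simp add: algebra_simps power2_eq_square)
  have "omega_st (flatten' r e q u) (flatten' r e q v) = s\<^sup>2 * (cross (fst u) (fst v) + e\<^sup>2 * cross (snd u) (snd v))
      + s ^ 4 * e\<^sup>2 * ((snd q \<bullet> snd v) * (cross (fst q) (fst u) + e\<^sup>2 * cross (snd q) (snd u))
        - (snd q \<bullet> snd u) * (cross (fst q) (fst v) + e\<^sup>2 * cross (snd q) (snd v)))"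
    unfolding omega_st_cross flatten'_def Let_def s_def[symmetric]
    by (simp add: cross_expand power2_eq_square power3_eq_cube power4_eq_xxxx algebra_simps)
  also have "\<dots> = (R * (cross (fst u) (fst v) + e\<^sup>2 * cross (snd u) (snd v))
      + e\<^sup>2 * ((snd q \<bullet> snd v) * (cross (fst q) (fst u) + e\<^sup>2 * cross (snd q) (snd u))
        - (snd q \<bullet> snd u) * (cross (fst q) (fst v) + e\<^sup>2 * cross (snd q) (snd v)))) / R\<^sup>2"
    unfolding s2 s4 using R by (simp add: add_divide_distrib power2_eq_square)
  also have "R * (cross (fst u) (fst v) + e\<^sup>2 * cross (snd u) (snd v))
      + e\<^sup>2 * ((snd q \<bullet> snd v) * (cross (fst q) (fst u) + e\<^sup>2 * cross (snd q) (snd u))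
        - (snd q \<bullet> snd u) * (cross (fst q) (fst v) + e\<^sup>2 * cross (snd q) (snd v)))
      = r\<^sup>2 * cross (fst u) (fst v) + e\<^sup>2 * beta r q u v + e\<^sup>2 * e\<^sup>2 *
        ((cmod (snd q))\<^sup>2 * cross (snd u) (snd v) + (snd q \<bullet> snd v) * cross (snd q) (snd u)
          - (snd q \<bullet> snd u) * cross (snd q) (snd v))"
    by (simp add: R_def beta_def algebra_simps)
  finally show ?thesis unfolding key R_def by simp
qed

lemma inner_flatten:
  assumes "cmod (fst q) = r"
  shows "flatten r e q \<bullet> flatten' r e q v = (fst q \<bullet> fst v) / (r\<^sup>2 + e\<^sup>2 * (cmod (snd q))\<^sup>2)"
proof -
  define R where "R = r\<^sup>2 + e\<^sup>2 * (cmod (snd q))\<^sup>2"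
  define s where "s = 1 / sqrt R"
  have R: "R > 0" using flatten_denominator_pos by (simp add: R_def)
  have s2: "s\<^sup>2 = 1 / R" using R by (simp add: s_def power_divide)
  have "fst q \<bullet> fst q = r\<^sup>2" "snd q \<bullet> snd q = (cmod (snd q))\<^sup>2"
    using assms by (simp_all add: power2_norm_eq_inner[symmetric])
  then have "flatten r e q \<bullet> flatten' r e q v
      = s\<^sup>2 * (fst q \<bullet> fst v + e\<^sup>2 * (snd q \<bullet> snd v)) - s\<^sup>2 * e\<^sup>2 * (snd q \<bullet> snd v) * (s\<^sup>2 * R)"
    unfolding flatten_def flatten'_def Let_def R_def[symmetric] s_def[symmetric]
    by (simp add: inner_Pair inner_diff_right power2_eq_square power3_eq_cube)
      (simp add: R_def algebra_simps power2_eq_square)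
  then show ?thesis unfolding R_def[symmetric] using R by (simp add: s2 algebra_simps)
qed

end


section \<open>Charts of a braided surface\<close>

lemma lin_det_complex:
  fixes A :: "complex \<Rightarrow> complex"
  shows "lin_det A = cross (A 1) (A \<i>)"
proof -
  have f: "finite {\<i>}" "1 \<notin> {\<i>}" by auto
  show ?thesis
    unfolding lin_det_def Basis_complex_def sum_over_permutations_insert[OF f] permutes_sing
    by (simp add: sign_swap_id sign_id cross_def inner_complex_def Transposition.transpose_def)
qed

lemma sum_permutations_block:
  fixes g :: "'x \<Rightarrow> 'x \<Rightarrow> real"
  assumes d: "a \<noteq> b" "a \<noteq> c" "a \<noteq> d" "b \<noteq> c" "b \<noteq> d" "c \<noteq> d"
    and z: "g c a = 0" "g c b = 0" "g d a = 0" "g d b = 0"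
  shows "(\<Sum>p | p permutes {a, b, c, d}. of_int (sign p) * (\<Prod>x\<in>{a, b, c, d}. g x (p x)))
    = (g a a * g b b - g a b * g b a) * (g c c * g d d - g c d * g d c)"
proof -
  have 1: "finite {b, c, d}" "a \<notin> {b, c, d}"
    and 2: "finite {c, d}" "b \<notin> {c, d}" and 3: "finite {d}" "c \<notin> {d}" using d by auto
  note d' = d d[symmetric]
  show ?thesis
    unfolding sum_over_permutations_insert[OF 1] sum_over_permutations_insert[OF 2]
      sum_over_permutations_insert[OF 3] permutes_sing
    by (simp add: d' z sign_compose permutation_swap_id permutation_compose sign_swap_id sign_id
        Transposition.transpose_def) (simp add: algebra_simps)
qed

lemma lin_det_block_triangular:
  fixes A :: "complex \<times> complex \<Rightarrow> complex \<times> complex"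
  assumes "\<And>v. fst (A (0, v)) = 0"
  shows "lin_det A = lin_det (\<lambda>u. fst (A (u, 0))) * lin_det (\<lambda>v. snd (A (0, v)))"
proof -
  let ?a = "(1, 0) :: complex \<times> complex" and ?b = "(\<i>, 0) :: complex \<times> complex"
    and ?c = "(0, 1) :: complex \<times> complex" and ?d = "(0, \<i>) :: complex \<times> complex"
  have B: "Basis = {?a, ?b, ?c, ?d}" by (auto simp: Basis_prod_def Basis_complex_def)
  have "lin_det A = (A ?a \<bullet> ?a * (A ?b \<bullet> ?b) - A ?a \<bullet> ?b * (A ?b \<bullet> ?a))
      * (A ?c \<bullet> ?c * (A ?d \<bullet> ?d) - A ?c \<bullet> ?d * (A ?d \<bullet> ?c))"
    unfolding lin_det_def B
    by (rule sum_permutations_block[of ?a ?b ?c ?d "\<lambda>x y. A x \<bullet> y"])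
      (use assms in \<open>simp_all add: inner_prod_def\<close>)
  then show ?thesis
    unfolding lin_det_complex by (simp add: cross_def inner_prod_def inner_complex_def)
qed

lemma cross_linear_image:
  assumes "linear A"
  shows "cross (A u) (A v) = lin_det A * cross u v"
proof -
  have e: "A z = Re z *\<^sub>R A 1 + Im z *\<^sub>R A \<i>" for z
  proof -
    have "z = Re z *\<^sub>R 1 + Im z *\<^sub>R \<i>" by (simp add: complex_eq_iff)
    then have "A z = A (Re z *\<^sub>R 1 + Im z *\<^sub>R \<i>)" by (rule arg_cong)
    then show ?thesis by (simp only: linear_add[OF assms] linear_scale[OF assms])
  qed
  show ?thesis
    unfolding e[of u] e[of v] lin_det_complex cross_def by (simp add: algebra_simps)
qed

lemma lin_det_compose:
  "linear A \<Longrightarrow> lin_det (\<lambda>u. A (B u)) = lin_det A * lin_det B" for A B :: "complex \<Rightarrow> complex"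
  using cross_linear_image[of A "B 1" "B \<i>"] by (simp add: lin_det_complex)

lemma inj_linear_cross_nonzero:
  assumes "linear A" "inj A"
  shows "cross (A 1) (A \<i>) \<noteq> 0"
proof
  assume 0: "cross (A 1) (A \<i>) = 0"
  have "surj A" using linear_injective_imp_surjective assms by blast
  then obtain u v where "A u = 1" "A v = \<i>" by (metis surjD)
  then have "cross 1 \<i> = 0"
    using cross_linear_image[OF assms(1), of u v] 0 by (simp add: lin_det_complex)
  then show False by (simp add: cross_def)
qed

lemma abs_cross_le: "\<bar>cross u v\<bar> \<le> cmod u * cmod v"
  unfolding cross_def by (metis abs_Im_le_cmod complex_mod_cnj norm_mult)

lemma cross_simps:
  "cross (u + v) w = cross u w + cross v w" "cross w (u + v) = cross w u + cross w v"
  "cross (s *\<^sub>R u) v = s * cross u v" "cross u (s *\<^sub>R v) = s * cross u v" "cross u u = 0"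
  "cross 0 u = 0" "cross u 0 = 0"
  by (simp_all add: cross_def algebra_simps)

lemma smooth_on_open_iff:
  fixes f :: "'a::euclidean_space \<Rightarrow> 'b::euclidean_space"
  assumes U: "open U"
  shows "smooth_on U f \<longleftrightarrow> Cinf_on f U"
proof
  assume "smooth_on U f"
  then obtain g W where "Cinf_on g W" "U \<subseteq> W" "\<forall>x\<in>U. g x = f x" using smooth_onE[of U f] by metis
  then show "Cinf_on f U" using Cinf_on_cong[OF Cinf_on_subset[OF _ U]] by metis
qed (rule Cinf_imp_smooth_on[OF _ order_refl])

lemma oriented_diffeo_inverse_derivative:
  assumes f: "oriented_diffeo f U (f ` U)" "open U" "open (f ` U)" "x \<in> U"
    and g: "homeomorphism U (f ` U) f g"
  obtains f' g' where "(f has_derivative f') (at x)" "lin_det f' > 0"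
    "(g has_derivative g') (at (f x))" "\<And>v. f' (g' v) = v"
proof -
  obtain f' where f': "(f has_derivative f') (at x within U)" "lin_det f' > 0"
    using f(1,4) unfolding oriented_diffeo_def by blast
  have f'x: "(f has_derivative f') (at x)" using f'(1) at_within_open[OF f(4,2)] by simp
  obtain g1 where g1: "homeomorphism U (f ` U) f g1" "smooth_on (f ` U) g1"
    using f(1) unfolding oriented_diffeo_def diffeo_def by blast
  have "g1 y = g y" if "y \<in> f ` U" for y
    using that g g1(1) by (auto simp: homeomorphism_def)
  then have "smooth_on (f ` U) g" by (rule smooth_on_cong[OF g1(2)])
  then have "Cinf_on g (f ` U)" using smooth_on_open_iff f(3) by blast
  then obtain g' where g': "(g has_derivative g') (at (f x))"
    using Cinf_on_derivative(1) f(4) by blast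
  have gfx: "g (f x) = x" using g f(4) by (simp add: homeomorphism_def)
  have "((\<lambda>y. f (g y)) has_derivative (\<lambda>v. f' (g' v))) (at (f x))"
    by (rule has_derivative_compose[OF g']) (use f'x gfx in simp)
  then have "((\<lambda>y. y) has_derivative (\<lambda>v. f' (g' v))) (at (f x))"
    by (rule has_derivative_transform_within_open[OF _ f(3)])
      (use f(4) g in \<open>auto simp: homeomorphism_def\<close>)
  from has_derivative_unique[OF this has_derivative_ident]
  have "f' (g' v) = v" for v by metis
  then show ?thesis using that f'x f'(2) g' by blast
qed

text \<open>The alternative on which the symplectic argument rests: at the point in question either the
  first projection is regular, or the tangent plane is vertical with its complex orientation and
  the first projection does not reverse orientations in the chart.  The chart is extended to an open
  set so that its derivatives depend continuously on the point.\<close>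

definition adapted_chart ::
    "(complex \<times> complex) set \<Rightarrow> (complex \<Rightarrow> complex \<times> complex) \<Rightarrow> complex set \<Rightarrow> complex set \<Rightarrow>
     complex \<Rightarrow> complex \<times> complex \<Rightarrow> bool" where
  "adapted_chart T F V W a x \<longleftrightarrow>
     local_param half_plane T F V a x \<and> Cinf_on F W \<and> V \<subseteq> W \<and>
     (let D = (\<lambda>b. frechet_derivative F (at b));
          jz = (\<lambda>b. cross (fst (D b 1)) (fst (D b \<i>)))
      in jz a \<noteq> 0 \<or>
         (\<forall>v. fst (D a v) = 0) \<and> cross (snd (D a 1)) (snd (D a \<i>)) > 0 \<and> (\<forall>b\<in>V. jz b \<ge> 0))"

lemma local_param_cong:
  assumes "local_param H M f V a x" "\<forall>b\<in>V. F b = f b"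
  shows "local_param H M F V a x"
proof -
  have "F ` V = f ` V" using assms(2) by simp
  moreover have "diffeo F V (f ` V)"
    by (rule diffeo_cong[of f]) (use assms in \<open>simp_all add: local_param_def\<close>)
  ultimately show ?thesis
    using assms unfolding local_param_def by simp
qed

text \<open>Where the first projection is a local diffeomorphism onto \<open>D1\<close>, any chart is adapted: its
  composite with the projection is a diffeomorphism within the half-plane, and so has injective
  derivative.\<close>

lemma adapted_chart_regular:
  assumes S: "submanifold half_plane S" "x \<in> S" "S \<subseteq> D1 \<times> D2"
    and ld: "local_diffeo_at fst S D1 x"
    and \<phi>: "diffeo \<phi>1 D1 E1" "diffeo \<phi>2 D2 E2"
  shows "\<exists>F V W a. adapted_chart (map_prod \<phi>1 \<phi>2 ` S) F V W a (map_prod \<phi>1 \<phi>2 x) \<and>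
     cross (fst (frechet_derivative F (at a) 1)) (fst (frechet_derivative F (at a) \<i>)) \<noteq> 0"
proof -
  let ?\<phi> = "map_prod \<phi>1 \<phi>2"
  obtain f V a where f: "local_param half_plane S f V a x"
    using S unfolding submanifold_def by blast
  note c = local_param_image[OF diffeo_map_prod[OF \<phi>] S(3) f]
  obtain F W where F: "Cinf_on F W" "V \<subseteq> W" "\<forall>b\<in>V. F b = (?\<phi> \<circ> f) b"
    by (rule chart_extension[OF c])
  define A where "A = frechet_derivative F (at a)"
  have a: "a \<in> V" "f a = x" and Vo: "openin (top_of_set half_plane) V" "diffeo f V (f ` V)"
    and fV: "f ` V \<subseteq> S"
    using f openin_imp_subset unfolding local_param_def by blast+
  have dA: "(?\<phi> \<circ> f has_derivative A) (at a within V)"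
    unfolding A_def by (rule extension_derivative_within[OF F a(1)])
  then have linA: "linear A" by (rule has_derivative_linear)
  obtain U V0 where U: "x \<in> U" "openin (top_of_set S) U" "diffeo fst U V0"
    and V0: "openin (top_of_set D1) V0"
    using ld unfolding local_diffeo_at_def by blast
  define V' where "V' = V \<inter> f -` U"
  have "openin (top_of_set V) V'"
    unfolding V'_def using U(2) fV local_param_continuous[OF f]
    by (metis continuous_openin_preimage image_subset_iff_funcset)
  then have V'o: "openin (top_of_set half_plane) V'" using Vo(1) openin_trans by blast
  have aV': "a \<in> V'" using a U(1) by (simp add: V'_def)
  have sub: "f ` V' \<subseteq> U" "V' \<subseteq> V" by (auto simp: V'_def)
  have "V0 \<subseteq> D1" using V0 openin_imp_subset by blast
  have d1: "diffeo (fst \<circ> f) V' (fst ` f ` V')"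
    by (rule diffeo_compose[OF diffeo_restrict[OF Vo(2) sub(2)] diffeo_restrict[OF U(3) sub(1)]])
  have "fst ` f ` V' \<subseteq> D1" using sub(1) diffeo_image[OF U(3)] \<open>V0 \<subseteq> D1\<close> by blast
  then have d2: "diffeo (\<phi>1 \<circ> (fst \<circ> f)) V' (\<phi>1 ` fst ` f ` V')"
    using diffeo_compose[OF d1] diffeo_restrict[OF \<phi>(1)] by blast
  have "((\<lambda>b. fst ((?\<phi> \<circ> f) b)) has_derivative (\<lambda>v. fst (A v))) (at a within V)"
    by (rule has_derivative_fst[OF dA])
  then have "((\<phi>1 \<circ> (fst \<circ> f)) has_derivative (\<lambda>v. fst (A v))) (at a within V')"
    using has_derivative_subset[OF _ sub(2)] by (simp add: o_def)
  from diffeo_derivative_inj[OF directionally_full_half_plane V'o aV' d2 this]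
  have "inj (\<lambda>v. fst (A v))" .
  moreover have "linear (\<lambda>v. fst (A v))" using linear_compose[OF linA linear_fst] by (simp add: o_def)
  ultimately have "cross (fst (A 1)) (fst (A \<i>)) \<noteq> 0"
    using inj_linear_cross_nonzero by blast
  then show ?thesis
    unfolding adapted_chart_def Let_def
    using local_param_cong[OF c F(3)] F(1,2) by (auto simp: A_def)
qed

text \<open>The chart is the parametrization \<open>u \<mapsto> \<Phi>\<^sup>-\<^sup>1 (u\<^sup>2, u)\<close> given by the branch coordinates.  Its first
  component is \<open>\<psi>\<^sup>-\<^sup>1 (u\<^sup>2)\<close>, whose Jacobian is a positive multiple of \<open>4 |u|\<^sup>2\<close>.  Since
  \<open>\<psi> (fst q) = fst (\<Phi> q)\<close>, the derivative of \<open>\<Phi>\<close> is block triangular; both \<open>\<Phi>\<close> and \<open>\<psi>\<close> preserve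
  orientations, and therefore so does the vertical block, which is the inverse of the derivative of
  the second component at \<open>u = 0\<close>.  The maps \<open>\<phi>1\<close> and \<open>\<phi>2\<close> multiply both Jacobians by positive
  factors.\<close>

lemma adapted_chart_branch:
  assumes S: "S \<subseteq> D1 \<times> D2"
    and pc: "positive_branch_coordinates D1 D2 S x"
    and \<phi>: "oriented_diffeo \<phi>1 D1 E1" "oriented_diffeo \<phi>2 D2 E2"
  shows "\<exists>F V W a. adapted_chart (map_prod \<phi>1 \<phi>2 ` S) F V W a (map_prod \<phi>1 \<phi>2 x)"
proof -
  let ?\<phi> = "map_prod \<phi>1 \<phi>2"
  obtain U N \<Phi> \<psi> where U: "open U" "x \<in> U" "U \<subseteq> D1 \<times> D2" and N: "open N" "N \<subseteq> D1" "fst ` U \<subseteq> N"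
    and \<Phi>: "open (\<Phi> ` U)" "oriented_diffeo \<Phi> U (\<Phi> ` U)" "\<Phi> x = (0, 0)"
    and \<psi>: "open (\<psi> ` N)" "oriented_diffeo \<psi> N (\<psi> ` N)" "\<forall>q\<in>U. \<psi> (fst q) = fst (\<Phi> q)"
    and im: "\<Phi> ` (S \<inter> U) = {(z, w). (z, w) \<in> \<Phi> ` U \<and> z = w\<^sup>2}"
    using pc unfolding positive_branch_coordinates_def by blast
  have d\<Phi>: "diffeo \<Phi> U (\<Phi> ` U)" using \<Phi>(2) by (simp add: oriented_diffeo_def)
  have d\<psi>: "diffeo \<psi> N (\<psi> ` N)" using \<psi>(2) by (simp add: oriented_diffeo_def)
  have d\<phi>: "diffeo \<phi>1 D1 E1" "diffeo \<phi>2 D2 E2" using \<phi> by (simp_all add: oriented_diffeo_def)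
  obtain P where P: "homeomorphism U (\<Phi> ` U) \<Phi> P" "smooth_on (\<Phi> ` U) P" "diffeo P (\<Phi> ` U) U"
    by (rule diffeoE[OF d\<Phi>])
  have PU: "P p \<in> U" "\<Phi> (P p) = p" if "p \<in> \<Phi> ` U" for p
    using that P(1) by (auto simp: homeomorphism_def)
  have P\<Phi>: "P (\<Phi> q) = q" if "q \<in> U" for q
    using that P(1) by (auto simp: homeomorphism_def)
  \<comment> \<open>The parameter \<open>u\<close> is shifted by \<open>\<i>\<close>, so that the unit disk around \<open>u = 0\<close> lies in the half-plane.\<close>
  define c where "c b = b - \<i>" for b :: complex
  define m where "m b = ((c b)\<^sup>2, c b)" for b
  have Cm: "Cinf_on m UNIV"
    unfolding m_def c_def by (intro Cinf_on_Pair Cinf_on_power Cinf_on_diff Cinf_on_id Cinf_on_const open_UNIV)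
  define V where "V = m -` (\<Phi> ` U) \<inter> ball \<i> 1"
  have oV: "open V"
    unfolding V_def using open_vimage[OF \<Phi>(1) Cinf_on_imp_continuous[OF Cm]] by blast
  have iV: "\<i> \<in> V" using \<Phi>(3) U(2) by (auto simp: V_def m_def c_def image_iff intro!: bexI[of _ x])
  have Vhp: "V \<subseteq> half_plane"
  proof
    fix b assume "b \<in> V"
    then have "cmod (\<i> - b) < 1" by (simp add: V_def dist_norm)
    then have "\<bar>Im (\<i> - b)\<bar> < 1" using abs_Im_le_cmod le_less_trans by blast
    then show "b \<in> half_plane" by (simp add: half_plane_def)
  qed
  define f where "f b = P (m b)" for b
  have fV: "f b \<in> S \<inter> U" "\<Phi> (f b) = m b" if "b \<in> V" for b
  proof -
    have mb: "m b \<in> \<Phi> ` U" using that by (simp add: V_def)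
    then show "\<Phi> (f b) = m b" using PU by (simp add: f_def)
    have "m b \<in> \<Phi> ` (S \<inter> U)" unfolding im using mb by (simp add: m_def)
    then show "f b \<in> S \<inter> U" using P\<Phi> by (auto simp: f_def)
  qed
  have smf: "smooth_on V f"
    unfolding f_def
    by (rule smooth_on_compose[OF Cinf_imp_smooth_on[OF Cm] P(2)]) (auto simp: V_def)
  have df: "diffeo f V (f ` V)"
  proof (rule diffeoI[of _ _ _ "\<lambda>q. snd (\<Phi> q) + \<i>"])
    have "smooth_on (f ` V) \<Phi>"
      using smooth_on_subset[OF diffeo_smooth[OF d\<Phi>]] fV(1) by blast
    moreover have "smooth_on UNIV (\<lambda>p :: complex \<times> complex. snd p + \<i>)"
      by (intro Cinf_imp_smooth_on[of _ UNIV] Cinf_on_add Cinf_on_snd Cinf_on_id Cinf_on_const open_UNIV) auto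
    ultimately show "smooth_on (f ` V) (\<lambda>q. snd (\<Phi> q) + \<i>)"
      by (rule smooth_on_compose) auto
  qed (use smf fV(2) in \<open>auto simp: m_def c_def\<close>)
  have fVim: "f ` V = S \<inter> (U \<inter> (\<lambda>q. snd (\<Phi> q)) -` ball 0 1)"
  proof
    show "f ` V \<subseteq> S \<inter> (U \<inter> (\<lambda>q. snd (\<Phi> q)) -` ball 0 1)"
    proof
      fix q assume "q \<in> f ` V"
      then obtain b where b: "b \<in> V" "q = f b" by blast
      then have "snd (\<Phi> q) = b - \<i>" "cmod (b - \<i>) < 1"
        using fV(2)[OF b(1)] by (simp_all add: m_def c_def V_def dist_norm norm_minus_commute)
      then show "q \<in> S \<inter> (U \<inter> (\<lambda>q. snd (\<Phi> q)) -` ball 0 1)" using fV(1)[OF b(1)] b(2) by simp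
    qed
    show "S \<inter> (U \<inter> (\<lambda>q. snd (\<Phi> q)) -` ball 0 1) \<subseteq> f ` V"
    proof
      fix q assume q: "q \<in> S \<inter> (U \<inter> (\<lambda>q. snd (\<Phi> q)) -` ball 0 1)"
      define b where "b = snd (\<Phi> q) + \<i>"
      have "\<Phi> q \<in> \<Phi> ` (S \<inter> U)" using q by simp
      then have "fst (\<Phi> q) = (snd (\<Phi> q))\<^sup>2" unfolding im by (simp add: case_prod_unfold)
      then have mb: "m b = \<Phi> q" by (simp add: m_def c_def b_def prod_eq_iff)
      have "m b \<in> \<Phi> ` U" using mb q by blast
      moreover have "b \<in> ball \<i> 1" using q by (simp add: b_def dist_norm)
      ultimately have "b \<in> V" by (simp add: V_def)
      moreover have "f b = q" using mb P\<Phi> q by (simp add: f_def)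
      ultimately show "q \<in> f ` V" by blast
    qed
  qed
  have "open (U \<inter> (\<lambda>q. snd (\<Phi> q)) -` ball 0 1)"
    using P(1) by (intro continuous_open_preimage[OF continuous_on_snd U(1)]) (auto simp: homeomorphism_def)
  then have "openin (top_of_set S) (f ` V)" unfolding fVim by (simp add: openin_open_Int)
  moreover have "openin (top_of_set half_plane) V"
    using oV Vhp by (simp add: open_subset)
  moreover have fi: "f \<i> = x" using P\<Phi>[OF U(2)] \<Phi>(3) by (simp add: f_def m_def c_def)
  ultimately have lp: "local_param half_plane S f V \<i> x"
    using df iV by (simp add: local_param_def)
  note lpT = local_param_image[OF diffeo_map_prod[OF d\<phi>] S lp]
  define F where "F = ?\<phi> \<circ> f"
  have "smooth_on V F"
    using lpT unfolding F_def local_param_def by (meson diffeo_smooth)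
  then have CF: "Cinf_on F V" using smooth_on_open_iff[OF oV] by blast
  define D where "D b = frechet_derivative F (at b)" for b
  have DF: "(F has_derivative D b) (at b)" if "b \<in> V" for b
    unfolding D_def using Cinf_on_derivative(1)[OF CF that] .
  obtain \<kappa> where \<kappa>: "homeomorphism N (\<psi> ` N) \<psi> \<kappa>" by (rule diffeoE[OF d\<psi>])
  have dc2: "((\<lambda>b. (c b)\<^sup>2) has_derivative (\<lambda>v. 2 * c b * v)) (at b)" for b
    unfolding c_def by (auto intro!: derivative_eq_intros simp: algebra_simps)
  have deriv1: "\<exists>B. linear B \<and> lin_det B > 0 \<and> (\<forall>v. fst (D b v) = B (2 * c b * v))" if b: "b \<in> V" for b
  proof -
    define z where "z = fst (f b)"
    have z: "z \<in> N" "\<psi> z = (c b)\<^sup>2"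
      using fV[OF b] N(3) \<psi>(3) by (auto simp: z_def m_def)
    obtain \<psi>' \<kappa>' where g: "(\<psi> has_derivative \<psi>') (at z)" "lin_det \<psi>' > 0"
      "(\<kappa> has_derivative \<kappa>') (at (\<psi> z))" "\<And>v. \<psi>' (\<kappa>' v) = v"
      using oriented_diffeo_inverse_derivative[OF \<psi>(2) N(1) \<psi>(1) z(1) \<kappa>] by metis
    have "lin_det (\<lambda>v. \<psi>' (\<kappa>' v)) = lin_det \<psi>' * lin_det \<kappa>'"
      by (rule lin_det_compose) (use g(1) has_derivative_linear in blast)
    then have "lin_det \<psi>' * lin_det \<kappa>' = 1" by (simp add: g(4) lin_det_complex cross_def)
    then have \<kappa>pos: "lin_det \<kappa>' > 0" using g(2) by (metis zero_less_mult_pos zero_less_one)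
    obtain \<phi>' where \<phi>': "(\<phi>1 has_derivative \<phi>') (at z within D1)" "lin_det \<phi>' > 0"
      using \<phi>(1) z(1) N(2) unfolding oriented_diffeo_def by blast
    have "(\<phi>1 has_derivative \<phi>') (at z within N)" using has_derivative_subset[OF \<phi>'(1) N(2)] .
    then have \<phi>'z: "(\<phi>1 has_derivative \<phi>') (at z)" using at_within_open[OF z(1) N(1)] by simp
    have lin: "linear \<phi>'" "linear \<kappa>'" using \<phi>'z g(3) has_derivative_linear by blast+
    have \<kappa>z: "\<kappa> (\<psi> z) = z" using \<kappa> z(1) by (simp add: homeomorphism_def)
    have "((\<lambda>b. \<kappa> ((c b)\<^sup>2)) has_derivative (\<lambda>v. \<kappa>' (2 * c b * v))) (at b)"
      by (rule has_derivative_compose[OF dc2]) (use g(3) z(2) in simp)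
    then have "((\<lambda>b. \<phi>1 (\<kappa> ((c b)\<^sup>2))) has_derivative (\<lambda>v. \<phi>' (\<kappa>' (2 * c b * v)))) (at b)"
      by (rule has_derivative_compose) (use \<phi>'z \<kappa>z z(2) in simp)
    then have "((\<lambda>b. fst (F b)) has_derivative (\<lambda>v. \<phi>' (\<kappa>' (2 * c b * v)))) (at b)"
    proof (rule has_derivative_transform_within_open[OF _ oV b])
      fix b' assume b': "b' \<in> V"
      then have "fst (f b') \<in> N" "\<psi> (fst (f b')) = (c b')\<^sup>2"
        using fV[OF b'] N(3) \<psi>(3) by (auto simp: m_def)
      then have "\<kappa> ((c b')\<^sup>2) = fst (f b')" using \<kappa> by (metis homeomorphism_apply1)
      then show "\<phi>1 (\<kappa> ((c b')\<^sup>2)) = fst (F b')" by (simp add: F_def)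
    qed
    from has_derivative_unique[OF has_derivative_fst[OF DF[OF b]] this]
    have "fst (D b v) = \<phi>' (\<kappa>' (2 * c b * v))" for v by metis
    moreover have "linear (\<lambda>v. \<phi>' (\<kappa>' v))" using linear_compose[OF lin(2,1)] by (simp add: o_def)
    moreover have "lin_det (\<lambda>v. \<phi>' (\<kappa>' v)) > 0"
      using lin_det_compose[OF lin(1), of \<kappa>'] \<phi>'(2) \<kappa>pos by simp
    ultimately show ?thesis by (intro exI[of _ "\<lambda>v. \<phi>' (\<kappa>' v)"]) auto
  qed
  have jz: "cross (fst (D b 1)) (fst (D b \<i>)) \<ge> 0" if b: "b \<in> V" for b
  proof -
    obtain B where B: "linear B" "lin_det B > 0" "\<forall>v. fst (D b v) = B (2 * c b * v)"
      using deriv1[OF b] by blast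
    have "cross (2 * c b * 1) (2 * c b * \<i>) = 4 * ((Re (c b))\<^sup>2 + (Im (c b))\<^sup>2)"
      by (simp add: cross_def power2_eq_square algebra_simps)
    then show ?thesis
      using B cross_linear_image[OF B(1), of "2 * c b * 1" "2 * c b * \<i>"] by simp
  qed
  have vert: "fst (D \<i> v) = 0" for v
  proof -
    obtain B where B: "linear B" "\<forall>v. fst (D \<i> v) = B (2 * c \<i> * v)"
      using deriv1[OF iV] by blast
    then show ?thesis using linear_0[OF B(1)] by (simp add: c_def)
  qed
  have jw: "cross (snd (D \<i> 1)) (snd (D \<i> \<i>)) > 0"
  proof -
    obtain J K where g: "(\<Phi> has_derivative J) (at x)" "lin_det J > 0"
      "(P has_derivative K) (at (\<Phi> x))" "\<And>v. J (K v) = v"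
      using oriented_diffeo_inverse_derivative[OF \<Phi>(2) U(1) \<Phi>(1) U(2) P(1)] by metis
    have linJ: "linear J" and linK: "linear K" using g has_derivative_linear by blast+
    have xN: "fst x \<in> N" using U(2) N(3) by blast
    obtain \<psi>' \<kappa>' where h: "(\<psi> has_derivative \<psi>') (at (fst x))" "lin_det \<psi>' > 0"
      "(\<kappa> has_derivative \<kappa>') (at (\<psi> (fst x)))" "\<And>v. \<psi>' (\<kappa>' v) = v"
      using oriented_diffeo_inverse_derivative[OF \<psi>(2) N(1) \<psi>(1) xN \<kappa>] by metis
    have lin\<psi>: "linear \<psi>'" using h(1) has_derivative_linear by blast
    have "((\<lambda>q. \<psi> (fst q)) has_derivative (\<lambda>v. \<psi>' (fst v))) (at x)"
      using has_derivative_compose[OF has_derivative_fst[OF has_derivative_ident] h(1)] .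
    then have "((\<lambda>q. fst (\<Phi> q)) has_derivative (\<lambda>v. \<psi>' (fst v))) (at x)"
      by (rule has_derivative_transform_within_open[OF _ U(1,2)]) (use \<psi>(3) in simp)
    from has_derivative_unique[OF has_derivative_fst[OF g(1)] this]
    have fstJ: "fst (J v) = \<psi>' (fst v)" for v by metis
    have J0: "fst (J (0, v)) = 0" for v by (simp add: fstJ linear_0[OF lin\<psi>])
    have "lin_det J = lin_det (\<lambda>u. fst (J (u, 0))) * lin_det (\<lambda>v. snd (J (0, v)))"
      by (rule lin_det_block_triangular[where A = J, OF J0])
    then have "lin_det J = lin_det \<psi>' * lin_det (\<lambda>v. snd (J (0, v)))" by (simp add: fstJ)
    then have Qpos: "lin_det (\<lambda>v. snd (J (0, v))) > 0"
      using g(2) h(2) by (metis zero_less_mult_pos)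
    have inj\<psi>: "inj \<psi>'" using linear_surjective_imp_injective[OF lin\<psi>] h(4) by (metis surjI)
    have K0: "fst (K (0, v)) = 0" for v
    proof -
      have "\<psi>' (fst (K (0, v))) = fst (J (K (0, v)))" by (simp only: fstJ)
      also have "\<dots> = \<psi>' 0" using linear_0[OF lin\<psi>] by (simp add: g(4))
      finally show ?thesis using inj\<psi> by (simp add: inj_eq)
    qed
    have JK: "snd (J (0, snd (K (0, v)))) = v" for v
      using g(4)[of "(0, v)"] K0[of v] by (metis prod.collapse snd_conv)
    have linQ: "linear (\<lambda>v. snd (J (0, v)))"
      using linear_compose[OF linear_compose[OF _ linJ] linear_snd, of "\<lambda>v. (0, v)"]
      by (simp add: o_def linear_iff)
    have "lin_det (\<lambda>v. snd (J (0, snd (K (0, v)))))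
        = lin_det (\<lambda>v. snd (J (0, v))) * lin_det (\<lambda>v. snd (K (0, v)))"
      by (rule lin_det_compose[OF linQ])
    then have "lin_det (\<lambda>v. snd (J (0, v))) * lin_det (\<lambda>v. snd (K (0, v))) = 1"
      by (simp add: JK lin_det_complex cross_def)
    then have Kpos: "lin_det (\<lambda>v. snd (K (0, v))) > 0"
      using Qpos by (metis zero_less_mult_pos zero_less_one)
    have xD: "snd x \<in> D2" using U(2,3) by (cases x) auto
    obtain \<phi>' where \<phi>': "(\<phi>2 has_derivative \<phi>') (at (snd x) within D2)" "lin_det \<phi>' > 0"
      using \<phi>(2) xD unfolding oriented_diffeo_def by blast
    have "open (snd ` U)" by (rule open_image_snd[OF U(1)])
    moreover have "snd ` U \<subseteq> D2" using U(3) by auto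
    ultimately have \<phi>'x: "(\<phi>2 has_derivative \<phi>') (at (snd x))"
      using has_derivative_subset[OF \<phi>'(1)] at_within_open[of "snd x" "snd ` U"] U(2) by (metis imageI)
    have lin\<phi>: "linear \<phi>'" using \<phi>'x has_derivative_linear by blast
    have m': "(m has_derivative (\<lambda>v. (0, v))) (at \<i>)"
    proof -
      have "((\<lambda>b. (c b)\<^sup>2) has_derivative (\<lambda>v. 0)) (at \<i>)" using dc2[of \<i>] by (simp add: c_def)
      moreover have "(c has_derivative (\<lambda>v. v)) (at \<i>)"
        unfolding c_def by (auto intro!: derivative_eq_intros)
      ultimately show ?thesis unfolding m_def by (rule has_derivative_Pair)
    qed
    have mi: "m \<i> = \<Phi> x" using \<Phi>(3) by (simp add: m_def c_def)
    have "(f has_derivative (\<lambda>v. K (0, v))) (at \<i>)"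
      unfolding f_def by (rule has_derivative_compose[OF m']) (use g(3) mi in simp)
    then have "((\<lambda>b. snd (f b)) has_derivative (\<lambda>v. snd (K (0, v)))) (at \<i>)"
      by (rule has_derivative_snd)
    then have "((\<lambda>b. \<phi>2 (snd (f b))) has_derivative (\<lambda>v. \<phi>' (snd (K (0, v))))) (at \<i>)"
      by (rule has_derivative_compose) (use \<phi>'x fi in simp)
    then have "((\<lambda>b. snd (F b)) has_derivative (\<lambda>v. \<phi>' (snd (K (0, v))))) (at \<i>)"
      by (simp add: F_def)
    from has_derivative_unique[OF has_derivative_snd[OF DF[OF iV]] this]
    have "snd (D \<i> v) = \<phi>' (snd (K (0, v)))" for v by metis
    then have "cross (snd (D \<i> 1)) (snd (D \<i> \<i>)) = lin_det (\<lambda>v. \<phi>' (snd (K (0, v))))"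
      by (simp add: lin_det_complex)
    also have "\<dots> = lin_det \<phi>' * lin_det (\<lambda>v. snd (K (0, v)))" by (rule lin_det_compose[OF lin\<phi>])
    finally show ?thesis using \<phi>'(2) Kpos by simp
  qed
  have "adapted_chart (?\<phi> ` S) F V V \<i> (?\<phi> x)"
    unfolding adapted_chart_def Let_def using lpT CF jz vert jw by (simp add: F_def D_def)
  then show ?thesis by blast
qed


section \<open>Local estimates and compactness\<close>

lemma compact_uniform_parameter:
  fixes K :: "'a::t2_space set" and P :: "real \<Rightarrow> 'a \<Rightarrow> bool"
  assumes "compact K"
    and loc: "\<And>x. x \<in> K \<Longrightarrow> \<exists>O' e0. open O' \<and> x \<in> O' \<and> e0 > 0 \<and> (\<forall>e\<in>{0<..<e0}. \<forall>y\<in>K \<inter> O'. P e y)"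
  shows "\<exists>e0>0. \<forall>e\<in>{0<..<e0}. \<forall>y\<in>K. P e y"
proof -
  obtain U d where U: "\<And>x. x \<in> K \<Longrightarrow> open (U x) \<and> x \<in> U x \<and> d x > (0::real) \<and>
      (\<forall>e\<in>{0<..<d x}. \<forall>y\<in>K \<inter> U x. P e y)"
    using loc by metis
  obtain C where C: "C \<subseteq> K" "finite C" "K \<subseteq> (\<Union>x\<in>C. U x)"
    using compactE_image[OF assms(1), of K U] U by blast
  define e0 where "e0 = Min (insert 1 (d ` C))"
  have "e0 > 0" unfolding e0_def using C U by (subst Min_gr_iff) auto
  moreover have "P e y" if "e \<in> {0<..<e0}" "y \<in> K" for e y
  proof -
    obtain x where x: "x \<in> C" "y \<in> U x" using C(3) \<open>y \<in> K\<close> by blast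
    have "e0 \<le> d x" unfolding e0_def using C(2) x(1) by (intro Min_le) auto
    then have "e \<in> {0<..<d x}" using that(1) by auto
    then show ?thesis using U[of x] C(1) x that(2) by blast
  qed
  ultimately show ?thesis by blast
qed

lemma chart_neighbourhood:
  assumes "local_param H M f V a x" "open U" "a \<in> U"
  obtains O' where "open O'" "x \<in> O'" "\<And>y. y \<in> M \<inter> O' \<Longrightarrow> \<exists>b\<in>V \<inter> U. y = f b"
proof -
  have c: "a \<in> V" "f a = x" "openin (top_of_set M) (f ` V)" "diffeo f V (f ` V)"
    using assms(1) by (auto simp: local_param_def)
  obtain k where k: "homeomorphism V (f ` V) f k" by (rule diffeoE[OF c(4)])
  have "openin (top_of_set V) (V \<inter> U)" using assms(2) by (simp add: openin_open_Int)
  then have "openin (top_of_set (f ` V)) (f ` (V \<inter> U))" by (rule homeomorphism_imp_open_map[OF k])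
  then have "openin (top_of_set M) (f ` (V \<inter> U))" using c(3) openin_trans by blast
  then obtain O' where O': "open O'" "f ` (V \<inter> U) = M \<inter> O'" by (auto simp: openin_open)
  have "x \<in> f ` (V \<inter> U)" using c(1,2) assms(3) by blast
  then have "x \<in> O'" using O'(2) by blast
  moreover have "\<exists>b\<in>V \<inter> U. y = f b" if "y \<in> M \<inter> O'" for y using that O'(2) by blast
  ultimately show ?thesis using that O'(1) by blast
qed

lemma tangent_space_extended_chart:
  assumes lp: "local_param half_plane T F V a x" and F: "Cinf_on F W" "V \<subseteq> W" and b: "b \<in> V"
  shows "tangent_space half_plane T (F b) = range (frechet_derivative F (at b))"
  by (rule tangent_space_eq_range[OF directionally_full_half_plane local_param_move[OF lp b]])
    (rule extension_derivative_within[OF F _ b], simp)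

lemma subspace_tangent_space:
  assumes "submanifold half_plane T" "x \<in> T"
  shows "subspace (tangent_space half_plane T x)"
proof -
  obtain f V a where f: "local_param half_plane T f V a x" using assms unfolding submanifold_def by blast
  obtain A where A: "(f has_derivative A) (at a within V)" "linear A" by (rule chart_derivative[OF f])
  show ?thesis
    unfolding tangent_space_eq_range[OF directionally_full_half_plane f A(1)]
    by (rule linear_subspace_image[OF A(2) subspace_UNIV])
qed

text \<open>At a regular point \<open>r\<^sup>2 A\<^sub>z\<close> is bounded away from \<open>0\<close> nearby, and dominates for small \<open>e\<close>.  At a
  vertical tangent plane \<open>\<beta>\<close> reduces to \<open>r\<^sup>2 A\<^sub>w > 0\<close>, hence stays positive nearby, where
  \<open>A\<^sub>z \<ge> 0\<close>; there every \<open>e\<close> will do.\<close>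

lemma symplectic_near:
  assumes ch: "adapted_chart T F V W a x" and r: "r > 0"
  shows "\<exists>O' e0. open O' \<and> x \<in> O' \<and> e0 > 0 \<and> (\<forall>e\<in>{0<..<e0}. \<forall>q\<in>T \<inter> O'.
    \<exists>u\<in>tangent_space half_plane T q. \<exists>v\<in>tangent_space half_plane T q.
      r\<^sup>2 * cross (fst u) (fst v) + e\<^sup>2 * beta r q u v \<noteq> 0)"
proof -
  have lp: "local_param half_plane T F V a x" and F: "Cinf_on F W" "V \<subseteq> W"
    using ch by (auto simp: adapted_chart_def)
  have aV: "a \<in> V" using lp by (simp add: local_param_def)
  then have aW: "a \<in> W" using F(2) by blast
  define D where "D b = frechet_derivative F (at b)" for b
  define jz where "jz b = cross (fst (D b 1)) (fst (D b \<i>))" for b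
  define B where "B b = beta r (F b) (D b 1) (D b \<i>)" for b
  have cD: "continuous_on W (\<lambda>b. D b v)" for v
    unfolding D_def by (rule Cinf_on_imp_continuous[OF Cinf_on_derivative(2)[OF F(1)]])
  note cF = Cinf_on_imp_continuous[OF F(1)]
  have cjz: "continuous_on W jz" unfolding jz_def cross_def by (intro continuous_intros cD)
  have cB: "continuous_on W B" unfolding B_def beta_def cross_def by (intro continuous_intros cD cF)
  have oW: "open W" using Cinf_on_open[OF F(1)] .
  have "\<exists>U e0. open U \<and> a \<in> U \<and> e0 > 0 \<and>
      (\<forall>e\<in>{0<..<e0}. \<forall>b\<in>V \<inter> U. r\<^sup>2 * jz b + e\<^sup>2 * B b \<noteq> 0)"
  proof (cases "jz a = 0")
    case False
    define c where "c = r\<^sup>2 * \<bar>jz a\<bar> / 2"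
    define M where "M = \<bar>B a\<bar> + 1"
    have c: "c > 0" "c < r\<^sup>2 * \<bar>jz a\<bar>" using False r by (auto simp: c_def)
    have M: "M > 0" by (simp add: M_def)
    define U where "U = (W \<inter> (\<lambda>b. r\<^sup>2 * \<bar>jz b\<bar>) -` {c<..}) \<inter> (W \<inter> (\<lambda>b. \<bar>B b\<bar>) -` {..<M})"
    have "open U"
      unfolding U_def
      by (rule open_Int[OF continuous_open_preimage[OF _ oW] continuous_open_preimage[OF _ oW]])
        (auto intro!: continuous_intros cjz cB)
    moreover have "a \<in> U" using aW c by (simp add: U_def M_def)
    moreover have "min 1 (c / M) > 0" using c M by simp
    moreover have "r\<^sup>2 * jz b + e\<^sup>2 * B b \<noteq> 0" if "e \<in> {0<..<min 1 (c / M)}" "b \<in> V \<inter> U" for e b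
    proof
      assume 0: "r\<^sup>2 * jz b + e\<^sup>2 * B b = 0"
      have e: "0 < e" "e < 1" "e * M < c" using that(1) M by (auto simp: field_simps)
      have "e\<^sup>2 \<le> e" using e by (simp add: power2_eq_square mult_left_le)
      then have "e\<^sup>2 * \<bar>B b\<bar> \<le> e * M"
        using that(2) e by (intro mult_mono) (auto simp: U_def)
      moreover have "r\<^sup>2 * \<bar>jz b\<bar> = e\<^sup>2 * \<bar>B b\<bar>"
        using 0 by (metis abs_minus_cancel abs_mult abs_power2 eq_neg_iff_add_eq_0)
      moreover have "r\<^sup>2 * \<bar>jz b\<bar> > c" using that(2) by (simp add: U_def)
      ultimately show False using e by linarith
    qed
    ultimately show ?thesis by (intro exI[of _ U] exI[of _ "min 1 (c / M)"]) blast
  next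
    case True
    then have vert: "\<forall>v. fst (D a v) = 0" and jw: "cross (snd (D a 1)) (snd (D a \<i>)) > 0"
      and nn: "\<forall>b\<in>V. jz b \<ge> 0"
      using ch unfolding adapted_chart_def Let_def D_def jz_def by blast+
    define U where "U = W \<inter> B -` {0<..}"
    have "open U" unfolding U_def by (rule continuous_open_preimage[OF cB oW]) simp
    moreover have "B a > 0" using vert jw r by (simp add: B_def beta_def cross_simps)
    then have "a \<in> U" using aW by (simp add: U_def)
    moreover have "r\<^sup>2 * jz b + e\<^sup>2 * B b \<noteq> 0" if "e \<in> {0<..<1}" "b \<in> V \<inter> U" for e b
    proof -
      have "r\<^sup>2 * jz b \<ge> 0" using nn that(2) by simp
      moreover have "e\<^sup>2 * B b > 0" using that by (simp add: U_def)
      ultimately show ?thesis by linarith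
    qed
    ultimately show ?thesis by (intro exI[of _ U] exI[of _ 1]) auto
  qed
  then obtain U e0 where U: "open U" "a \<in> U" "e0 > 0"
    "\<forall>e\<in>{0<..<e0}. \<forall>b\<in>V \<inter> U. r\<^sup>2 * jz b + e\<^sup>2 * B b \<noteq> 0" by blast
  obtain O' where O': "open O'" "x \<in> O'" "\<And>y. y \<in> T \<inter> O' \<Longrightarrow> \<exists>b\<in>V \<inter> U. y = F b"
    using chart_neighbourhood[OF lp U(1,2)] by metis
  have "\<exists>u\<in>tangent_space half_plane T q. \<exists>v\<in>tangent_space half_plane T q.
      r\<^sup>2 * cross (fst u) (fst v) + e\<^sup>2 * beta r q u v \<noteq> 0" if e: "e \<in> {0<..<e0}" and q: "q \<in> T \<inter> O'" for e q
  proof -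
    obtain b where b: "b \<in> V \<inter> U" "q = F b" using O'(3)[OF q] by blast
    have "D b 1 \<in> tangent_space half_plane T q" "D b \<i> \<in> tangent_space half_plane T q"
      using tangent_space_extended_chart[OF lp F, of b] b by (auto simp: D_def)
    moreover have "r\<^sup>2 * cross (fst (D b 1)) (fst (D b \<i>)) + e\<^sup>2 * beta r q (D b 1) (D b \<i>) \<noteq> 0"
      using U(4) e b by (simp add: jz_def B_def)
    ultimately show ?thesis by blast
  qed
  then show ?thesis using O'(1,2) U(3) by blast
qed

lemma cross_cramer: "cross u v *\<^sub>R y = cross y v *\<^sub>R u + cross u y *\<^sub>R v"
  by (simp add: cross_def complex_eq_iff algebra_simps)

text \<open>Cramer's rule recovers the coordinates of a tangent vector from its first component, with a
  denominator bounded away from \<open>0\<close>.  The slope bound has \<open>1 / e\<close> as its constant so that it holds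
  for all small \<open>e\<close>, as the compactness argument requires.\<close>

lemma slope_near:
  assumes lp: "local_param half_plane T F V a x" and F: "Cinf_on F W" "V \<subseteq> W"
    and reg: "cross (fst (frechet_derivative F (at a) 1)) (fst (frechet_derivative F (at a) \<i>)) \<noteq> 0"
  shows "\<exists>O' e0. open O' \<and> x \<in> O' \<and> e0 > 0 \<and> (\<forall>e\<in>{0<..<e0}. \<forall>q\<in>T \<inter> O'.
    \<forall>\<tau>\<in>tangent_space half_plane T q. e * cmod (snd \<tau>) \<le> cmod (fst \<tau>))"
proof -
  have aW: "a \<in> W" using lp F(2) unfolding local_param_def by blast
  define D where "D b = frechet_derivative F (at b)" for b
  define jz where "jz b = cross (fst (D b 1)) (fst (D b \<i>))" for b
  define G where "G b = cmod (fst (D b \<i>)) * cmod (snd (D b 1)) + cmod (fst (D b 1)) * cmod (snd (D b \<i>))" for b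
  have cD: "continuous_on W (\<lambda>b. D b v)" for v
    unfolding D_def by (rule Cinf_on_imp_continuous[OF Cinf_on_derivative(2)[OF F(1)]])
  have cjz: "continuous_on W jz" unfolding jz_def cross_def by (intro continuous_intros cD)
  have cG: "continuous_on W G" unfolding G_def by (intro continuous_intros cD)
  have oW: "open W" using Cinf_on_open[OF F(1)] .
  define c where "c = \<bar>jz a\<bar> / 2"
  define M where "M = G a + 1"
  have c: "c > 0" "c < \<bar>jz a\<bar>" using reg by (auto simp: c_def jz_def D_def)
  have G0: "G b \<ge> 0" for b by (simp add: G_def)
  have M: "M > 0" using G0[of a] by (simp add: M_def)
  define U where "U = (W \<inter> (\<lambda>b. \<bar>jz b\<bar>) -` {c<..}) \<inter> (W \<inter> G -` {..<M})"
  have oU: "open U"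
    unfolding U_def
    by (rule open_Int[OF continuous_open_preimage[OF _ oW] continuous_open_preimage[OF cG oW]])
      (auto intro!: continuous_intros cjz)
  have aU: "a \<in> U" using aW c by (simp add: U_def M_def)
  obtain O' where O': "open O'" "x \<in> O'" "\<And>y. y \<in> T \<inter> O' \<Longrightarrow> \<exists>b\<in>V \<inter> U. y = F b"
    using chart_neighbourhood[OF lp oU aU] by metis
  have "e * cmod (snd \<tau>) \<le> cmod (fst \<tau>)"
    if e: "e \<in> {0<..<c / M}" and q: "q \<in> T \<inter> O'" and \<tau>: "\<tau> \<in> tangent_space half_plane T q" for e q \<tau>
  proof -
    obtain b where b: "b \<in> V" "b \<in> U" "q = F b" using O'(3)[OF q] by blast
    have bW: "b \<in> W" using b F(2) by blast
    obtain \<xi> where \<xi>: "\<tau> = D b \<xi>"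
      using \<tau> tangent_space_extended_chart[OF lp F b(1)] b(3) by (auto simp: D_def)
    have lin: "linear (D b)"
      unfolding D_def using Cinf_on_derivative(1)[OF F(1) bW] has_derivative_linear by blast
    have "\<xi> = Re \<xi> *\<^sub>R 1 + Im \<xi> *\<^sub>R \<i>" by (simp add: complex_eq_iff)
    then have \<tau>eq: "\<tau> = Re \<xi> *\<^sub>R D b 1 + Im \<xi> *\<^sub>R D b \<i>"
      unfolding \<xi> using linear_add[OF lin] linear_scale[OF lin] by metis
    define s t where "s = Re \<xi>" and "t = Im \<xi>"
    have f: "fst \<tau> = s *\<^sub>R fst (D b 1) + t *\<^sub>R fst (D b \<i>)"
      and sn: "snd \<tau> = s *\<^sub>R snd (D b 1) + t *\<^sub>R snd (D b \<i>)" by (simp_all add: \<tau>eq s_def t_def)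
    have s: "s * jz b = cross (fst \<tau>) (fst (D b \<i>))" and t: "t * jz b = cross (fst (D b 1)) (fst \<tau>)"
      by (simp_all add: f jz_def cross_simps)
    have "\<bar>s\<bar> * \<bar>jz b\<bar> \<le> cmod (fst \<tau>) * cmod (fst (D b \<i>))"
      using abs_cross_le[of "fst \<tau>" "fst (D b \<i>)"] by (simp add: s[symmetric] abs_mult)
    moreover have "\<bar>t\<bar> * \<bar>jz b\<bar> \<le> cmod (fst (D b 1)) * cmod (fst \<tau>)"
      using abs_cross_le[of "fst (D b 1)" "fst \<tau>"] by (simp add: t[symmetric] abs_mult)
    ultimately have "\<bar>s\<bar> * \<bar>jz b\<bar> * cmod (snd (D b 1)) + \<bar>t\<bar> * \<bar>jz b\<bar> * cmod (snd (D b \<i>))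
        \<le> cmod (fst \<tau>) * cmod (fst (D b \<i>)) * cmod (snd (D b 1)) + cmod (fst (D b 1)) * cmod (fst \<tau>) * cmod (snd (D b \<i>))"
      by (intro add_mono mult_right_mono) auto
    also have "\<dots> = cmod (fst \<tau>) * G b" by (simp add: G_def algebra_simps)
    also have "\<dots> \<le> cmod (fst \<tau>) * M" using b(2) by (intro mult_left_mono) (auto simp: U_def)
    finally have 1: "\<bar>jz b\<bar> * (\<bar>s\<bar> * cmod (snd (D b 1)) + \<bar>t\<bar> * cmod (snd (D b \<i>))) \<le> cmod (fst \<tau>) * M"
      by (simp add: algebra_simps)
    have "cmod (snd \<tau>) \<le> \<bar>s\<bar> * cmod (snd (D b 1)) + \<bar>t\<bar> * cmod (snd (D b \<i>))"
      unfolding sn by (rule order_trans[OF norm_triangle_ineq]) simp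
    then have "c * cmod (snd \<tau>) \<le> \<bar>jz b\<bar> * (\<bar>s\<bar> * cmod (snd (D b 1)) + \<bar>t\<bar> * cmod (snd (D b \<i>)))"
      using b(2) c by (intro mult_mono) (auto simp: U_def)
    with 1 have 2: "c * cmod (snd \<tau>) \<le> cmod (fst \<tau>) * M" by linarith
    have "e * M \<le> c" using e M by (simp add: field_simps)
    then have "(e * M) * cmod (snd \<tau>) \<le> c * cmod (snd \<tau>)" by (rule mult_right_mono) simp
    then have "(e * cmod (snd \<tau>)) * M \<le> cmod (fst \<tau>) * M" using 2 by (simp add: algebra_simps)
    then show ?thesis using M by simp
  qed
  moreover have "c / M > 0" using c M by simp
  ultimately show ?thesis using O'(1,2) by blast
qed

lemma tangent_to_sphere:
  assumes "L \<subseteq> sphere 0 1" "\<tau> \<in> tangent_space (UNIV :: real set) L x"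
  shows "x \<bullet> \<tau> = 0"
proof -
  obtain g V a B where g: "local_param (UNIV::real set) L g V a x" "(g has_derivative B) (at a within V)"
    "\<tau> \<in> range B" using assms(2) unfolding tangent_space_def by blast
  have V: "openin (top_of_set (UNIV::real set)) V" "a \<in> V" "g a = x" "g ` V \<subseteq> L"
    using g(1) openin_imp_subset unfolding local_param_def by blast+
  have "((\<lambda>b. g b \<bullet> g b) has_derivative (\<lambda>v. g a \<bullet> B v + B v \<bullet> g a)) (at a within V)"
    by (rule has_derivative_inner[OF g(2) g(2)])
  moreover have "((\<lambda>b. g b \<bullet> g b) has_derivative (\<lambda>v. 0)) (at a within V)"
  proof (rule has_derivative_transform[OF V(2) _ has_derivative_const[of 1]])
    fix b assume "b \<in> V"
    then have "g b \<in> sphere 0 1" using V(4) assms(1) by blast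
    then have "norm (g b) = 1" by simp
    then show "g b \<bullet> g b = 1" by (simp add: norm_eq_1)
  qed
  ultimately have "(\<lambda>v. g a \<bullet> B v + B v \<bullet> g a) = (\<lambda>v. 0)"
    by (rule derivative_within_unique[OF directionally_full_UNIV V(1,2)])
  then have "2 * (x \<bullet> B v) = 0" for v using V(3) by (metis inner_commute mult_2)
  then show ?thesis using g(3) by auto
qed

lemma inward_ball_subset:
  fixes x v :: "'a::euclidean_space"
  assumes "norm x = 1" "x \<bullet> v < 0"
  shows "\<exists>e>0. \<forall>t\<in>{0<..<e}. ball (x + t *\<^sub>R v) (e * t) \<subseteq> cball 0 1"
proof -
  define k where "k = - (x \<bullet> v)"
  have k: "k > 0" using assms(2) by (simp add: k_def)
  \<comment> \<open>Squaring \<open>norm (x + t v) \<le> 1 - k t / 2\<close> shows which \<open>t\<close> are admissible; the other half of the speed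
    \<open>k\<close> towards the interior pays for the radius \<open>e t\<close>.\<close>
  define e where "e = min (k / 2) (min (k / ((norm v)\<^sup>2 + 1)) (1 / (k + 1)))"
  have e: "e > 0" using k by (simp add: e_def add_nonneg_pos)
  have "ball (x + t *\<^sub>R v) (e * t) \<subseteq> cball 0 1" if t: "t \<in> {0<..<e}" for t
  proof
    fix y assume y: "y \<in> ball (x + t *\<^sub>R v) (e * t)"
    have t0: "0 < t" "t < e" using t by auto
    have e2: "e \<le> k / 2" and e3: "e \<le> k / ((norm v)\<^sup>2 + 1)" and e4: "e \<le> 1 / (k + 1)"
      unfolding e_def by (auto simp only: min.cobounded1 min.cobounded2 intro: min.coboundedI2)
    have "t \<le> k / ((norm v)\<^sup>2 + 1)" using t0 e3 by linarith
    then have "t * ((norm v)\<^sup>2 + 1) \<le> k" by (simp add: pos_le_divide_eq add_nonneg_pos)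
    moreover have "t * (norm v)\<^sup>2 \<le> t * ((norm v)\<^sup>2 + 1)" using t0 by simp
    ultimately have tv: "t * (norm v)\<^sup>2 \<le> k" by linarith
    have "t \<le> 1 / (k + 1)" using t0 e4 by linarith
    then have "t * (k + 1) \<le> 1" using k by (simp add: pos_le_divide_eq)
    then have tk: "t * k \<le> 1" using t0 by (simp add: algebra_simps)
    have "(norm (x + t *\<^sub>R v))\<^sup>2 = 1 - 2 * t * k + t * (t * (norm v)\<^sup>2)"
      using assms(1) by (simp add: power2_norm_eq_inner inner_add_left inner_add_right k_def
          norm_eq_1 inner_commute[of v x] algebra_simps)
    also have "\<dots> \<le> 1 - 2 * t * k + t * k" using tv t0 by simp
    also have "\<dots> \<le> (1 - t * k / 2)\<^sup>2" by (simp add: power2_diff algebra_simps)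
    finally have "norm (x + t *\<^sub>R v) \<le> 1 - t * k / 2"
      by (rule power2_le_imp_le) (use tk in simp)
    moreover have "dist (x + t *\<^sub>R v) y < e * t" using y by simp
    then have "norm y \<le> norm (x + t *\<^sub>R v) + e * t"
      using norm_triangle_ineq2[of y "x + t *\<^sub>R v"] by (simp add: dist_norm norm_minus_commute)
    moreover have "e * t \<le> k / 2 * t" using e2 t0 by (intro mult_right_mono) auto
    ultimately show "y \<in> cball 0 1" by (simp add: algebra_simps)
  qed
  then show ?thesis using e by blast
qed

section \<open>The round braided surface\<close>

lemma disk_identification_interior:
  assumes "disk_identification D r \<phi>" "x \<in> D"
  shows "cmod (\<phi> x) \<le> r" "x \<in> interior D \<longleftrightarrow> cmod (\<phi> x) < r"
proof -
  have d: "diffeo \<phi> D (cball 0 r)"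
    using assms(1) by (simp add: disk_identification_def oriented_diffeo_def)
  obtain g where g: "homeomorphism D (cball 0 r) \<phi> g" "diffeo g (cball 0 r) D" by (rule diffeoE[OF d])
  show "cmod (\<phi> x) \<le> r" using diffeo_image[OF d] assms(2) by auto
  have h: "f \<in> interior A \<rightarrow> interior B" if "diffeo f A B" for f :: "complex \<Rightarrow> complex" and A B
    using continuous_image_subset_interior[of A f] that diffeo_image[OF that]
    by (simp add: smooth_on_continuous diffeo_smooth diffeo_inj)
  have "\<phi> x \<in> ball 0 r" if "x \<in> interior D" using h[OF d] that by (auto simp: interior_cball)
  moreover have "x \<in> interior D" if "\<phi> x \<in> ball 0 r"
  proof -
    have "g (\<phi> x) \<in> interior D" using h[OF g(2)] that by (auto simp: interior_cball)
    then show ?thesis using homeomorphism_apply1[OF g(1) assms(2)] by simp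
  qed
  ultimately show "x \<in> interior D \<longleftrightarrow> cmod (\<phi> x) < r" by auto
qed

text \<open>The surface stays away from \<open>|w| = r2\<close>: a point there would lie on the frontier of the bidisk,
  hence on the boundary of the surface, which is assumed to project into the interior of \<open>D2\<close>.
  Boundary points are regular because branch points lie over interior points.\<close>

lemma round_braided_surface:
  assumes \<phi>: "disk_identification D1 r1 \<phi>1" "disk_identification D2 r2 \<phi>2"
    and S: "braided_surface D1 D2 S"
  defines "T \<equiv> map_prod \<phi>1 \<phi>2 ` S"
  shows "compact T" "submanifold half_plane T" "T \<subseteq> cball 0 r1 \<times> ball 0 r2"
    and "surface_boundary T = {q \<in> T. cmod (fst q) = r1}"
    and "\<And>q. q \<in> T \<Longrightarrow> \<exists>F V W a. adapted_chart T F V W a q"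
    and "\<And>q. q \<in> T \<Longrightarrow> cmod (fst q) = r1 \<Longrightarrow> \<exists>F V W a. adapted_chart T F V W a q \<and>
      cross (fst (frechet_derivative F (at a) 1)) (fst (frechet_derivative F (at a) \<i>)) \<noteq> 0"
proof -
  let ?\<phi> = "map_prod \<phi>1 \<phi>2"
  have od: "oriented_diffeo \<phi>1 D1 (cball 0 r1)" "oriented_diffeo \<phi>2 D2 (cball 0 r2)"
    using \<phi> by (simp_all add: disk_identification_def)
  then have d: "diffeo \<phi>1 D1 (cball 0 r1)" "diffeo \<phi>2 D2 (cball 0 r2)"
    by (simp_all add: oriented_diffeo_def)
  note dp = diffeo_map_prod[OF d]
  have pS: "properly_embedded_surface S (D1 \<times> D2)" and cS: "branched_covering fst S D1"
    and sb: "surface_boundary S \<subseteq> frontier D1 \<times> interior D2"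
    and br: "\<forall>x\<in>branch_points fst S D1. positive_branch_coordinates D1 D2 S x"
    using S unfolding braided_surface_def simple_branched_covering_def by simp_all
  have pe: "compact S" "submanifold half_plane S" "S \<subseteq> D1 \<times> D2"
    "surface_boundary S = S \<inter> frontier (D1 \<times> D2)"
    using pS unfolding properly_embedded_surface_def by simp_all
  have bc: "fst ` branch_points fst S D1 \<subseteq> interior D1"
    using cS unfolding branched_covering_def Let_def by blast
  have TE: "\<exists>x\<in>S. q = ?\<phi> x" if "q \<in> T" for q
    using that unfolding T_def image_iff .
  have fr: "x \<in> surface_boundary S \<longleftrightarrow> fst x \<notin> interior D1 \<or> snd x \<notin> interior D2" if "x \<in> S" for x
  proof -
    have "x \<in> closure (D1 \<times> D2)" using that pe(3) closure_subset by blast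
    then show ?thesis using that unfolding pe(4) frontier_def interior_Times by (cases x) auto
  qed
  have int2: "snd x \<in> interior D2" if "x \<in> S" for x using fr[OF that] sb by (cases x) auto
  have bd: "x \<in> surface_boundary S \<longleftrightarrow> cmod (\<phi>1 (fst x)) = r1" if "x \<in> S" for x
  proof -
    have "fst x \<in> D1" using that pe(3) by auto
    from disk_identification_interior[OF \<phi>(1) this] show ?thesis
      using fr[OF that] int2[OF that] by auto
  qed
  show "compact T"
    unfolding T_def using pe(1,3) smooth_on_continuous[OF diffeo_smooth[OF dp]]
    by (intro compact_continuous_image) (auto intro: continuous_on_subset)
  show "submanifold half_plane T" unfolding T_def by (rule submanifold_image[OF dp pe(3,2)])
  show "T \<subseteq> cball 0 r1 \<times> ball 0 r2"
  proof
    fix q assume "q \<in> T"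
    from TE[OF this] obtain x where x: "x \<in> S" "q = ?\<phi> x" by (rule bexE)
    then have D: "fst x \<in> D1" "snd x \<in> D2" using pe(3) by auto
    show "q \<in> cball 0 r1 \<times> ball 0 r2"
      using disk_identification_interior[OF \<phi>(1) D(1)] disk_identification_interior[OF \<phi>(2) D(2)] int2[OF x(1)] x(2)
      by (cases x) auto
  qed
  have "surface_boundary T = ?\<phi> ` surface_boundary S" unfolding T_def by (rule surface_boundary_image[OF dp pe(3)])
  also have "\<dots> = {q \<in> T. cmod (fst q) = r1}"
  proof
    show "?\<phi> ` surface_boundary S \<subseteq> {q \<in> T. cmod (fst q) = r1}"
    proof
      fix q assume "q \<in> ?\<phi> ` surface_boundary S"
      then obtain x where x: "x \<in> surface_boundary S" "q = ?\<phi> x" by (rule imageE)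
      have xS: "x \<in> S" by (rule subsetD[OF surface_boundary_subset x(1)])
      have "?\<phi> x \<in> T" unfolding T_def by (rule imageI[OF xS])
      then show "q \<in> {q \<in> T. cmod (fst q) = r1}" using bd[OF xS] x by simp
    qed
    show "{q \<in> T. cmod (fst q) = r1} \<subseteq> ?\<phi> ` surface_boundary S"
    proof
      fix q assume q: "q \<in> {q \<in> T. cmod (fst q) = r1}"
      then have "q \<in> T" by simp
      from TE[OF this] obtain x where x: "x \<in> S" "q = ?\<phi> x" by (rule bexE)
      then have "x \<in> surface_boundary S" using bd[OF x(1)] q by simp
      then show "q \<in> ?\<phi> ` surface_boundary S" using x(2) by blast
    qed
  qed
  finally show "surface_boundary T = {q \<in> T. cmod (fst q) = r1}" .
  show reg: "\<exists>F V W a. adapted_chart T F V W a q \<and>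
      cross (fst (frechet_derivative F (at a) 1)) (fst (frechet_derivative F (at a) \<i>)) \<noteq> 0"
    if q: "q \<in> T" "cmod (fst q) = r1" for q
  proof -
    obtain x where x: "x \<in> S" "q = ?\<phi> x" using TE[OF q(1)] by (rule bexE)
    then have "fst x \<notin> interior D1"
      using bd[OF x(1)] fr[OF x(1)] int2[OF x(1)] q(2) by simp
    then have "local_diffeo_at fst S D1 x" using bc x(1) unfolding branch_points_def by blast
    from adapted_chart_regular[OF pe(2) x(1) pe(3) this d] show ?thesis unfolding x(2) T_def .
  qed
  show "\<exists>F V W a. adapted_chart T F V W a q" if q: "q \<in> T" for q
  proof -
    obtain x where x: "x \<in> S" "q = ?\<phi> x" using TE[OF q] by (rule bexE)
    show ?thesis
    proof (cases "x \<in> branch_points fst S D1")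
      case True
      then have "positive_branch_coordinates D1 D2 S x" using br by blast
      from adapted_chart_branch[OF pe(3) this od] show ?thesis unfolding x(2) T_def .
    next
      case False
      then have "local_diffeo_at fst S D1 x" using x(1) unfolding branch_points_def by blast
      from adapted_chart_regular[OF pe(2) x(1) pe(3) this d] show ?thesis unfolding x(2) T_def by blast
    qed
  qed
qed


section \<open>The symplectic surface\<close>

lemma cross_inner_lagrange: "(cross z u)\<^sup>2 + (z \<bullet> u)\<^sup>2 = (cmod z)\<^sup>2 * (cmod u)\<^sup>2"
  by (simp add: cross_def inner_complex_def cmod_power2) (simp add: power2_eq_square algebra_simps)

lemma abs_cross_orthogonal:
  assumes "z \<bullet> u = 0"
  shows "\<bar>cross z u\<bar> = cmod z * cmod u"
proof -
  have "(cross z u)\<^sup>2 = (cmod z * cmod u)\<^sup>2"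
    using cross_inner_lagrange[of z u] assms by (simp add: power_mult_distrib)
  then have "\<bar>cross z u\<bar> = \<bar>cmod z * cmod u\<bar>" by (simp only: abs_eq_iff power2_eq_iff)
  then show ?thesis by simp
qed

lemma abs_inner_parallel:
  assumes "cross z u = 0"
  shows "\<bar>z \<bullet> u\<bar> = cmod z * cmod u"
proof -
  have "(z \<bullet> u)\<^sup>2 = (cmod z * cmod u)\<^sup>2"
    using cross_inner_lagrange[of z u] assms by (simp add: power_mult_distrib)
  then have "\<bar>z \<bullet> u\<bar> = \<bar>cmod z * cmod u\<bar>" by (simp only: abs_eq_iff power2_eq_iff)
  then show ?thesis by simp
qed

lemma cross_decompose: "(cmod z)\<^sup>2 * cross u v = (z \<bullet> u) * cross z v - cross z u * (z \<bullet> v)"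
  by (simp add: cross_def inner_complex_def cmod_power2) (simp add: power2_eq_square algebra_simps)

text \<open>On boundary tangent vectors the horizontal part of the contact form has size \<open>r |d z|\<close>, while the
  slope bound \<open>C\<close> controls the vertical part.\<close>

lemma alpha_dominated:
  assumes q: "cmod (fst q) = r" "cmod (snd q) \<le> R" and sl: "cmod (snd \<tau>) \<le> C * cmod (fst \<tau>)"
    and orth: "fst q \<bullet> fst \<tau> = 0" and small: "e\<^sup>2 * (R * C) < r" and nz: "fst \<tau> \<noteq> 0"
  shows "\<bar>e\<^sup>2 * cross (snd q) (snd \<tau>)\<bar> < \<bar>cross (fst q) (fst \<tau>)\<bar>"
proof -
  have "\<bar>e\<^sup>2 * cross (snd q) (snd \<tau>)\<bar> = e\<^sup>2 * \<bar>cross (snd q) (snd \<tau>)\<bar>" by (simp add: abs_mult)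
  also have "\<dots> \<le> e\<^sup>2 * (cmod (snd q) * cmod (snd \<tau>))"
    by (intro mult_left_mono abs_cross_le) simp
  also have "\<dots> \<le> e\<^sup>2 * (R * (C * cmod (fst \<tau>)))"
    using q(2) sl by (intro mult_left_mono mult_mono) (auto intro: order_trans[OF norm_ge_zero])
  also have "\<dots> = (e\<^sup>2 * (R * C)) * cmod (fst \<tau>)" by simp
  also have "\<dots> < r * cmod (fst \<tau>)" using small nz by (intro mult_strict_right_mono) auto
  also have "\<dots> = \<bar>cross (fst q) (fst \<tau>)\<bar>" by (simp add: abs_cross_orthogonal[OF orth] q(1))
  finally show ?thesis .
qed

lemma abs_beta_le:
  assumes q: "cmod (fst q) = r" "cmod (snd q) \<le> R" and C: "C \<ge> 0"
    and sl: "cmod (snd u) \<le> C * cmod (fst u)" "cmod (snd v) \<le> C * cmod (fst v)"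
  shows "\<bar>beta r q u v\<bar> \<le> (R\<^sup>2 + r\<^sup>2 * C\<^sup>2 + 2 * R * C * r) * (cmod (fst u) * cmod (fst v))"
proof -
  define a b where "a = cmod (fst u)" and "b = cmod (fst v)"
  have ab: "a \<ge> 0" "b \<ge> 0" by (simp_all add: a_def b_def)
  have R: "R \<ge> 0" using q(2) norm_ge_zero order_trans by blast
  have r: "r \<ge> 0" using q(1) by auto
  have "\<bar>(cmod (snd q))\<^sup>2 * cross (fst u) (fst v)\<bar> \<le> R\<^sup>2 * (a * b)"
    unfolding abs_mult a_def b_def using q(2) R
    by (intro mult_mono abs_cross_le) (auto intro: power_mono)
  moreover have "\<bar>r\<^sup>2 * cross (snd u) (snd v)\<bar> \<le> r\<^sup>2 * ((C * a) * (C * b))"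
    unfolding abs_mult a_def b_def abs_power2 using C
    by (intro mult_left_mono order_trans[OF abs_cross_le] mult_mono sl) auto
  moreover have in_le: "\<bar>snd q \<bullet> snd x\<bar> \<le> R * (C * cmod (fst x))" if "cmod (snd x) \<le> C * cmod (fst x)" for x :: "complex \<times> complex"
    by (rule order_trans[OF Cauchy_Schwarz_ineq2]) (use q(2) R that in \<open>auto intro: mult_mono\<close>)
  have cr_le: "\<bar>cross (fst q) (fst x)\<bar> \<le> r * cmod (fst x)" for x :: "complex \<times> complex"
    using abs_cross_le[of "fst q" "fst x"] q(1) by simp
  have "\<bar>(snd q \<bullet> snd v) * cross (fst q) (fst u)\<bar> \<le> (R * (C * b)) * (r * a)"
    unfolding abs_mult a_def b_def using C R
    by (intro mult_mono in_le[OF sl(2)] cr_le) auto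
  moreover have "\<bar>(snd q \<bullet> snd u) * cross (fst q) (fst v)\<bar> \<le> (R * (C * a)) * (r * b)"
    unfolding abs_mult a_def b_def using C R
    by (intro mult_mono in_le[OF sl(1)] cr_le) auto
  ultimately have "\<bar>beta r q u v\<bar> \<le> R\<^sup>2 * (a * b) + r\<^sup>2 * ((C * a) * (C * b)) + (R * (C * b)) * (r * a) + (R * (C * a)) * (r * b)"
    unfolding beta_def by linarith
  also have "\<dots> = (R\<^sup>2 + r\<^sup>2 * C\<^sup>2 + 2 * R * C * r) * (a * b)"
    by (simp add: algebra_simps power2_eq_square)
  finally show ?thesis by (simp add: a_def b_def)
qed

text \<open>At a boundary point the form \<open>r\<^sup>2 A\<^sub>z + e\<^sup>2 \<beta>\<close> orients the surface as its first projection does,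
  so that the induced boundary orientation is the counterclockwise one.\<close>

lemma boundary_orientation:
  assumes q: "cmod (fst q) = r" "cmod (snd q) \<le> R" and r: "r > 0" and C: "C \<ge> 0"
    and Tq: "subspace Tq" "\<And>u. u \<in> Tq \<Longrightarrow> cmod (snd u) \<le> C * cmod (fst u)"
    and small: "e\<^sup>2 * (R\<^sup>2 + r\<^sup>2 * C\<^sup>2 + 2 * R * C * r) < r\<^sup>2"
    and \<nu>: "\<nu> \<in> Tq" "fst q \<bullet> fst \<nu> > 0" and \<tau>: "\<tau> \<in> Tq" "fst q \<bullet> fst \<tau> = 0"
    and pos: "r\<^sup>2 * cross (fst \<nu>) (fst \<tau>) + e\<^sup>2 * beta r q \<nu> \<tau> > 0"
  shows "cross (fst q) (fst \<tau>) > 0"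
proof (rule ccontr)
  define K where "K = R\<^sup>2 + r\<^sup>2 * C\<^sup>2 + 2 * R * C * r"
  define t where "t = cross (fst q) (fst \<tau>)"
  define n where "n = fst q \<bullet> fst \<nu>"
  assume "\<not> cross (fst q) (fst \<tau>) > 0"
  then have t: "t \<le> 0" by (simp add: t_def)
  have n: "n > 0" using \<nu>(2) by (simp add: n_def)
  have nt: "r * cmod (fst \<tau>) = \<bar>t\<bar>"
    using abs_cross_orthogonal[OF \<tau>(2)] q(1) by (simp add: t_def)
  have cnt: "r\<^sup>2 * cross (fst \<nu>) (fst \<tau>) = n * t"
    using cross_decompose[of "fst q" "fst \<nu>" "fst \<tau>"] q(1) \<tau>(2) by (simp add: n_def t_def)
  show False
  proof (cases "t = 0")
    case True
    then have "fst \<tau> = 0" using nt r by simp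
    moreover from this have "snd \<tau> = 0" using Tq(2)[OF \<tau>(1)] by simp
    ultimately show False using pos by (simp add: beta_def cross_simps)
  next
    case False
    \<comment> \<open>Subtracting a multiple of \<open>\<tau>\<close> from \<open>\<nu>\<close> changes neither form, and makes the first component of
      \<open>\<nu>\<close> radial, hence of controlled length.\<close>
    define l where "l = cross (fst q) (fst \<nu>) / t"
    define \<mu> where "\<mu> = \<nu> - l *\<^sub>R \<tau>"
    have \<mu>: "\<mu> \<in> Tq" unfolding \<mu>_def using Tq(1) \<nu>(1) \<tau>(1) by (simp add: subspace_diff subspace_scale)
    have "cross (fst q) (fst \<mu>) = cross (fst q) (fst \<nu>) - l * t"
      by (simp add: \<mu>_def cross_def t_def algebra_simps)
    then have "cross (fst q) (fst \<mu>) = 0" using False by (simp add: l_def)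
    then have n\<mu>: "r * cmod (fst \<mu>) = n"
      using abs_inner_parallel[of "fst q" "fst \<mu>"] q(1) n \<tau>(2) by (simp add: \<mu>_def inner_diff_right n_def)
    have "beta r q \<nu> \<tau> = beta r q \<mu> \<tau>"
    proof -
      have "beta r q \<nu> \<tau> - beta r q \<mu> \<tau> = l * beta r q \<tau> \<tau>"
        unfolding \<mu>_def beta_def by (simp add: cross_def inner_diff_right algebra_simps)
      also have "beta r q \<tau> \<tau> = 0" by (simp add: beta_def cross_simps)
      finally show ?thesis by simp
    qed
    then have "\<bar>beta r q \<nu> \<tau>\<bar> \<le> K * (cmod (fst \<mu>) * cmod (fst \<tau>))"
      unfolding K_def using abs_beta_le[OF q C Tq(2)[OF \<mu>] Tq(2)[OF \<tau>(1)]] by simp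
    then have "e\<^sup>2 * \<bar>beta r q \<nu> \<tau>\<bar> \<le> e\<^sup>2 * (K * (cmod (fst \<mu>) * cmod (fst \<tau>)))"
      by (rule mult_left_mono) simp
    also have "\<dots> = (e\<^sup>2 * K) * (cmod (fst \<mu>) * cmod (fst \<tau>))" by simp
    also have "\<dots> < r\<^sup>2 * (cmod (fst \<mu>) * cmod (fst \<tau>))"
    proof (rule mult_strict_right_mono)
      show "e\<^sup>2 * K < r\<^sup>2" using small by (simp add: K_def)
      show "0 < cmod (fst \<mu>) * cmod (fst \<tau>)"
        using n\<mu> nt n False r by (intro mult_pos_pos) (auto simp: zero_less_mult_iff)
    qed
    also have "\<dots> = n * \<bar>t\<bar>" unfolding n\<mu>[symmetric] nt[symmetric] by (simp add: power2_eq_square)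
    finally have "e\<^sup>2 * \<bar>beta r q \<nu> \<tau>\<bar> < - (n * t)" using t by simp
    moreover have "e\<^sup>2 * beta r q \<nu> \<tau> \<le> e\<^sup>2 * \<bar>beta r q \<nu> \<tau>\<bar>" by (intro mult_left_mono) auto
    ultimately show False using pos cnt by linarith
  qed
qed

lemma cross_surj:
  assumes "linear A" "cross (A 1) (A \<i>) \<noteq> 0"
  shows "\<exists>v. A v = y"
proof
  let ?d = "cross (A 1) (A \<i>)"
  have "A ((cross y (A \<i>) / ?d) *\<^sub>R 1 + (cross (A 1) y / ?d) *\<^sub>R \<i>)
      = (1 / ?d) *\<^sub>R (cross y (A \<i>) *\<^sub>R A 1 + cross (A 1) y *\<^sub>R A \<i>)"
    unfolding linear_add[OF assms(1)] linear_scale[OF assms(1)] by (simp add: scaleR_add_right)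
  also have "\<dots> = y" unfolding cross_cramer[symmetric] using assms(2) by simp
  finally show "A ((cross y (A \<i>) / ?d) *\<^sub>R 1 + (cross (A 1) y / ?d) *\<^sub>R \<i>) = y" .
qed

theorem mainTheorem3:
  fixes D1 D2 :: "complex set"
    and r1 r2 :: real
    and \<phi>1 \<phi>2 :: "complex \<Rightarrow> complex"
    and S :: "(complex \<times> complex) set"
  assumes "disk_identification D1 r1 \<phi>1"
    and "disk_identification D2 r2 \<phi>2"
    and "braided_surface D1 D2 S"
  shows "\<exists>S''. symplectic_surface S'' \<and> positively_transverse_boundary S'' \<and>
           isotopic_to_braided r1 \<phi>1 r2 \<phi>2 S'' S"
proof -
  define T where "T = map_prod \<phi>1 \<phi>2 ` S"
  note R = round_braided_surface[OF assms, folded T_def]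
  have r1: "r1 > 0" and r2: "r2 > 0" using assms(1,2) by (simp_all add: disk_identification_def)
  let ?tT = "tangent_space half_plane T"
  define L where "L = surface_boundary T"
  have LT: "L \<subseteq> T" unfolding L_def by (rule surface_boundary_subset)
  have Lr: "q \<in> L \<longleftrightarrow> q \<in> T \<and> cmod (fst q) = r1" for q unfolding L_def R(4) by simp
  have Tsnd: "cmod (snd q) < r2" and Tfst: "cmod (fst q) \<le> r1" if "q \<in> T" for q
    using subsetD[OF R(3) that] by (cases q, simp)+
  have "compact L"
  proof -
    have "L = T \<inter> (\<lambda>q. cmod (fst q)) -` {r1}" using Lr by auto
    moreover have "closed ((\<lambda>q :: complex \<times> complex. cmod (fst q)) -` {r1})"
      by (intro closed_vimage continuous_intros)
    ultimately show ?thesis using R(1) by (simp add: compact_Int_closed)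
  qed
  have "\<exists>e0>0. \<forall>e\<in>{0<..<e0}. \<forall>q\<in>T. \<exists>u\<in>?tT q. \<exists>v\<in>?tT q.
      r1\<^sup>2 * cross (fst u) (fst v) + e\<^sup>2 * beta r1 q u v \<noteq> 0"
  proof (rule compact_uniform_parameter[OF R(1)])
    fix x assume "x \<in> T"
    then obtain F V W a where "adapted_chart T F V W a x" using R(5) by metis
    from symplectic_near[OF this r1]
    show "\<exists>O' e0. open O' \<and> x \<in> O' \<and> 0 < e0 \<and> (\<forall>e\<in>{0<..<e0}. \<forall>q\<in>T \<inter> O'.
      \<exists>u\<in>?tT q. \<exists>v\<in>?tT q. r1\<^sup>2 * cross (fst u) (fst v) + e\<^sup>2 * beta r1 q u v \<noteq> 0)" .
  qed
  then obtain e0 where e0: "e0 > 0" "\<And>e q. 0 < e \<Longrightarrow> e < e0 \<Longrightarrow> q \<in> T \<Longrightarrow> \<exists>u\<in>?tT q. \<exists>v\<in>?tT q.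
      r1\<^sup>2 * cross (fst u) (fst v) + e\<^sup>2 * beta r1 q u v \<noteq> 0" by (metis greaterThanLessThan_iff)
  have "\<exists>c0>0. \<forall>c\<in>{0<..<c0}. \<forall>q\<in>L. \<forall>\<tau>\<in>?tT q. c * cmod (snd \<tau>) \<le> cmod (fst \<tau>)"
  proof (rule compact_uniform_parameter[OF \<open>compact L\<close>])
    fix x assume x: "x \<in> L"
    then obtain F V W a where ch: "adapted_chart T F V W a x"
      "cross (fst (frechet_derivative F (at a) 1)) (fst (frechet_derivative F (at a) \<i>)) \<noteq> 0"
      using R(6) Lr by metis
    have "local_param half_plane T F V a x" "Cinf_on F W" "V \<subseteq> W"
      using ch(1) by (simp_all add: adapted_chart_def)
    from slope_near[OF this ch(2)]
    show "\<exists>O' e0. open O' \<and> x \<in> O' \<and> 0 < e0 \<and> (\<forall>e\<in>{0<..<e0}. \<forall>q\<in>L \<inter> O'.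
      \<forall>\<tau>\<in>?tT q. e * cmod (snd \<tau>) \<le> cmod (fst \<tau>))" using LT by blast
  qed
  then obtain c0 where c0: "c0 > 0" "\<forall>c\<in>{0<..<c0}. \<forall>q\<in>L. \<forall>\<tau>\<in>?tT q. c * cmod (snd \<tau>) \<le> cmod (fst \<tau>)"
    by blast
  \<comment> \<open>The slope bound holds for parameters strictly below \<open>c0\<close>, such as \<open>c0 / 2\<close>.\<close>
  define C where "C = 2 / c0"
  have C: "C \<ge> 0" using c0(1) by (simp add: C_def)
  have slope: "cmod (snd \<tau>) \<le> C * cmod (fst \<tau>)" if "q \<in> L" "\<tau> \<in> ?tT q" for q \<tau>
  proof -
    have "c0 / 2 \<in> {0<..<c0}" using c0(1) by simp
    then have "c0 / 2 * cmod (snd \<tau>) \<le> cmod (fst \<tau>)" using c0(2) that by blast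
    then show ?thesis using c0(1) by (simp add: C_def field_simps)
  qed
  define K where "K = r2\<^sup>2 + r1\<^sup>2 * C\<^sup>2 + 2 * r2 * C * r1"
  have small: "eventually (\<lambda>e. e\<^sup>2 * k < m) (at_right 0)" if "m > 0" for k m :: real
  proof -
    have "((\<lambda>e. e\<^sup>2 * k) \<longlongrightarrow> 0\<^sup>2 * k) (at_right 0)" by (intro tendsto_intros)
    then show ?thesis using that by (intro order_tendstoD(2)[of _ "0\<^sup>2 * k"]) auto
  qed
  have "eventually (\<lambda>e. e \<in> {0<..<e0}) (at_right 0)" using e0(1) by (rule eventually_at_rightI[rotated]) 
  then have "eventually (\<lambda>e. e \<in> {0<..<e0} \<and> e\<^sup>2 * (r2 * C) < r1 \<and> e\<^sup>2 * K < r1\<^sup>2) (at_right 0)"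
    using r1 by (intro eventually_conj small) auto
  then obtain e where e: "0 < e" "e < e0" "e\<^sup>2 * (r2 * C) < r1" "e\<^sup>2 * K < r1\<^sup>2"
    by (metis (no_types, lifting) eventually_happens' trivial_limit_at_right_real greaterThanLessThan_iff)
  let ?Q = "flatten r1 e" and ?Q' = "flatten' r1 e"
  have dQ: "diffeo ?Q UNIV {p. cmod (snd p) < 1}" by (rule diffeo_flatten[OF r1 e(1)])
  note Qd = flatten_has_derivative[OF r1 e(1)]
  define S2 where "S2 = ?Q ` T"
  have subm: "submanifold half_plane S2"
    unfolding S2_def by (rule submanifold_image[OF dQ subset_UNIV R(2)])
  have bS2: "surface_boundary S2 = ?Q ` L"
    unfolding S2_def L_def by (rule surface_boundary_image[OF dQ subset_UNIV])
  have tS2: "tangent_space half_plane S2 (?Q q) = ?Q' q ` ?tT q" if "q \<in> T" for q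
    unfolding S2_def by (rule tangent_space_image[OF directionally_full_half_plane dQ subset_UNIV R(2) that Qd])
  have rho: "r1\<^sup>2 + e\<^sup>2 * (cmod (snd q))\<^sup>2 > 0" for q :: "complex \<times> complex"
    by (rule flatten_denominator_pos[OF r1 e(1)])
  have S2D: "S2 \<subseteq> D4"
    unfolding S2_def D4_eq using Tfst by (auto simp: flatten_norm_le_1[OF r1 e(1)])
  have fr: "frontier D4 = sphere (0 :: complex \<times> complex) 1" by (simp add: D4_eq)
  have pe: "properly_embedded_surface S2 D4"
    unfolding properly_embedded_surface_def
  proof (intro conjI ballI)
    show "compact S2"
      unfolding S2_def using R(1) smooth_on_continuous[OF diffeo_smooth[OF dQ]]
      by (intro compact_continuous_image) (auto intro: continuous_on_subset)
    show "submanifold half_plane S2" by (rule subm)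
    show "S2 \<subseteq> D4" by (rule S2D)
    have "?Q ` L = ?Q ` T \<inter> sphere 0 1"
    proof
      show "?Q ` L \<subseteq> ?Q ` T \<inter> sphere 0 1" using Lr by (auto simp: flatten_norm_eq_1[OF r1 e(1)])
      have "?Q q \<in> ?Q ` L" if "q \<in> T" "norm (?Q q) = 1" for q
        using that Lr[of q] flatten_norm_eq_1[OF r1 e(1), of q] by (intro imageI) simp
      then show "?Q ` T \<inter> sphere 0 1 \<subseteq> ?Q ` L" by auto
    qed
    then show "surface_boundary S2 = S2 \<inter> frontier D4"
      unfolding bS2 fr by (simp add: S2_def)
    fix x assume "x \<in> surface_boundary S2"
    then obtain q where q: "q \<in> L" "x = ?Q q" unfolding bS2 by blast
    then have qT: "q \<in> T" "cmod (fst q) = r1" using Lr by auto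
    obtain F V W a where ch: "adapted_chart T F V W a q"
      "cross (fst (frechet_derivative F (at a) 1)) (fst (frechet_derivative F (at a) \<i>)) \<noteq> 0"
      using R(6)[OF qT] by blast
    let ?A = "frechet_derivative F (at a)"
    have lp: "local_param half_plane T F V a q" and F: "Cinf_on F W" "V \<subseteq> W"
      using ch(1) by (simp_all add: adapted_chart_def)
    have a: "a \<in> V" "F a = q" using lp by (simp_all add: local_param_def)
    then have "linear ?A" using Cinf_on_derivative(1)[OF F(1)] F(2) has_derivative_linear by blast
    then have "linear (\<lambda>v. fst (?A v))" using linear_compose[OF _ linear_fst] by (auto simp: o_def)
    then obtain v where v: "fst (?A v) = - fst q" using cross_surj[OF _ ch(2)] by blast
    have vT: "?A v \<in> ?tT q" using tangent_space_extended_chart[OF lp F a(1)] a(2) by auto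
    have "x \<bullet> ?Q' q (?A v) = (fst q \<bullet> fst (?A v)) / (r1\<^sup>2 + e\<^sup>2 * (cmod (snd q))\<^sup>2)"
      unfolding q(2) by (rule inner_flatten[OF r1 e(1) qT(2)])
    also have "\<dots> = - (r1\<^sup>2 / (r1\<^sup>2 + e\<^sup>2 * (cmod (snd q))\<^sup>2))"
      using qT(2) by (simp add: v power2_norm_eq_inner[symmetric])
    also have "\<dots> < 0" using rho[of q] r1 by simp
    finally have neg: "x \<bullet> ?Q' q (?A v) < 0" .
    have "norm x = 1" using qT(2) by (simp add: q(2) flatten_norm_eq_1[OF r1 e(1)])
    from inward_ball_subset[OF this neg]
    show "\<exists>v\<in>tangent_space half_plane S2 x. \<exists>e>0. \<forall>t\<in>{0<..<e}. ball (x + t *\<^sub>R v) (e * t) \<subseteq> D4"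
      unfolding D4_eq using tS2[OF qT(1)] vT q(2) by blast
  qed
  have symp: "symplectic_surface S2"
    unfolding symplectic_surface_def
  proof (intro conjI ballI pe)
    fix x assume "x \<in> S2"
    then obtain q where q: "q \<in> T" "x = ?Q q" unfolding S2_def by blast
    obtain u v where uv: "u \<in> ?tT q" "v \<in> ?tT q"
      "r1\<^sup>2 * cross (fst u) (fst v) + e\<^sup>2 * beta r1 q u v \<noteq> 0" using e0(2)[OF e(1,2) q(1)] by blast
    have "omega_st (?Q' q u) (?Q' q v) \<noteq> 0"
      unfolding omega_flatten[OF r1 e(1)] using uv(3) rho[of q] by simp
    then show "\<exists>u\<in>tangent_space half_plane S2 x. \<exists>v\<in>tangent_space half_plane S2 x. omega_st u v \<noteq> 0"
      using tS2[OF q(1)] uv(1,2) q(2) by blast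
  qed
  have Lsph: "surface_boundary S2 \<subseteq> sphere 0 1"
    using pe unfolding properly_embedded_surface_def fr by blast
  have tang: "\<exists>\<tau>0\<in>?tT q. \<tau> = ?Q' q \<tau>0 \<and> fst q \<bullet> fst \<tau>0 = 0"
    if q: "q \<in> L" and \<tau>: "\<tau> \<in> tangent_space (UNIV :: real set) (surface_boundary S2) (?Q q)" for q \<tau>
  proof -
    have qT: "q \<in> T" "cmod (fst q) = r1" using q Lr by auto
    have "?Q q \<in> S2" using qT(1) by (simp add: S2_def)
    then have "\<tau> \<in> tangent_space half_plane S2 (?Q q)"
      using tangent_space_surface_boundary[OF subm] \<tau> by blast
    then obtain \<tau>0 where \<tau>0: "\<tau>0 \<in> ?tT q" "\<tau> = ?Q' q \<tau>0" using tS2[OF qT(1)] by blast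
    have "?Q q \<bullet> \<tau> = 0" by (rule tangent_to_sphere[OF Lsph \<tau>])
    then have "fst q \<bullet> fst \<tau>0 = 0"
      using inner_flatten[OF r1 e(1) qT(2), of \<tau>0] rho[of q] by (simp add: \<tau>0(2))
    then show ?thesis using \<tau>0 by blast
  qed
  have zero: "?Q' q \<tau> = 0" if "q \<in> L" "\<tau> \<in> ?tT q" "fst \<tau> = 0" for q \<tau>
  proof -
    have "snd \<tau> = 0" using slope[OF that(1,2)] that(3) by simp
    then show ?thesis using that(3) by (simp add: flatten'_def zero_prod_def)
  qed
  have transv: "transverse_link (surface_boundary S2)"
    unfolding transverse_link_def
  proof (intro conjI ballI impI)
    show "compact (surface_boundary S2)"
      unfolding bS2 using \<open>compact L\<close> smooth_on_continuous[OF diffeo_smooth[OF dQ]]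
      by (intro compact_continuous_image) (auto intro: continuous_on_subset)
    show "submanifold (UNIV :: real set) (surface_boundary S2)" by (rule submanifold_surface_boundary[OF subm])
    show "surface_boundary S2 \<subseteq> frontier D4" using Lsph fr by simp
    fix x \<tau> assume x: "x \<in> surface_boundary S2"
      and \<tau>: "\<tau> \<in> tangent_space (UNIV :: real set) (surface_boundary S2) x" "\<tau> \<noteq> 0"
    from x obtain q where q: "q \<in> L" "x = ?Q q" unfolding bS2 by blast
    then have qT: "q \<in> T" "cmod (fst q) = r1" using Lr by auto
    obtain \<tau>0 where \<tau>0: "\<tau>0 \<in> ?tT q" "\<tau> = ?Q' q \<tau>0" "fst q \<bullet> fst \<tau>0 = 0"
      using tang[OF q(1)] \<tau>(1) q(2) by blast
    have "fst \<tau>0 \<noteq> 0" using zero[OF q(1) \<tau>0(1)] \<tau>(2) \<tau>0(2) by blast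
    from alpha_dominated[OF qT(2) less_imp_le[OF Tsnd[OF qT(1)]] slope[OF q(1) \<tau>0(1)] \<tau>0(3) e(3) this]
    have "cross (fst q) (fst \<tau>0) + e\<^sup>2 * cross (snd q) (snd \<tau>0) \<noteq> 0" by linarith
    then have "alpha_st x \<tau> \<noteq> 0"
      unfolding q(2) \<tau>0(2) alpha_flatten[OF r1 e(1)] using rho[of q] by simp
    then show "\<tau> \<notin> xi_st x" by (simp add: xi_st_def)
  qed
  have posb: "positively_transverse_boundary S2"
    unfolding positively_transverse_boundary_def
  proof (intro conjI ballI impI transv)
    fix x \<tau> \<nu> assume x: "x \<in> surface_boundary S2"
      and \<tau>: "\<tau> \<in> tangent_space (UNIV :: real set) (surface_boundary S2) x"
      and \<nu>: "\<nu> \<in> tangent_space half_plane S2 x" and pos: "0 < x \<bullet> \<nu> \<and> 0 < omega_st \<nu> \<tau>"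
    from x obtain q where q: "q \<in> L" "x = ?Q q" unfolding bS2 by blast
    then have qT: "q \<in> T" "cmod (fst q) = r1" using Lr by auto
    note qr2 = less_imp_le[OF Tsnd[OF qT(1)]]
    obtain \<tau>0 where \<tau>0: "\<tau>0 \<in> ?tT q" "\<tau> = ?Q' q \<tau>0" "fst q \<bullet> fst \<tau>0 = 0"
      using tang[OF q(1)] \<tau> q(2) by blast
    obtain \<nu>0 where \<nu>0: "\<nu>0 \<in> ?tT q" "\<nu> = ?Q' q \<nu>0" using \<nu> tS2[OF qT(1)] q(2) by blast
    have n: "fst q \<bullet> fst \<nu>0 > 0"
      using pos rho[of q] unfolding q(2) \<nu>0(2) inner_flatten[OF r1 e(1) qT(2)]
      by (simp add: zero_less_divide_iff)
    have w: "r1\<^sup>2 * cross (fst \<nu>0) (fst \<tau>0) + e\<^sup>2 * beta r1 q \<nu>0 \<tau>0 > 0"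
      using pos rho[of q] unfolding \<tau>0(2) \<nu>0(2) omega_flatten[OF r1 e(1)]
      by (simp add: zero_less_divide_iff)
    have cr: "cross (fst q) (fst \<tau>0) > 0"
      by (rule boundary_orientation[OF qT(2) qr2 r1 C subspace_tangent_space[OF R(2) qT(1)]
            slope[OF q(1)] e(4)[unfolded K_def] \<nu>0(1) n \<tau>0(1,3) w])
    then have "fst \<tau>0 \<noteq> 0" by (auto simp: cross_simps)
    from alpha_dominated[OF qT(2) qr2 slope[OF q(1) \<tau>0(1)] \<tau>0(3) e(3) this]
    have "cross (fst q) (fst \<tau>0) + e\<^sup>2 * cross (snd q) (snd \<tau>0) > 0" using cr by linarith
    then show "alpha_st x \<tau> > 0"
      unfolding q(2) \<tau>0(2) alpha_flatten[OF r1 e(1)] using rho[of q] by simp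
  qed
  obtain y1 where y1: "0 \<le> y1" "y1 < r2\<^sup>2" "\<forall>q\<in>T. (cmod (snd q))\<^sup>2 < y1"
  proof (cases "T = {}")
    case True
    then show ?thesis using that[of 0] r2 by simp
  next
    case False
    have "continuous_on T (\<lambda>q. (cmod (snd q))\<^sup>2)" by (intro continuous_intros)
    then obtain p where p: "p \<in> T" "\<forall>q\<in>T. (cmod (snd q))\<^sup>2 \<le> (cmod (snd p))\<^sup>2"
      using continuous_attains_sup[OF R(1) False] by blast
    have "(cmod (snd p))\<^sup>2 < r2\<^sup>2" using Tsnd[OF p(1)] by (simp add: power_strict_mono)
    then obtain y where y: "(cmod (snd p))\<^sup>2 < y" "y < r2\<^sup>2" using dense by blast
    have "0 \<le> y" using y(1) zero_le_power2[of "cmod (snd p)"] by linarith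
    moreover have "\<forall>q\<in>T. (cmod (snd q))\<^sup>2 < y" using p(2) y(1) le_less_trans by blast
    ultimately show ?thesis using that y(2) by blast
  qed
  have "T \<subseteq> cball 0 r1 \<times> cball 0 r2" using R(3) ball_subset_cball by blast
  from exists_radial_identification[OF r1 r2 y1(1,2) this y1(3)]
  obtain X h where h: "radial_identification r1 r2 T X h"
    "\<forall>q\<in>T. h q = (1 / sqrt (r1\<^sup>2 + (cmod (snd q))\<^sup>2)) *\<^sub>R q" by blast
  have "squeeze e ` h ` T = S2"
    unfolding S2_def image_image
    by (rule image_cong[OF refl]) (use h(2) squeeze_radial[OF r1 e(1)] in simp)
  then have "ambient_isotopic D4 (h ` T) S2" using squeeze_isotopy[OF e(1), of "h ` T"] by simp
  then have "isotopic_to_braided r1 \<phi>1 r2 \<phi>2 S2 S"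
    unfolding isotopic_to_braided_def Let_def using h(1) unfolding T_def by blast
  then show ?thesis using symp posb by blast
qed


end
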